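(* Let $M=\Gamma\backslash G$ be a compact quotient of a simply-connected $4$-dimensional real Lie group $G$ by a uniform discrete subgroup $\Gamma\subset G$, and let $J$ be an almost complex structure on the Lie algebra $\mathfrak{g}$ of $G$ (which also denotes the induced left-invariant almost complex structure on $M$). Assume that $H^2(\mathfrak{g})\cong H^2(M)$. Then $$H_J^+(M)=H_J^+(\mathfrak{g}),\qquad H_J^-(M)=H_J^-(\mathfrak{g}),$$ under the natural homomorphisms $H_J^\pm(\mathfrak{g})\to H_J^\pm(M)$ induced by regarding forms on $\mathfrak{g}$ as left-invariant forms on $M$.
   Context: $H^*(\mathfrak{g})$ is the Chevalley–Eilenberg cohomology of $(\Lambda^*(\mathfrak{g}^* ),d)$, $d\phi(u,v)=-\phi([u,v])$ on $1$-forms; $H^2(M)=H^2(M;\mathbb{R})$ is de Rham cohomology. An almost complex structure on $\mathfrak{g}$ is a linear automorphism $J$ of the vector space $\mathfrak{g}$ with $J^2=-\mathrm{id}$. $H_J^{\pm}(\mathfrak{g})\subset H^2(\mathfrak{g})$ is the subspace of classes representable by a closed $2$-form $\alpha$ on $\mathfrak{g}$ with $\alpha(J\cdot,J\cdot)=\pm\alpha(\cdot,\cdot)$. Likewise $H_J^\pm(M)\subset H^2(M;\mathbb{R})$ is the subspace of classes representable by a closed real smooth $2$-form $\alpha$ on $M$ with $\alpha(J\cdot,J\cdot)=\pm\alpha(\cdot,\cdot)$. *)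

theory Defs
  imports "HOL-Analysis.Analysis" "HOL-Algebra.Coset" "HOL-Library.Function_Algebras"
begin

text \<open>Functions into a real vector space, with pointwise operations. Tangent vectors and
  differential forms below are functions of this kind.\<close>

instantiation "fun" :: (type, real_vector) real_vector
begin

definition scaleR_fun :: "real \<Rightarrow> ('a \<Rightarrow> 'b) \<Rightarrow> 'a \<Rightarrow> 'b"
  where "scaleR_fun c f = (\<lambda>x. c *\<^sub>R f x)"

instance
  by standard (auto simp: scaleR_fun_def plus_fun_def fun_eq_iff algebra_simps)

end


section \<open>Smooth manifolds\<close>

text \<open>\<open>Ck_on k S f\<close> is meant for open \<open>S\<close> in a finite-dimensional space.\<close>

primrec Ck_on :: "nat \<Rightarrow> 'e::real_normed_vector set \<Rightarrow> ('e \<Rightarrow> 'f::real_normed_vector) \<Rightarrow> bool" where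
  "Ck_on 0 S f \<longleftrightarrow> continuous_on S f"
| "Ck_on (Suc k) S f \<longleftrightarrow>
     f differentiable_on S \<and> (\<forall>v. Ck_on k S (\<lambda>x. frechet_derivative f (at x) v))"

definition smooth_on :: "'e::real_normed_vector set \<Rightarrow> ('e \<Rightarrow> 'f::real_normed_vector) \<Rightarrow> bool"
  where "smooth_on S f \<longleftrightarrow> (\<forall>k. Ck_on k S f)"

text \<open>A smooth structure is given by an atlas, which need not be maximal. A chart is a pair of its
  domain and a map that is only relevant on that domain.\<close>

record ('a, 'e) mfd =
  mtop :: "'a topology"
  charts :: "('a set \<times> ('a \<Rightarrow> 'e)) set"

abbreviation points :: "('a, 'e) mfd \<Rightarrow> 'a set"
  where "points M \<equiv> topspace (mtop M)"

definition smooth_manifold :: "('a, 'e::euclidean_space) mfd \<Rightarrow> bool" where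
  "smooth_manifold M \<longleftrightarrow>
     Hausdorff_space (mtop M) \<and> second_countable (mtop M) \<and>
     (\<Union>(U, \<phi>)\<in>charts M. U) = points M \<and>
     (\<forall>(U, \<phi>)\<in>charts M. openin (mtop M) U \<and> open (\<phi> ` U) \<and>
        homeomorphic_map (subtopology (mtop M) U) (top_of_set (\<phi> ` U)) \<phi>) \<and>
     (\<forall>(U, \<phi>)\<in>charts M. \<forall>(V, \<psi>)\<in>charts M. smooth_on (\<phi> ` (U \<inter> V)) (\<psi> \<circ> inv_into U \<phi>))"

definition prod_mfd :: "('a, 'e) mfd \<Rightarrow> ('b, 'f) mfd \<Rightarrow> ('a \<times> 'b, 'e \<times> 'f) mfd" where
  "prod_mfd M N =
     \<lparr>mtop = prod_topology (mtop M) (mtop N),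
      charts = {(U \<times> V, map_prod \<phi> \<psi>) | U \<phi> V \<psi>. (U, \<phi>) \<in> charts M \<and> (V, \<psi>) \<in> charts N}\<rparr>"

definition smooth_map ::
  "('a, 'e::euclidean_space) mfd \<Rightarrow> ('b, 'f::euclidean_space) mfd \<Rightarrow> ('a \<Rightarrow> 'b) \<Rightarrow> bool" where
  "smooth_map M N F \<longleftrightarrow>
     continuous_map (mtop M) (mtop N) F \<and>
     (\<forall>(U, \<phi>)\<in>charts M. \<forall>(V, \<psi>)\<in>charts N.
        smooth_on (\<phi> ` (U \<inter> F -` V)) (\<psi> \<circ> F \<circ> inv_into U \<phi>))"

text \<open>Values of the function outside \<open>points M\<close> are irrelevant.\<close>

definition smooth_fun :: "('a, 'e::euclidean_space) mfd \<Rightarrow> ('a \<Rightarrow> real) \<Rightarrow> bool" where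
  "smooth_fun M f \<longleftrightarrow> (\<forall>(U, \<phi>)\<in>charts M. smooth_on (\<phi> ` U) (f \<circ> inv_into U \<phi>))"

text \<open>Tangent vectors at \<open>p\<close> are derivations at \<open>p\<close> of the algebra of smooth functions; since a
  HOL function is total, they are set to \<open>0\<close> on non-smooth functions. (The Leibniz rule
  makes them insensitive to the values of functions outside \<open>points M\<close>.)\<close>

definition tangent_space ::
  "('a, 'e::euclidean_space) mfd \<Rightarrow> 'a \<Rightarrow> (('a \<Rightarrow> real) \<Rightarrow> real) set" where
  "tangent_space M p = {v.
     (\<forall>f. \<not> smooth_fun M f \<longrightarrow> v f = 0) \<and>
     (\<forall>f g. smooth_fun M f \<longrightarrow> smooth_fun M g \<longrightarrow> v (\<lambda>x. f x + g x) = v f + v g) \<and>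
     (\<forall>c f. smooth_fun M f \<longrightarrow> v (\<lambda>x. c * f x) = c * v f) \<and>
     (\<forall>f g. smooth_fun M f \<longrightarrow> smooth_fun M g \<longrightarrow> v (\<lambda>x. f x * g x) = f p * v g + g p * v f)}"

text \<open>The differential of a smooth map \<open>F\<close> into \<open>N\<close>, applied to a tangent vector \<open>v\<close> of the source.\<close>

definition pushforward ::
  "('b, 'f::euclidean_space) mfd \<Rightarrow> ('a \<Rightarrow> 'b) \<Rightarrow> (('a \<Rightarrow> real) \<Rightarrow> real) \<Rightarrow> ('b \<Rightarrow> real) \<Rightarrow> real" where
  "pushforward N F v = (\<lambda>f. if smooth_fun N f then v (f \<circ> F) else 0)"

definition smooth_vf ::
  "('a, 'e::euclidean_space) mfd \<Rightarrow> ('a \<Rightarrow> ('a \<Rightarrow> real) \<Rightarrow> real) \<Rightarrow> bool" where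
  "smooth_vf M X \<longleftrightarrow>
     (\<forall>p\<in>points M. X p \<in> tangent_space M p) \<and>
     (\<forall>f. smooth_fun M f \<longrightarrow> smooth_fun M (\<lambda>p. X p f))"

definition vf_bracket ::
  "('a \<Rightarrow> ('a \<Rightarrow> real) \<Rightarrow> real) \<Rightarrow> ('a \<Rightarrow> ('a \<Rightarrow> real) \<Rightarrow> real) \<Rightarrow> 'a \<Rightarrow> ('a \<Rightarrow> real) \<Rightarrow> real" where
  "vf_bracket X Y = (\<lambda>p f. X p (\<lambda>q. Y q f) - Y p (\<lambda>q. X q f))"


section \<open>Linear and alternating bilinear forms on a subspace\<close>

text \<open>Forms are normalised to vanish off the subspace, so that equality of forms is equality of
  HOL functions.\<close>

definition linear_forms :: "'v::real_vector set \<Rightarrow> ('v \<Rightarrow> real) set" where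
  "linear_forms V = {\<theta>.
     (\<forall>u. u \<notin> V \<longrightarrow> \<theta> u = 0) \<and>
     (\<forall>u\<in>V. \<forall>v\<in>V. \<theta> (u + v) = \<theta> u + \<theta> v) \<and>
     (\<forall>c. \<forall>u\<in>V. \<theta> (c *\<^sub>R u) = c * \<theta> u)}"

definition alt_forms2 :: "'v::real_vector set \<Rightarrow> ('v \<Rightarrow> 'v \<Rightarrow> real) set" where
  "alt_forms2 V = {\<alpha>.
     (\<forall>u v. u \<notin> V \<or> v \<notin> V \<longrightarrow> \<alpha> u v = 0) \<and>
     (\<forall>u\<in>V. \<alpha> u \<in> linear_forms V) \<and>
     (\<forall>u\<in>V. \<forall>v\<in>V. \<alpha> u v = - \<alpha> v u)}"


section \<open>Quotient vector spaces and their linear isomorphisms\<close>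

definition cls :: "'v::real_vector set \<Rightarrow> 'v \<Rightarrow> 'v set"
  where "cls B z = {z + b | b. b \<in> B}"

definition cls_add :: "'v::real_vector set \<Rightarrow> 'v set \<Rightarrow> 'v set"
  where "cls_add S T = {s + t | s t. s \<in> S \<and> t \<in> T}"

text \<open>The summand \<open>b\<close> only matters for \<open>c = 0\<close>.\<close>

definition cls_scale :: "'v::real_vector set \<Rightarrow> real \<Rightarrow> 'v set \<Rightarrow> 'v set"
  where "cls_scale B c S = {c *\<^sub>R s + b | s b. s \<in> S \<and> b \<in> B}"

text \<open>\<open>F\<close> is a linear isomorphism from \<open>P\<close> onto \<open>Q\<close>, where \<open>P\<close> is a subspace of a quotient
  modulo \<open>B\<close> and \<open>Q\<close> a subspace of a quotient modulo \<open>C\<close>.\<close>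

definition quot_iso ::
  "'v::real_vector set \<Rightarrow> 'w::real_vector set \<Rightarrow> 'v set set \<Rightarrow> 'w set set \<Rightarrow> ('v set \<Rightarrow> 'w set) \<Rightarrow> bool"
  where
  "quot_iso B C P Q F \<longleftrightarrow>
     bij_betw F P Q \<and>
     (\<forall>S\<in>P. \<forall>T\<in>P. F (cls_add S T) = cls_add (F S) (F T)) \<and>
     (\<forall>c. \<forall>S\<in>P. F (cls_scale B c S) = cls_scale C c (F S))"


section \<open>De Rham cohomology in degree two\<close>

type_synonym 'a tvec = "('a \<Rightarrow> real) \<Rightarrow> real"

definition one_forms :: "('a, 'e::euclidean_space) mfd \<Rightarrow> ('a \<Rightarrow> 'a tvec \<Rightarrow> real) set" where
  "one_forms M = {\<theta>.
     (\<forall>p\<in>points M. \<theta> p \<in> linear_forms (tangent_space M p)) \<and>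
     (\<forall>p. p \<notin> points M \<longrightarrow> \<theta> p = 0) \<and>
     (\<forall>X. smooth_vf M X \<longrightarrow> smooth_fun M (\<lambda>p. \<theta> p (X p)))}"

definition two_forms :: "('a, 'e::euclidean_space) mfd \<Rightarrow> ('a \<Rightarrow> 'a tvec \<Rightarrow> 'a tvec \<Rightarrow> real) set" where
  "two_forms M = {\<alpha>.
     (\<forall>p\<in>points M. \<alpha> p \<in> alt_forms2 (tangent_space M p)) \<and>
     (\<forall>p. p \<notin> points M \<longrightarrow> \<alpha> p = 0) \<and>
     (\<forall>X Y. smooth_vf M X \<longrightarrow> smooth_vf M Y \<longrightarrow> smooth_fun M (\<lambda>p. \<alpha> p (X p) (Y p)))}"

text \<open>The exterior derivative, evaluated on vector fields by the invariant formula.\<close>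

definition ext_d1 ::
  "('a \<Rightarrow> 'a tvec \<Rightarrow> real) \<Rightarrow> ('a \<Rightarrow> 'a tvec) \<Rightarrow> ('a \<Rightarrow> 'a tvec) \<Rightarrow> 'a \<Rightarrow> real" where
  "ext_d1 \<theta> X Y p =
     X p (\<lambda>q. \<theta> q (Y q)) - Y p (\<lambda>q. \<theta> q (X q)) - \<theta> p (vf_bracket X Y p)"

definition ext_d2 ::
  "('a \<Rightarrow> 'a tvec \<Rightarrow> 'a tvec \<Rightarrow> real) \<Rightarrow>
   ('a \<Rightarrow> 'a tvec) \<Rightarrow> ('a \<Rightarrow> 'a tvec) \<Rightarrow> ('a \<Rightarrow> 'a tvec) \<Rightarrow> 'a \<Rightarrow> real" where
  "ext_d2 \<alpha> X Y Z p =
     X p (\<lambda>q. \<alpha> q (Y q) (Z q)) - Y p (\<lambda>q. \<alpha> q (X q) (Z q)) + Z p (\<lambda>q. \<alpha> q (X q) (Y q))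
     - \<alpha> p (vf_bracket X Y p) (Z p) + \<alpha> p (vf_bracket X Z p) (Y p) - \<alpha> p (vf_bracket Y Z p) (X p)"

definition closed_forms :: "('a, 'e::euclidean_space) mfd \<Rightarrow> ('a \<Rightarrow> 'a tvec \<Rightarrow> 'a tvec \<Rightarrow> real) set" where
  "closed_forms M = {\<alpha>\<in>two_forms M.
     \<forall>X Y Z. smooth_vf M X \<longrightarrow> smooth_vf M Y \<longrightarrow> smooth_vf M Z \<longrightarrow>
       (\<forall>p\<in>points M. ext_d2 \<alpha> X Y Z p = 0)}"

definition exact_forms :: "('a, 'e::euclidean_space) mfd \<Rightarrow> ('a \<Rightarrow> 'a tvec \<Rightarrow> 'a tvec \<Rightarrow> real) set" where
  "exact_forms M = {\<alpha>\<in>two_forms M.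
     \<exists>\<theta>\<in>one_forms M. \<forall>X Y. smooth_vf M X \<longrightarrow> smooth_vf M Y \<longrightarrow>
       (\<forall>p\<in>points M. \<alpha> p (X p) (Y p) = ext_d1 \<theta> X Y p)}"

definition deRham_H2 ::
  "('a, 'e::euclidean_space) mfd \<Rightarrow> ('a \<Rightarrow> 'a tvec \<Rightarrow> 'a tvec \<Rightarrow> real) set set" where
  "deRham_H2 M = cls (exact_forms M) ` closed_forms M"

text \<open>For an almost complex structure \<open>J\<close> on \<open>M\<close>, the parameter \<open>s\<close> is \<open>1\<close> for the \<open>J\<close>-invariant
  and \<open>- 1\<close> for the \<open>J\<close>-anti-invariant classes.\<close>

definition deRham_HJ ::
  "real \<Rightarrow> ('a, 'e::euclidean_space) mfd \<Rightarrow> ('a \<Rightarrow> 'a tvec \<Rightarrow> 'a tvec) \<Rightarrow>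
   ('a \<Rightarrow> 'a tvec \<Rightarrow> 'a tvec \<Rightarrow> real) set set" where
  "deRham_HJ s M J = cls (exact_forms M) ` {\<alpha>\<in>closed_forms M.
     \<forall>p\<in>points M. \<forall>u\<in>tangent_space M p. \<forall>v\<in>tangent_space M p.
       \<alpha> p (J p u) (J p v) = s * \<alpha> p u v}"


section \<open>Lie groups and Lie algebras\<close>

definition lie_group :: "('a, 'b) monoid_scheme \<Rightarrow> ('a, 'e::euclidean_space) mfd \<Rightarrow> bool" where
  "lie_group G M \<longleftrightarrow>
     group G \<and> points M = carrier G \<and> smooth_manifold M \<and>
     smooth_map (prod_mfd M M) M (\<lambda>(x, y). x \<otimes>\<^bsub>G\<^esub> y) \<and>
     smooth_map M M (\<lambda>x. inv\<^bsub>G\<^esub> x)"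

abbreviation lie_algebra ::
  "('a, 'b) monoid_scheme \<Rightarrow> ('a, 'e::euclidean_space) mfd \<Rightarrow> 'a tvec set" where
  "lie_algebra G M \<equiv> tangent_space M \<one>\<^bsub>G\<^esub>"

definition left_inv_vf ::
  "('a, 'b) monoid_scheme \<Rightarrow> ('a, 'e::euclidean_space) mfd \<Rightarrow> 'a tvec \<Rightarrow> 'a \<Rightarrow> 'a tvec" where
  "left_inv_vf G M u = (\<lambda>g. pushforward M (\<lambda>x. g \<otimes>\<^bsub>G\<^esub> x) u)"

definition lie_bracket ::
  "('a, 'b) monoid_scheme \<Rightarrow> ('a, 'e::euclidean_space) mfd \<Rightarrow> 'a tvec \<Rightarrow> 'a tvec \<Rightarrow> 'a tvec" where
  "lie_bracket G M u v = vf_bracket (left_inv_vf G M u) (left_inv_vf G M v) \<one>\<^bsub>G\<^esub>"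

definition almost_complex_structure_on :: "'v::real_vector set \<Rightarrow> ('v \<Rightarrow> 'v) \<Rightarrow> bool" where
  "almost_complex_structure_on V J \<longleftrightarrow>
     (\<forall>u\<in>V. J u \<in> V \<and> J (J u) = - u) \<and>
     (\<forall>u\<in>V. \<forall>v\<in>V. J (u + v) = J u + J v) \<and>
     (\<forall>c. \<forall>u\<in>V. J (c *\<^sub>R u) = c *\<^sub>R J u)"


section \<open>Chevalley-Eilenberg cohomology in degree two\<close>

definition ce_d1 ::
  "'v::real_vector set \<Rightarrow> ('v \<Rightarrow> 'v \<Rightarrow> 'v) \<Rightarrow> ('v \<Rightarrow> real) \<Rightarrow> 'v \<Rightarrow> 'v \<Rightarrow> real" where
  "ce_d1 V br \<theta> = (\<lambda>u v. if u \<in> V \<and> v \<in> V then - \<theta> (br u v) else 0)"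

definition ce_d2 ::
  "('v \<Rightarrow> 'v \<Rightarrow> 'v) \<Rightarrow> ('v \<Rightarrow> 'v \<Rightarrow> real) \<Rightarrow> 'v \<Rightarrow> 'v \<Rightarrow> 'v \<Rightarrow> real" where
  "ce_d2 br \<alpha> u v w = - \<alpha> (br u v) w + \<alpha> (br u w) v - \<alpha> (br v w) u"

definition ce_closed :: "'v::real_vector set \<Rightarrow> ('v \<Rightarrow> 'v \<Rightarrow> 'v) \<Rightarrow> ('v \<Rightarrow> 'v \<Rightarrow> real) set" where
  "ce_closed V br = {\<alpha>\<in>alt_forms2 V. \<forall>u\<in>V. \<forall>v\<in>V. \<forall>w\<in>V. ce_d2 br \<alpha> u v w = 0}"

definition ce_exact :: "'v::real_vector set \<Rightarrow> ('v \<Rightarrow> 'v \<Rightarrow> 'v) \<Rightarrow> ('v \<Rightarrow> 'v \<Rightarrow> real) set" where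
  "ce_exact V br = ce_d1 V br ` linear_forms V"

definition ce_H2 :: "'v::real_vector set \<Rightarrow> ('v \<Rightarrow> 'v \<Rightarrow> 'v) \<Rightarrow> ('v \<Rightarrow> 'v \<Rightarrow> real) set set" where
  "ce_H2 V br = cls (ce_exact V br) ` ce_closed V br"

definition ce_HJ ::
  "real \<Rightarrow> 'v::real_vector set \<Rightarrow> ('v \<Rightarrow> 'v \<Rightarrow> 'v) \<Rightarrow> ('v \<Rightarrow> 'v) \<Rightarrow> ('v \<Rightarrow> 'v \<Rightarrow> real) set set" where
  "ce_HJ s V br J = cls (ce_exact V br) `
     {\<alpha>\<in>ce_closed V br. \<forall>u\<in>V. \<forall>v\<in>V. \<alpha> (J u) (J v) = s * \<alpha> u v}"


section \<open>Quotients by discrete subgroups\<close>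

text \<open>The library has simple connectedness only for subsets of type-class topological spaces; this
  is the same definition for abstract topologies: any two loops are freely homotopic, which
  includes path-connectedness.\<close>

definition simply_connected_space :: "'a topology \<Rightarrow> bool" where
  "simply_connected_space T \<longleftrightarrow>
     (\<forall>p q. pathin T p \<and> p 1 = p 0 \<and> pathin T q \<and> q 1 = q 0 \<longrightarrow>
        homotopic_with (\<lambda>r. r 1 = r 0) (top_of_set {0..1}) T p q)"

definition quotient_topology :: "'a topology \<Rightarrow> ('a \<Rightarrow> 'b) \<Rightarrow> 'b topology" where
  "quotient_topology T \<pi> =
     topology (\<lambda>W. W \<subseteq> \<pi> ` topspace T \<and> openin T {x \<in> topspace T. \<pi> x \<in> W})"

lemma openin_quotient_topology:
  "openin (quotient_topology T \<pi>) W \<longleftrightarrow>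
     W \<subseteq> \<pi> ` topspace T \<and> openin T {x \<in> topspace T. \<pi> x \<in> W}"
proof -
  have "istopology (\<lambda>W. W \<subseteq> \<pi> ` topspace T \<and> openin T {x \<in> topspace T. \<pi> x \<in> W})"
    unfolding istopology_def
  proof (intro conjI allI impI)
    fix A B
    assume A: "A \<subseteq> \<pi> ` topspace T \<and> openin T {x \<in> topspace T. \<pi> x \<in> A}"
      and B: "B \<subseteq> \<pi> ` topspace T \<and> openin T {x \<in> topspace T. \<pi> x \<in> B}"
    have "{x \<in> topspace T. \<pi> x \<in> A \<inter> B} =
        {x \<in> topspace T. \<pi> x \<in> A} \<inter> {x \<in> topspace T. \<pi> x \<in> B}" by auto
    then show "openin T {x \<in> topspace T. \<pi> x \<in> A \<inter> B}" using A B by auto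
    show "A \<inter> B \<subseteq> \<pi> ` topspace T" using A by auto
  next
    fix \<K>
    assume K: "\<forall>W\<in>\<K>. W \<subseteq> \<pi> ` topspace T \<and> openin T {x \<in> topspace T. \<pi> x \<in> W}"
    have "{x \<in> topspace T. \<pi> x \<in> \<Union>\<K>} = (\<Union>W\<in>\<K>. {x \<in> topspace T. \<pi> x \<in> W})" by auto
    then show "openin T {x \<in> topspace T. \<pi> x \<in> \<Union>\<K>}" using K by auto
    show "\<Union>\<K> \<subseteq> \<pi> ` topspace T" using K by auto
  qed
  then show ?thesis by (simp add: quotient_topology_def topology_inverse')
qed

text \<open>\<open>\<Gamma>\<setminus>G\<close> is the space of right cosets \<open>\<Gamma> #> g\<close>. Its charts are those of \<open>G\<close>, restricted to open
  sets on which the projection is injective.\<close>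

definition quotient_mfd ::
  "('a, 'b) monoid_scheme \<Rightarrow> ('a, 'e::euclidean_space) mfd \<Rightarrow> 'a set \<Rightarrow> ('a set, 'e) mfd" where
  "quotient_mfd G M \<Gamma> =
     (let \<pi> = (\<lambda>g. \<Gamma> #>\<^bsub>G\<^esub> g) in
      \<lparr>mtop = quotient_topology (mtop M) \<pi>,
       charts = {(\<pi> ` V, \<phi> \<circ> inv_into V \<pi>) | U \<phi> V.
         (U, \<phi>) \<in> charts M \<and> V \<subseteq> U \<and> openin (mtop M) V \<and> inj_on \<pi> V}\<rparr>)"

definition discrete_subgroup ::
  "('a, 'b) monoid_scheme \<Rightarrow> ('a, 'e::euclidean_space) mfd \<Rightarrow> 'a set \<Rightarrow> bool" where
  "discrete_subgroup G M \<Gamma> \<longleftrightarrow>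
     subgroup \<Gamma> G \<and> subtopology (mtop M) \<Gamma> = discrete_topology \<Gamma>"

text \<open>\<open>frame G M \<Gamma> p\<close> identifies the Lie algebra with the tangent space of the quotient at \<open>p\<close>:
  for \<open>p = \<Gamma> #> g\<close> the map \<open>x \<mapsto> p #> x = \<Gamma> #> (g \<otimes> x)\<close> is left translation by \<open>g\<close> followed by the
  projection, so this is the image of a left-invariant vector field, evaluated at \<open>p\<close>.\<close>

definition frame ::
  "('a, 'b) monoid_scheme \<Rightarrow> ('a, 'e::euclidean_space) mfd \<Rightarrow> 'a set \<Rightarrow>
   'a set \<Rightarrow> 'a tvec \<Rightarrow> 'a set tvec" where
  "frame G M \<Gamma> p = pushforward (quotient_mfd G M \<Gamma>) (\<lambda>x. p #>\<^bsub>G\<^esub> x)"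

definition coframe ::
  "('a, 'b) monoid_scheme \<Rightarrow> ('a, 'e::euclidean_space) mfd \<Rightarrow> 'a set \<Rightarrow>
   'a set \<Rightarrow> 'a set tvec \<Rightarrow> 'a tvec" where
  "coframe G M \<Gamma> p = inv_into (lie_algebra G M) (frame G M \<Gamma> p)"

definition induced_J ::
  "('a, 'b) monoid_scheme \<Rightarrow> ('a, 'e::euclidean_space) mfd \<Rightarrow> 'a set \<Rightarrow> ('a tvec \<Rightarrow> 'a tvec) \<Rightarrow>
   'a set \<Rightarrow> 'a set tvec \<Rightarrow> 'a set tvec" where
  "induced_J G M \<Gamma> J p w = frame G M \<Gamma> p (J (coframe G M \<Gamma> p w))"

definition left_inv_form ::
  "('a, 'b) monoid_scheme \<Rightarrow> ('a, 'e::euclidean_space) mfd \<Rightarrow> 'a set \<Rightarrow> ('a tvec \<Rightarrow> 'a tvec \<Rightarrow> real) \<Rightarrow>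
   'a set \<Rightarrow> 'a set tvec \<Rightarrow> 'a set tvec \<Rightarrow> real" where
  "left_inv_form G M \<Gamma> \<alpha> p u v =
     (let N = quotient_mfd G M \<Gamma> in
      if p \<in> points N \<and> u \<in> tangent_space N p \<and> v \<in> tangent_space N p
      then \<alpha> (coframe G M \<Gamma> p u) (coframe G M \<Gamma> p v) else 0)"

text \<open>The homomorphism \<open>[\<alpha>] \<mapsto> [left_inv_form \<alpha>]\<close>, as the union of the target classes over all
  representatives \<open>\<alpha>\<close>.\<close>

definition natural_hom ::
  "('a, 'b) monoid_scheme \<Rightarrow> ('a, 'e::euclidean_space) mfd \<Rightarrow> 'a set \<Rightarrow>
   ('a tvec \<Rightarrow> 'a tvec \<Rightarrow> real) set \<Rightarrow> ('a set \<Rightarrow> 'a set tvec \<Rightarrow> 'a set tvec \<Rightarrow> real) set" where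
  "natural_hom G M \<Gamma> S =
     (\<Union>\<alpha>\<in>S. cls (exact_forms (quotient_mfd G M \<Gamma>)) (left_inv_form G M \<Gamma> \<alpha>))"

end

theory Submission
  imports Defs
begin

text \<open>Let \<open>N\<close> be the quotient and \<open>\<gg>\<close> the Lie algebra. Regarding forms on \<open>\<gg>\<close> as left-invariant forms on \<open>N\<close>
is a map \<open>i\<close> that commutes with the differentials. The proof rests on an averaging map \<open>\<nu>\<close> in the
opposite direction (\<open>avg2\<close> below), which commutes with the differentials, satisfies \<open>\<nu> \<circ> i = id\<close>, and
maps \<open>J\<close>-(anti-)invariant forms to \<open>J\<close>-(anti-)invariant forms. Its existence makes \<open>i\<close> injective on
cohomology. Since \<open>H\<^sup>2(\<gg>)\<close> is finite-dimensional and abstractly isomorphic to \<open>H\<^sup>2(N)\<close>, the map \<open>i\<close> is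
then bijective on cohomology (\<open>injective_imp_surjective_quotient\<close>). If \<open>\<alpha>\<close> is a closed form on \<open>N\<close>,
then \<open>\<alpha>\<close> is cohomologous to some \<open>i \<beta>\<close>, so \<open>\<nu> \<alpha>\<close> is cohomologous to \<open>\<beta>\<close> and \<open>i (\<nu> \<alpha>)\<close> to \<open>\<alpha>\<close>. For a
\<open>J\<close>-(anti-)invariant \<open>\<alpha>\<close> this exhibits its class as the image of a class with a representative of the
same type (\<open>natural_hom_quot_iso\<close>).

\<^bold>\<open>The average.\<close> With the frame fields \<open>E\<^sub>u\<close> (the projections of the left-invariant fields), \<open>\<nu> \<alpha> (u, v)\<close>
is the mean of the function \<open>\<alpha>(E\<^sub>u, E\<^sub>v)\<close>. All that is needed of the mean is that it is a linear functional
on smooth functions with value \<open>1\<close> at the constant \<open>1\<close> and value \<open>0\<close> at every \<open>E\<^sub>u f\<close> (\<open>mean_frame\<close>).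
It is the normalised integral against the left-invariant volume. In a chart at the identity this
volume has a density \<open>rho\<close>, and \<open>integ\<close> is the resulting integral of functions supported near the
identity. It is invariant under left translations (\<open>integ_left\<close>). A right translation multiplies
it by a constant, because right translations commute with left translations; differentiating this
in the translation gives \<open>\<integral> E\<^sub>u F = c(u) \<integral> F\<close> (\<open>integ_lder\<close>). Finitely many left
translates of the chart cover the compact \<open>N\<close>, and the integrals over them are glued by a partition of
unity: changes between these charts are left translations, so the result does not depend on how a
function is distributed over them (\<open>integ_swap\<close>), and the formula passes to \<open>N\<close>. There it can be applied
to \<open>f = 1\<close>, which yields \<open>c(u) = 0\<close>: a group with a compact quotient by a discrete subgroup is unimodular.

\<^bold>\<open>The frame.\<close> Tangent vectors are derivations of the algebra of smooth functions. Hadamard's lemma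
identifies those at the identity with directional derivatives (\<open>dvec_coordv\<close>), so \<open>\<gg>\<close> is
finite-dimensional. Smooth functions on \<open>N\<close> are the \<open>\<Gamma>\<close>-invariant smooth functions on the group
(\<open>smooth_fun_N\<close>), and a function supported near the identity can be moved to \<open>N\<close> by a translation and
the projection (\<open>descend\<close>). By means of such functions, \<open>u \<mapsto> E\<^sub>u\<close> is an isomorphism from \<open>\<gg>\<close> onto every
tangent space of \<open>N\<close> (\<open>frame_bij\<close>), and the coefficients of a smooth vector field with respect to the frame are
smooth (\<open>smooth_vf_coords\<close>). Together with \<open>[E\<^sub>u, E\<^sub>v] = E\<^bsub>[u,v]\<^esub>\<close> this turns the compatibility of \<open>i\<close> with
the differentials into a computation.\<close>

section \<open>Calculus of smooth functions on open sets\<close>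

lemma Ck_on_cong:
  assumes "open S" "\<And>x. x \<in> S \<Longrightarrow> f x = g x" "Ck_on k S f"
  shows "Ck_on k S g"
  using assms(2,3)
proof (induction k arbitrary: f g)
  case 0
  then show ?case by (metis Ck_on.simps(1) continuous_on_cong)
next
  case (Suc k)
  have d: "f differentiable (at x)" if "x \<in> S" for x
    using Suc.prems(2) that assms(1) by (simp add: differentiable_on_eq_differentiable_at)
  have e: "frechet_derivative f (at x) = frechet_derivative g (at x)" if "x \<in> S" for x
    by (rule frechet_derivative_transform_within_open[OF d[OF that] assms(1) that]) (use Suc.prems in auto)
  have "g differentiable_on S"
    unfolding differentiable_on_def
    by (metis Suc.prems(1,2) Ck_on.simps(2) differentiable_on_def differentiable_transform_within zero_less_one)
  moreover have "Ck_on k S (\<lambda>x. frechet_derivative g (at x) v)" for v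
    by (rule Suc.IH[of "\<lambda>x. frechet_derivative f (at x) v"]) (use Suc.prems(2) e in auto)
  ultimately show ?case by simp
qed

lemma Ck_on_Suc_has_derivative:
  assumes "open S" "Ck_on (Suc k) S f" "x \<in> S"
  shows "(f has_derivative frechet_derivative f (at x)) (at x)"
  using assms by (simp add: differentiable_on_eq_differentiable_at frechet_derivative_works[symmetric])

text \<open>In the inductions on the order of differentiability below, a derivative is found by a calculus
  rule; this lemma accepts it in place of \<open>frechet_derivative\<close>.\<close>

lemma Ck_on_SucI:
  assumes "open S" "\<And>x. x \<in> S \<Longrightarrow> (f has_derivative f' x) (at x)" "\<And>v. Ck_on k S (\<lambda>x. f' x v)"
  shows "Ck_on (Suc k) S f"
proof -
  have "f differentiable_on S"
    using assms(1,2) by (meson differentiable_at_imp_differentiable_on differentiable_def)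
  moreover have "Ck_on k S (\<lambda>x. frechet_derivative f (at x) v)" for v
    by (rule Ck_on_cong[OF assms(1) _ assms(3)[of v]])
      (metis assms(2) frechet_derivative_at)
  ultimately show ?thesis by simp
qed

lemma Ck_on_Suc_imp: "Ck_on (Suc k) S f \<Longrightarrow> Ck_on k S f"
proof (induction k arbitrary: f)
  case 0
  then show ?case by (simp add: differentiable_imp_continuous_on)
next
  case (Suc k)
  then show ?case by (simp del: Ck_on.simps(2) add: Ck_on.simps(2)[of "Suc k"] Ck_on.simps(2)[of k])
qed

lemma Ck_on_local:
  assumes "\<And>x. x \<in> S \<Longrightarrow> \<exists>T. open T \<and> x \<in> T \<and> Ck_on k T f"
  shows "Ck_on k S f"
  using assms
proof (induction k arbitrary: f)
  case 0
  have "continuous (at x within S) f" if "x \<in> S" for x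
    using 0[OF that] by (auto simp: continuous_on_eq_continuous_at intro: continuous_at_imp_continuous_at_within)
  then show ?case by (simp add: continuous_on_eq_continuous_within)
next
  case (Suc k)
  have "f differentiable (at x within S)" if "x \<in> S" for x
    using Suc.prems[OF that]
    by (auto simp: differentiable_on_eq_differentiable_at intro: differentiable_at_withinI)
  moreover have "Ck_on k S (\<lambda>x. frechet_derivative f (at x) v)" for v
    by (rule Suc.IH) (use Suc.prems in auto)
  ultimately show ?case by (simp add: differentiable_on_def)
qed

lemma Ck_on_subset:
  assumes "open T" "T \<subseteq> S" "Ck_on k S f" shows "Ck_on k T f"
  using assms(3)
proof (induction k arbitrary: f)
  case 0
  then show ?case using assms(2) by (simp add: continuous_on_subset)
next
  case (Suc k)
  then show ?case using assms(2) by (auto intro: differentiable_on_subset)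
qed

lemma Ck_on_const: "Ck_on k S (\<lambda>x. c)"
  by (induction k arbitrary: c) (auto simp: differentiable_on_def)

lemma Ck_on_linear:
  assumes "open S" "bounded_linear h" "Ck_on k S f" shows "Ck_on k S (\<lambda>x. h (f x))"
  using assms(3)
proof (induction k arbitrary: f)
  case 0
  then show ?case using assms(2) by (simp add: bounded_linear.continuous_on)
next
  case (Suc k)
  show ?case
  proof (rule Ck_on_SucI[OF assms(1)])
    show "((\<lambda>x. h (f x)) has_derivative (\<lambda>v. h (frechet_derivative f (at x) v))) (at x)" if "x \<in> S" for x
      using Ck_on_Suc_has_derivative[OF assms(1) Suc.prems that] assms(2)
      by (rule bounded_linear.has_derivative[rotated])
    show "Ck_on k S (\<lambda>x. h (frechet_derivative f (at x) v))" for v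
      using Suc by simp
  qed
qed

lemma Ck_on_id: "Ck_on k S (\<lambda>x. x)"
proof (cases k)
  case (Suc m)
  have "Ck_on m S (\<lambda>x. frechet_derivative (\<lambda>x. x) (at x) v)" for v :: 'a
    by (simp add: Ck_on_const)
  then show ?thesis using Suc by (simp add: differentiable_on_def)
qed simp

lemma Ck_on_add:
  assumes "open S" "Ck_on k S f" "Ck_on k S g" shows "Ck_on k S (\<lambda>x. f x + g x)"
  using assms(2,3)
proof (induction k arbitrary: f g)
  case 0
  then show ?case by (simp add: continuous_on_add)
next
  case (Suc k)
  show ?case
  proof (rule Ck_on_SucI[OF assms(1)])
    show "((\<lambda>x. f x + g x) has_derivative
        (\<lambda>v. frechet_derivative f (at x) v + frechet_derivative g (at x) v)) (at x)" if "x \<in> S" for x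
      by (intro has_derivative_add Ck_on_Suc_has_derivative[OF assms(1) Suc.prems(1) that]
        Ck_on_Suc_has_derivative[OF assms(1) Suc.prems(2) that])
    show "Ck_on k S (\<lambda>x. frechet_derivative f (at x) v + frechet_derivative g (at x) v)" for v
      using Suc by simp
  qed
qed

lemma Ck_on_bilinear:
  assumes "open S" "bounded_bilinear B" "Ck_on k S f" "Ck_on k S g"
  shows "Ck_on k S (\<lambda>x. B (f x) (g x))"
  using assms(3,4)
proof (induction k arbitrary: f g)
  case 0
  then show ?case using assms(2) by (simp add: bounded_bilinear.continuous_on)
next
  case (Suc k)
  show ?case
  proof (rule Ck_on_SucI[OF assms(1)])
    show "((\<lambda>x. B (f x) (g x)) has_derivative
        (\<lambda>v. B (f x) (frechet_derivative g (at x) v) + B (frechet_derivative f (at x) v) (g x))) (at x)"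
      if "x \<in> S" for x
      by (intro bounded_bilinear.FDERIV assms Ck_on_Suc_has_derivative[OF assms(1) Suc.prems(1) that]
        Ck_on_Suc_has_derivative[OF assms(1) Suc.prems(2) that])
    show "Ck_on k S (\<lambda>x. B (f x) (frechet_derivative g (at x) v) + B (frechet_derivative f (at x) v) (g x))" for v
      by (intro Ck_on_add[OF assms(1)] Suc.IH Ck_on_Suc_imp[OF Suc.prems(1)] Ck_on_Suc_imp[OF Suc.prems(2)])
        (use Suc.prems in auto)
  qed
qed

lemma Ck_on_sum:
  assumes "open S" "\<And>i. i \<in> A \<Longrightarrow> Ck_on k S (f i)" shows "Ck_on k S (\<lambda>x. \<Sum>i\<in>A. f i x)"
  using assms(2) by (induction A rule: infinite_finite_induct) (auto simp: Ck_on_const intro!: Ck_on_add[OF assms(1)])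

text \<open>Expanding the inner derivative in the basis of the middle space writes the derivative of the
  composition as a sum of products of partial derivatives of \<open>f\<close> with compositions of \<open>f\<close> and partial
  derivatives of \<open>g\<close>, to which the induction hypothesis applies.\<close>

lemma Ck_on_compose:
  fixes f :: "'d::real_normed_vector \<Rightarrow> 'e::euclidean_space"
  assumes "open S" "open T" "f ` S \<subseteq> T" "Ck_on k S f" "Ck_on k T g"
  shows "Ck_on k S (\<lambda>x. g (f x))"
  using assms(4,5)
proof (induction k arbitrary: g)
  case 0
  then show ?case using assms(3) by (auto intro: continuous_on_compose2)
next
  case (Suc k)
  show ?case
  proof (rule Ck_on_SucI[OF assms(1)])
    let ?h = "\<lambda>x v. \<Sum>b\<in>Basis. (frechet_derivative f (at x) v \<bullet> b) *\<^sub>R frechet_derivative g (at (f x)) b"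
    show "((\<lambda>x. g (f x)) has_derivative ?h x) (at x)" if "x \<in> S" for x
    proof -
      have f: "(f has_derivative frechet_derivative f (at x)) (at x)"
        using Ck_on_Suc_has_derivative[OF assms(1) Suc.prems(1) that] .
      have g: "(g has_derivative frechet_derivative g (at (f x))) (at (f x))"
        by (rule Ck_on_Suc_has_derivative[OF assms(2) Suc.prems(2)]) (use that assms(3) in auto)
      have l: "linear (frechet_derivative g (at (f x)))"
        using g has_derivative_linear by blast
      have "?h x = (\<lambda>v. frechet_derivative g (at (f x)) (frechet_derivative f (at x) v))"
      proof
        fix v
        have "frechet_derivative g (at (f x)) (\<Sum>b\<in>Basis. (frechet_derivative f (at x) v \<bullet> b) *\<^sub>R b) = ?h x v"
          by (simp add: linear_sum[OF l] linear_cmul[OF l])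
        then show "?h x v = frechet_derivative g (at (f x)) (frechet_derivative f (at x) v)"
          by (simp add: euclidean_representation)
      qed
      then show ?thesis using has_derivative_compose[OF f g] by simp
    qed
    show "Ck_on k S (\<lambda>x. ?h x v)" for v
    proof (rule Ck_on_sum[OF assms(1)])
      fix b :: 'e
      show "Ck_on k S (\<lambda>x. (frechet_derivative f (at x) v \<bullet> b) *\<^sub>R frechet_derivative g (at (f x)) b)"
      proof (rule Ck_on_bilinear[OF assms(1) bounded_bilinear_scaleR])
        show "Ck_on k S (\<lambda>x. frechet_derivative f (at x) v \<bullet> b)"
          by (rule Ck_on_linear[OF assms(1) bounded_linear_inner_left]) (use Suc.prems in simp)
        show "Ck_on k S (\<lambda>x. frechet_derivative g (at (f x)) b)"
          by (rule Suc.IH) (use Suc.prems Ck_on_Suc_imp in auto)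
      qed
    qed
  qed
qed

lemma Ck_on_inverse:
  fixes f :: "'e::real_normed_vector \<Rightarrow> real"
  assumes "open S" "\<And>x. x \<in> S \<Longrightarrow> f x \<noteq> 0" "Ck_on k S f"
  shows "Ck_on k S (\<lambda>x. inverse (f x))"
  using assms(3)
proof (induction k)
  case 0
  then show ?case using assms(2) by (simp add: continuous_on_inverse)
next
  case (Suc k)
  show ?case
  proof (rule Ck_on_SucI[OF assms(1)])
    show "((\<lambda>x. inverse (f x)) has_derivative
       (\<lambda>v. - (inverse (f x) * frechet_derivative f (at x) v * inverse (f x)))) (at x)" if "x \<in> S" for x
      by (intro Deriv.has_derivative_inverse Ck_on_Suc_has_derivative[OF assms(1) Suc.prems that] assms(2) that)
    show "Ck_on k S (\<lambda>x. - (inverse (f x) * frechet_derivative f (at x) v * inverse (f x)))" for v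
      by (intro Ck_on_linear[OF assms(1) bounded_linear_minus[OF bounded_linear_ident]]
           Ck_on_bilinear[OF assms(1) bounded_bilinear_mult] Suc.IH Ck_on_Suc_imp[OF Suc.prems])
        (use Suc.prems in simp)
  qed
qed

lemma smooth_on_cong:
  "open S \<Longrightarrow> (\<And>x. x \<in> S \<Longrightarrow> f x = g x) \<Longrightarrow> smooth_on S f \<longleftrightarrow> smooth_on S g"
  unfolding smooth_on_def by (metis Ck_on_cong)

lemma smooth_on_subset: "open T \<Longrightarrow> T \<subseteq> S \<Longrightarrow> smooth_on S f \<Longrightarrow> smooth_on T f"
  unfolding smooth_on_def using Ck_on_subset by blast

lemma smooth_on_local:
  "(\<And>x. x \<in> S \<Longrightarrow> \<exists>T. open T \<and> x \<in> T \<and> smooth_on T f) \<Longrightarrow> smooth_on S f"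
  unfolding smooth_on_def by (meson Ck_on_local)

lemma smooth_on_const: "smooth_on S (\<lambda>x. c)"
  by (simp add: smooth_on_def Ck_on_const)

lemma smooth_on_id: "smooth_on S (\<lambda>x. x)"
  by (simp add: smooth_on_def Ck_on_id)

lemma smooth_on_linear:
  "open S \<Longrightarrow> bounded_linear h \<Longrightarrow> smooth_on S f \<Longrightarrow> smooth_on S (\<lambda>x. h (f x))"
  by (simp add: smooth_on_def Ck_on_linear)

lemma smooth_on_add:
  "open S \<Longrightarrow> smooth_on S f \<Longrightarrow> smooth_on S g \<Longrightarrow> smooth_on S (\<lambda>x. f x + g x)"
  by (simp add: smooth_on_def Ck_on_add)

lemma smooth_on_sum:
  "open S \<Longrightarrow> (\<And>i. i \<in> A \<Longrightarrow> smooth_on S (f i)) \<Longrightarrow> smooth_on S (\<lambda>x. \<Sum>i\<in>A. f i x)"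
  by (simp add: smooth_on_def Ck_on_sum)

lemma smooth_on_scaleR:
  "open S \<Longrightarrow> smooth_on S f \<Longrightarrow> smooth_on S g \<Longrightarrow> smooth_on S (\<lambda>x. f x *\<^sub>R g x)"
  by (simp add: smooth_on_def Ck_on_bilinear[OF _ bounded_bilinear_scaleR])

lemma smooth_on_mult:
  fixes f g :: "'e::real_normed_vector \<Rightarrow> real"
  shows "open S \<Longrightarrow> smooth_on S f \<Longrightarrow> smooth_on S g \<Longrightarrow> smooth_on S (\<lambda>x. f x * g x)"
  by (simp add: smooth_on_def Ck_on_bilinear[OF _ bounded_bilinear_mult])

lemma smooth_on_uminus: "open S \<Longrightarrow> smooth_on S f \<Longrightarrow> smooth_on S (\<lambda>x. - f x)"
  by (rule smooth_on_linear[OF _ bounded_linear_minus[OF bounded_linear_ident]])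

lemma smooth_on_diff:
  "open S \<Longrightarrow> smooth_on S f \<Longrightarrow> smooth_on S g \<Longrightarrow> smooth_on S (\<lambda>x. f x - g x)"
  using smooth_on_add[of S f "\<lambda>x. - g x"] smooth_on_uminus by auto

lemma smooth_on_inverse:
  fixes f :: "'e::real_normed_vector \<Rightarrow> real"
  shows "open S \<Longrightarrow> (\<And>x. x \<in> S \<Longrightarrow> f x \<noteq> 0) \<Longrightarrow> smooth_on S f \<Longrightarrow> smooth_on S (\<lambda>x. inverse (f x))"
  by (simp add: smooth_on_def Ck_on_inverse)

lemma smooth_on_divide:
  fixes f :: "'e::real_normed_vector \<Rightarrow> real"
  shows "open S \<Longrightarrow> (\<And>x. x \<in> S \<Longrightarrow> g x \<noteq> 0) \<Longrightarrow> smooth_on S f \<Longrightarrow> smooth_on S g \<Longrightarrow>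
    smooth_on S (\<lambda>x. f x / g x)"
  unfolding divide_inverse by (intro smooth_on_mult smooth_on_inverse) auto

lemma smooth_on_prod:
  fixes f :: "'i \<Rightarrow> 'e::real_normed_vector \<Rightarrow> real"
  shows "open S \<Longrightarrow> (\<And>i. i \<in> A \<Longrightarrow> smooth_on S (f i)) \<Longrightarrow> smooth_on S (\<lambda>x. \<Prod>i\<in>A. f i x)"
  by (induction A rule: infinite_finite_induct) (auto simp: smooth_on_const intro!: smooth_on_mult)

lemma smooth_on_compose:
  fixes f :: "'d::real_normed_vector \<Rightarrow> 'e::euclidean_space"
  shows "open S \<Longrightarrow> open T \<Longrightarrow> f ` S \<subseteq> T \<Longrightarrow> smooth_on S f \<Longrightarrow> smooth_on T g \<Longrightarrow> smooth_on S (\<lambda>x. g (f x))"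
  unfolding smooth_on_def using Ck_on_compose by blast

lemma smooth_on_Pair:
  assumes "open S" "smooth_on S f" "smooth_on S g"
  shows "smooth_on S (\<lambda>x. (f x, g x))"
proof -
  have "bounded_linear (\<lambda>x::'b. (x, 0::'c))" "bounded_linear (\<lambda>x::'c. (0::'b, x))"
    by (auto intro!: bounded_linear_Pair bounded_linear_ident bounded_linear_zero)
  then have "smooth_on S (\<lambda>x. (f x, 0) + (0, g x))"
    by (intro smooth_on_add smooth_on_linear[of S "\<lambda>x. (x, 0)"] smooth_on_linear[of S "\<lambda>x. (0, x)"]  assms)
  then show ?thesis by simp
qed

lemma smooth_on_nth: "open S \<Longrightarrow> smooth_on S f \<Longrightarrow> smooth_on S (\<lambda>x. f x $ i)"
  by (rule smooth_on_linear[OF _ bounded_linear_vec_nth])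

lemma smooth_on_continuous: "smooth_on S f \<Longrightarrow> continuous_on S f"
  unfolding smooth_on_def by (metis Ck_on.simps(1))

lemma smooth_on_has_derivative:
  "open S \<Longrightarrow> smooth_on S f \<Longrightarrow> x \<in> S \<Longrightarrow> (f has_derivative frechet_derivative f (at x)) (at x)"
  unfolding smooth_on_def using Ck_on_Suc_has_derivative by blast

lemma smooth_on_frechet_derivative:
  "smooth_on S f \<Longrightarrow> smooth_on S (\<lambda>x. frechet_derivative f (at x) v)"
  unfolding smooth_on_def by (metis Ck_on.simps(2))

lemma linear_frechet_smooth_on:
  "open S \<Longrightarrow> smooth_on S f \<Longrightarrow> x \<in> S \<Longrightarrow> linear (frechet_derivative f (at x))"
  using smooth_on_has_derivative has_derivative_linear by blast

lemma smooth_on_det: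
  fixes A :: "'e::real_normed_vector \<Rightarrow> real^'n^'n"
  assumes "open S" "\<And>i j. smooth_on S (\<lambda>x. A x $ i $ j)"
  shows "smooth_on S (\<lambda>x. det (A x))"
  unfolding det_def
  by (intro smooth_on_sum smooth_on_mult smooth_on_prod smooth_on_const assms)

subsection \<open>A plateau function\<close>

text \<open>The functions \<open>exp (- 1 / t) / t\<^sup>n\<close>, extended by zero to \<open>t \<le> 0\<close>. The span of this family is closed
  under differentiation, so all its members are proved smooth by one induction.\<close>

definition flat :: "nat \<Rightarrow> real \<Rightarrow> real" where
  "flat n t = (if t > 0 then exp (- (1 / t)) / t ^ n else 0)"

text \<open>At \<open>0\<close> the difference quotient of \<open>flat n\<close> is \<open>flat (n + 1)\<close>, and the exponential beats every power.\<close>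

lemma flat_has_derivative:
  "(flat n has_real_derivative flat (n + 2) t - n * flat (n + 1) t) (at t)"
proof (cases "t > 0")
  case True
  have "((\<lambda>t. exp (- (1 / t)) / t ^ n) has_real_derivative flat (n + 2) t - n * flat (n + 1) t) (at t)"
    using True
    apply (auto intro!: derivative_eq_intros simp: flat_def)
    apply (cases n)
     apply (auto simp: field_simps power2_eq_square)
    done
  then show ?thesis
    by (rule has_field_derivative_transform_within_open[of _ _ _ "{0<..}"]) (use True in \<open>auto simp: flat_def\<close>)
next
  case False
  show ?thesis
  proof (cases "t < 0")
    case True
    have "((\<lambda>t. 0) has_real_derivative 0) (at t)" by simp
    then have "(flat n has_real_derivative 0) (at t)"
      by (rule has_field_derivative_transform_within_open[of _ _ _ "{..<0}"]) (use True in \<open>auto simp: flat_def\<close>)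
    then show ?thesis using True by (simp add: flat_def)
  next
    case False
    then have [simp]: "t = 0" using \<open>\<not> t > 0\<close> by simp
    have lim: "((\<lambda>x. flat (Suc n) x) \<longlongrightarrow> 0) (at_right 0)"
    proof -
      have "((\<lambda>x::real. x ^ Suc n / exp x) \<longlongrightarrow> 0) at_top" by (rule tendsto_power_div_exp_0)
      then have "((\<lambda>x. inverse x ^ Suc n / exp (inverse x)) \<longlongrightarrow> 0) (at_right (0::real))"
        by (rule filterlim_compose[OF _ filterlim_inverse_at_top_right])
      then show ?thesis
        by (rule Lim_transform_eventually)
          (auto simp: eventually_at_filter flat_def exp_minus field_simps)
    qed
    have "((\<lambda>x. flat (Suc n) x) \<longlongrightarrow> 0) (at_left 0)"
      by (rule Lim_transform_eventually[OF tendsto_const[of 0]])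
        (auto simp: eventually_at_filter flat_def)
    with lim have "((\<lambda>x. flat (Suc n) x) \<longlongrightarrow> 0) (at 0)"
      by (simp add: filterlim_at_split)
    then have "((\<lambda>x. (flat n x - flat n 0) / (x - 0)) \<longlongrightarrow> 0) (at 0)"
      by (rule Lim_transform_eventually) (auto simp: flat_def eventually_at_filter)
    then show ?thesis by (simp add: has_field_derivative_iff flat_def)
  qed
qed

lemma Ck_on_flat: "Ck_on k UNIV (flat n)"
proof (induction k arbitrary: n)
  case 0
  have "\<forall>t. isCont (flat n) t" using flat_has_derivative DERIV_isCont by blast
  then show ?case by (simp add: continuous_on_eq_continuous_at)
next
  case (Suc k)
  show ?case
  proof (rule Ck_on_SucI)
    show "(flat n has_derivative (\<lambda>v. (flat (n + 2) x + (- real n) * flat (n + 1) x) * v)) (at x)" for x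
      using flat_has_derivative[of n x] by (simp add: has_field_derivative_def)
    show "Ck_on k UNIV (\<lambda>x. (flat (n + 2) x + (- real n) * flat (n + 1) x) * v)" for v
      by (intro Ck_on_bilinear[OF _ bounded_bilinear_mult] Ck_on_add Ck_on_const Suc open_UNIV)
  qed simp
qed

definition smooth_step :: "real \<Rightarrow> real" where
  "smooth_step t = flat 0 t / (flat 0 t + flat 0 (1 - t))"

lemma flat_nonneg: "flat n t \<ge> 0" by (simp add: flat_def)

lemma flat_denom_pos: "flat 0 t + flat 0 (1 - t) > 0"
  by (cases "t > 0") (auto simp: flat_def add_pos_nonneg add_pos_pos)

lemma smooth_on_smooth_step: "smooth_on UNIV smooth_step"
proof -
  have f: "smooth_on UNIV (flat 0)" by (simp add: smooth_on_def Ck_on_flat)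
  have "smooth_on UNIV (\<lambda>t. flat 0 (1 - t))"
    by (rule smooth_on_compose[of _ UNIV]) (auto intro!: f smooth_on_diff smooth_on_const smooth_on_id)
  then have "smooth_on UNIV (\<lambda>t. flat 0 t / (flat 0 t + flat 0 (1 - t)))"
    using flat_denom_pos by (intro smooth_on_divide smooth_on_add f) (auto simp: less_imp_neq[THEN not_sym])
  then show ?thesis by (simp add: smooth_step_def[abs_def])
qed

text \<open>The function is \<open>1\<close> for norms up to \<open>r / 3\<close> and \<open>0\<close> for norms from \<open>r / 2\<close> on, which leaves
  a margin inside the ball of radius \<open>r\<close> where a chart is available.\<close>

definition bump :: "real \<Rightarrow> 'e::euclidean_space \<Rightarrow> real" where
  "bump r y = smooth_step (((r/2)\<^sup>2 - y \<bullet> y) / ((r/2)\<^sup>2 - (r/3)\<^sup>2))"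

lemma smooth_on_bump: "smooth_on UNIV (bump r :: 'e::euclidean_space \<Rightarrow> real)"
proof -
  have "smooth_on UNIV (\<lambda>y::'e. y \<bullet> y)"
    by (simp add: smooth_on_def Ck_on_bilinear[OF _ bounded_bilinear_inner] Ck_on_id)
  then have "smooth_on UNIV (\<lambda>y::'e. ((r/2)\<^sup>2 - y \<bullet> y) * inverse ((r/2)\<^sup>2 - (r/3)\<^sup>2))"
    by (intro smooth_on_mult[OF open_UNIV smooth_on_diff[OF open_UNIV smooth_on_const] smooth_on_const])
  then have "smooth_on UNIV (\<lambda>y::'e. smooth_step (((r/2)\<^sup>2 - y \<bullet> y) * inverse ((r/2)\<^sup>2 - (r/3)\<^sup>2)))"
    by (rule smooth_on_compose[OF open_UNIV open_UNIV subset_UNIV _ smooth_on_smooth_step])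
  then show ?thesis by (simp only: bump_def[abs_def] divide_inverse)
qed

lemma bump_nonneg: "bump r y \<ge> 0"
  unfolding bump_def smooth_step_def using flat_nonneg flat_denom_pos by (metis divide_nonneg_pos)

lemma bump_plateau: "r > 0 \<Longrightarrow> norm y \<le> r / 3 \<Longrightarrow> bump r y = 1"
proof -
  assume r: "r > 0" and "norm y \<le> r / 3"
  then have "y \<bullet> y \<le> (r/3)\<^sup>2"
    by (metis norm_ge_zero power2_norm_eq_inner power_mono)
  moreover have "(r/3)\<^sup>2 < (r/2)\<^sup>2" using r by (simp add: power2_eq_square)
  ultimately have "((r/2)\<^sup>2 - y \<bullet> y) / ((r/2)\<^sup>2 - (r/3)\<^sup>2) \<ge> 1" by simp
  then show ?thesis unfolding bump_def smooth_step_def by (simp add: flat_def)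
qed

lemma bump_eq_0: "r > 0 \<Longrightarrow> norm y \<ge> r / 2 \<Longrightarrow> bump r y = 0"
proof -
  assume r: "r > 0" and "norm y \<ge> r / 2"
  then have "y \<bullet> y \<ge> (r/2)\<^sup>2"
    by (metis half_gt_zero_iff less_imp_le power2_norm_eq_inner power_mono)
  moreover have "(r/3)\<^sup>2 < (r/2)\<^sup>2" using r by (simp add: power2_eq_square)
  ultimately have "((r/2)\<^sup>2 - y \<bullet> y) / ((r/2)\<^sup>2 - (r/3)\<^sup>2) \<le> 0"
    by (simp add: divide_nonpos_pos)
  then show ?thesis unfolding bump_def smooth_step_def by (simp add: flat_def)
qed

subsection \<open>Hadamard's lemma\<close>

text \<open>A derivative under the integral sign replaces \<open>g\<close> by a derivative of \<open>g\<close> and \<open>m\<close> by \<open>m + 1\<close>. The power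
  of \<open>t\<close> is in the statement to make the induction on the order of differentiability close.\<close>

lemma smooth_on_param_integral:
  fixes g :: "'e::euclidean_space \<Rightarrow> real"
  assumes "smooth_on (ball a r) g"
  shows "smooth_on (ball a r) (\<lambda>y. integral {0..1} (\<lambda>t. t ^ m * g (a + t *\<^sub>R (y - a))))"
proof -
  have seg: "a + t *\<^sub>R (y - a) \<in> ball a r" if "t \<in> {0..1}" "y \<in> ball a r" for t y
    using that by (auto simp: dist_norm norm_minus_commute intro: le_less_trans[OF mult_left_le_one_le])
  have cont: "continuous_on (ball a r \<times> {0..1}) (\<lambda>(y, t). t ^ m * h (a + t *\<^sub>R (y - a)))"
    if "continuous_on (ball a r) h" for h :: "'e \<Rightarrow> real" and m
    unfolding case_prod_beta
    by (intro continuous_intros continuous_on_compose2[OF that]) (use seg in auto)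
  have "Ck_on k (ball a r) (\<lambda>y. integral {0..1} (\<lambda>t. t ^ m * g (a + t *\<^sub>R (y - a))))" for k
    using assms
  proof (induction k arbitrary: m g)
    case 0
    show ?case
      using integral_continuous_on_param[of "ball a r" 0 1 "\<lambda>y t. t ^ m * g (a + t *\<^sub>R (y - a))"]
        cont[OF smooth_on_continuous[OF 0]] by simp
  next
    case (Suc k)
    let ?D = "\<lambda>y. Blinfun (frechet_derivative g (at y))"
    have D: "blinfun_apply (?D y) = frechet_derivative g (at y)" if "y \<in> ball a r" for y
      using smooth_on_has_derivative[OF _ Suc.prems that] has_derivative_bounded_linear
      by (intro bounded_linear_Blinfun_apply) auto
    let ?fx = "\<lambda>y t. t ^ Suc m *\<^sub>R ?D (a + t *\<^sub>R (y - a))"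
    have cD: "continuous_on (ball a r) ?D"
      by (rule continuous_on_blinfun_componentwise)
        (use smooth_on_continuous[OF smooth_on_frechet_derivative[OF Suc.prems]] D in
          \<open>auto cong: continuous_on_cong_simp\<close>)
    have cfx: "continuous_on (ball a r \<times> cbox 0 1) (\<lambda>(y, t). ?fx y t)"
      unfolding case_prod_beta
      by (intro continuous_intros continuous_on_compose2[OF cD]) (use seg in auto)
    have der: "((\<lambda>y. integral (cbox 0 1) (\<lambda>t. t ^ m * g (a + t *\<^sub>R (y - a)))) has_derivative
           integral (cbox 0 1) (?fx y0)) (at y0 within ball a r)" if y0: "y0 \<in> ball a r" for y0
    proof (rule leibniz_rule[OF _ _ cfx y0 convex_ball])
      fix y t assume y: "y \<in> ball a r" and t: "t \<in> cbox (0::real) 1"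
      have s: "a + t *\<^sub>R (y - a) \<in> ball a r" using seg y t by simp
      have "((\<lambda>y. a + t *\<^sub>R (y - a)) has_derivative (\<lambda>v. t *\<^sub>R v)) (at y)"
        by (auto intro!: derivative_eq_intros)
      from has_derivative_compose[OF this smooth_on_has_derivative[OF _ Suc.prems s]]
      have "((\<lambda>y. g (a + t *\<^sub>R (y - a))) has_derivative
         (\<lambda>v. frechet_derivative g (at (a + t *\<^sub>R (y - a))) (t *\<^sub>R v))) (at y)" by simp
      then have "((\<lambda>y. t ^ m * g (a + t *\<^sub>R (y - a))) has_derivative
         (\<lambda>v. t ^ m * frechet_derivative g (at (a + t *\<^sub>R (y - a))) (t *\<^sub>R v))) (at y)"
        by (rule has_derivative_mult_right)
      moreover have "(\<lambda>v. t ^ m * frechet_derivative g (at (a + t *\<^sub>R (y - a))) (t *\<^sub>R v)) = blinfun_apply (?fx y t)"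
        using linear_cmul[OF linear_frechet_smooth_on[OF _ Suc.prems s]] D[OF s]
        by (auto simp: blinfun.scaleR_left fun_eq_iff)
      ultimately show "((\<lambda>y. t ^ m * g (a + t *\<^sub>R (y - a))) has_derivative blinfun_apply (?fx y t)) (at y within ball a r)"
        by (simp add: has_derivative_at_withinI)
    next
      fix y assume y: "y \<in> ball a r"
      show "(\<lambda>t. t ^ m * g (a + t *\<^sub>R (y - a))) integrable_on cbox 0 1"
        by (rule integrable_continuous)
          (use y seg in \<open>auto intro!: continuous_intros continuous_on_compose2[OF smooth_on_continuous[OF Suc.prems]]\<close>)
    qed
    show ?case
    proof (rule Ck_on_SucI[OF open_ball])
      show "((\<lambda>y. integral {0..1} (\<lambda>t. t ^ m * g (a + t *\<^sub>R (y - a)))) has_derivative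
         (\<lambda>v. blinfun_apply (integral (cbox 0 1) (?fx y)) v)) (at y)" if "y \<in> ball a r" for y
        using der[OF that] that by (simp add: at_within_open[OF that open_ball])
      fix v
      have "Ck_on k (ball a r) (\<lambda>y. integral {0..1} (\<lambda>t. t ^ Suc m * frechet_derivative g (at (a + t *\<^sub>R (y - a))) v))"
        by (rule Suc.IH[OF smooth_on_frechet_derivative[OF Suc.prems]])
      then show "Ck_on k (ball a r) (\<lambda>y. blinfun_apply (integral (cbox 0 1) (?fx y)) v)"
      proof (rule Ck_on_cong[OF open_ball, rotated])
        fix y assume y: "y \<in> ball a r"
        have "?fx y integrable_on cbox 0 1"
          by (rule integrable_continuous) (use y seg in \<open>auto intro!: continuous_intros continuous_on_compose2[OF cD]\<close>)
        from blinfun_apply_integral[OF this, of v]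
        show "integral {0..1} (\<lambda>t. t ^ Suc m * frechet_derivative g (at (a + t *\<^sub>R (y - a))) v) =
            blinfun_apply (integral (cbox 0 1) (?fx y)) v"
          using y seg D by (auto simp: blinfun.scaleR_left intro!: integral_cong)
      qed
    qed
  qed
  then show ?thesis by (simp add: smooth_on_def)
qed

text \<open>The derivative of \<open>f\<close> along the segment from \<open>a\<close> to \<open>y\<close> integrates to \<open>f y - f a\<close>. It is through this lemma that
  a derivation of the algebra of smooth functions is determined by its values on coordinates.\<close>

lemma Hadamard:
  fixes f :: "'e::euclidean_space \<Rightarrow> real"
  assumes r: "r > 0" and f: "smooth_on (ball a r) f"
  obtains h where "\<And>b. smooth_on (ball a r) (h b)" "\<And>b. h b a = frechet_derivative f (at a) b"
    "\<And>y. y \<in> ball a r \<Longrightarrow> f y = f a + (\<Sum>b\<in>Basis. ((y - a) \<bullet> b) * h b y)"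
proof
  define h where "h = (\<lambda>b y. integral {0..1} (\<lambda>t. frechet_derivative f (at (a + t *\<^sub>R (y - a))) b))"
  show "smooth_on (ball a r) (h b)" for b
    using smooth_on_param_integral[OF smooth_on_frechet_derivative[OF f, of b], of 0]
    by (simp add: h_def[abs_def])
  show "h b a = frechet_derivative f (at a) b" for b
    by (simp add: h_def)
  fix y assume y: "y \<in> ball a r"
  have seg: "a + t *\<^sub>R (y - a) \<in> ball a r" if "t \<in> {0..1}" for t
    using that y by (auto simp: dist_norm norm_minus_commute intro: le_less_trans[OF mult_left_le_one_le])
  have "((\<lambda>t. f (a + t *\<^sub>R (y - a))) has_vector_derivative
      frechet_derivative f (at (a + t *\<^sub>R (y - a))) (y - a)) (at t within {0..1})" if t: "t \<in> {0..1}" for t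
  proof -
    have "((\<lambda>t. a + t *\<^sub>R (y - a)) has_derivative (\<lambda>v. v *\<^sub>R (y - a))) (at t)"
      by (auto intro!: derivative_eq_intros)
    from has_derivative_compose[OF this smooth_on_has_derivative[OF _ f seg[OF t]]]
    show ?thesis
      using linear_cmul[OF linear_frechet_smooth_on[OF _ f seg[OF t]]]
      by (auto simp: has_vector_derivative_def intro: has_derivative_at_withinI)
  qed
  from fundamental_theorem_of_calculus[OF _ this]
  have "((\<lambda>t. frechet_derivative f (at (a + t *\<^sub>R (y - a))) (y - a)) has_integral f y - f a) {0..1}"
    by simp
  moreover have "((\<lambda>t. frechet_derivative f (at (a + t *\<^sub>R (y - a))) (y - a)) has_integral
     (\<Sum>b\<in>Basis. ((y - a) \<bullet> b) * h b y)) {0..1}"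
  proof -
    have "((\<lambda>t. \<Sum>b\<in>Basis. ((y - a) \<bullet> b) * frechet_derivative f (at (a + t *\<^sub>R (y - a))) b) has_integral
     (\<Sum>b\<in>Basis. ((y - a) \<bullet> b) * h b y)) {0..1}"
    proof (intro has_integral_sum has_integral_mult_right)
      fix b :: 'e
      have "continuous_on {0..1} (\<lambda>t. frechet_derivative f (at (a + t *\<^sub>R (y - a))) b)"
        by (rule continuous_on_compose2[OF smooth_on_continuous[OF smooth_on_frechet_derivative[OF f]]])
          (use seg in \<open>auto intro!: continuous_intros\<close>)
      then show "((\<lambda>t. frechet_derivative f (at (a + t *\<^sub>R (y - a))) b) has_integral h b y) {0..1}"
        unfolding h_def by (intro integrable_integral integrable_continuous_real)
    qed simp
    moreover have "frechet_derivative f (at (a + t *\<^sub>R (y - a))) (y - a) =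
       (\<Sum>b\<in>Basis. ((y - a) \<bullet> b) * frechet_derivative f (at (a + t *\<^sub>R (y - a))) b)" if "t \<in> {0..1}" for t
    proof -
      note l = linear_frechet_smooth_on[OF _ f seg[OF that]]
      have "frechet_derivative f (at (a + t *\<^sub>R (y - a))) (\<Sum>b\<in>Basis. ((y - a) \<bullet> b) *\<^sub>R b) =
         (\<Sum>b\<in>Basis. ((y - a) \<bullet> b) * frechet_derivative f (at (a + t *\<^sub>R (y - a))) b)"
        by (simp add: linear_sum[OF l] linear_cmul[OF l])
      then show ?thesis by (simp only: euclidean_representation)
    qed
    ultimately show ?thesis by (subst has_integral_cong) auto
  qed
  ultimately have "f y - f a = (\<Sum>b\<in>Basis. ((y - a) \<bullet> b) * h b y)"
    using has_integral_unique by blast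
  then show "f y = f a + (\<Sum>b\<in>Basis. ((y - a) \<bullet> b) * h b y)" by simp
qed

section \<open>Smooth functions and derivations on a manifold\<close>

text \<open>The one property of a manifold on which the algebra of smooth functions depends. For
  quotients it is verified directly.\<close>

definition open_charts :: "('a, 'e::euclidean_space) mfd \<Rightarrow> bool" where
  "open_charts M \<longleftrightarrow> (\<forall>(U, \<phi>)\<in>charts M. open (\<phi> ` U))"

lemma smooth_fun_const: "smooth_fun M (\<lambda>x. c)"
  by (auto simp: smooth_fun_def o_def smooth_on_const)

lemma smooth_fun_add:
  "open_charts M \<Longrightarrow> smooth_fun M f \<Longrightarrow> smooth_fun M g \<Longrightarrow> smooth_fun M (\<lambda>x. f x + g x)"
  unfolding smooth_fun_def open_charts_def by (fastforce intro: smooth_on_add simp: o_def)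

lemma smooth_fun_mult:
  "open_charts M \<Longrightarrow> smooth_fun M f \<Longrightarrow> smooth_fun M g \<Longrightarrow> smooth_fun M (\<lambda>x. f x * g x)"
  unfolding smooth_fun_def open_charts_def by (fastforce intro: smooth_on_mult simp: o_def)

lemma smooth_fun_cmult: "open_charts M \<Longrightarrow> smooth_fun M f \<Longrightarrow> smooth_fun M (\<lambda>x. c * f x)"
  by (rule smooth_fun_mult[OF _ smooth_fun_const])

lemma smooth_fun_uminus: "open_charts M \<Longrightarrow> smooth_fun M f \<Longrightarrow> smooth_fun M (\<lambda>x. - f x)"
  using smooth_fun_cmult[of M f "-1"] by simp

lemma smooth_fun_diff:
  "open_charts M \<Longrightarrow> smooth_fun M f \<Longrightarrow> smooth_fun M g \<Longrightarrow> smooth_fun M (\<lambda>x. f x - g x)"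
  using smooth_fun_add[of M f "\<lambda>x. - g x"] smooth_fun_uminus[of M g] by simp

lemma smooth_fun_sum:
  "open_charts M \<Longrightarrow> (\<And>i. i \<in> A \<Longrightarrow> smooth_fun M (f i)) \<Longrightarrow> smooth_fun M (\<lambda>x. \<Sum>i\<in>A. f i x)"
  by (induction A rule: infinite_finite_induct) (auto simp: smooth_fun_const intro!: smooth_fun_add)

lemma smooth_fun_divide:
  assumes "open_charts M" "smooth_fun M f" "smooth_fun M g"
    and "\<And>U \<phi> x. (U, \<phi>) \<in> charts M \<Longrightarrow> x \<in> U \<Longrightarrow> g x \<noteq> 0"
  shows "smooth_fun M (\<lambda>x. f x / g x)"
proof -
  have "smooth_on (\<phi> ` U) (\<lambda>y. f (inv_into U \<phi> y) / g (inv_into U \<phi> y))" if "(U, \<phi>) \<in> charts M" for U \<phi>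
  proof (rule smooth_on_divide)
    show "g (inv_into U \<phi> y) \<noteq> 0" if "y \<in> \<phi> ` U" for y
      using assms(4)[OF \<open>(U, \<phi>) \<in> charts M\<close>] inv_into_into that by metis
  qed (use assms that in \<open>auto simp: smooth_fun_def open_charts_def o_def\<close>)
  then show ?thesis by (auto simp: smooth_fun_def o_def)
qed

lemma smooth_fun_cong:
  assumes "open_charts M" "\<And>U \<phi> x. (U, \<phi>) \<in> charts M \<Longrightarrow> x \<in> U \<Longrightarrow> f x = g x"
  shows "smooth_fun M f \<longleftrightarrow> smooth_fun M g"
proof -
  have "smooth_on (\<phi> ` U) (f \<circ> inv_into U \<phi>) \<longleftrightarrow> smooth_on (\<phi> ` U) (g \<circ> inv_into U \<phi>)"
    if "(U, \<phi>) \<in> charts M" for U \<phi>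
  proof (rule smooth_on_cong)
    show "(f \<circ> inv_into U \<phi>) y = (g \<circ> inv_into U \<phi>) y" if "y \<in> \<phi> ` U" for y
      using assms(2)[OF \<open>(U, \<phi>) \<in> charts M\<close>] inv_into_into[OF that] by simp
  qed (use assms that in \<open>auto simp: open_charts_def\<close>)
  then show ?thesis by (auto simp: smooth_fun_def)
qed

context
  fixes M :: "('a, 'e::euclidean_space) mfd" and p :: 'a and w :: "'a tvec"
  assumes w: "w \<in> tangent_space M p"
begin

lemma tangent_nonsmooth: "\<not> smooth_fun M f \<Longrightarrow> w f = 0"
  using w by (simp add: tangent_space_def)

lemma tangent_add: "smooth_fun M f \<Longrightarrow> smooth_fun M g \<Longrightarrow> w (\<lambda>x. f x + g x) = w f + w g"
  using w by (simp add: tangent_space_def)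

lemma tangent_cmult: "smooth_fun M f \<Longrightarrow> w (\<lambda>x. c * f x) = c * w f"
  using w by (simp add: tangent_space_def)

lemma tangent_mult:
  "smooth_fun M f \<Longrightarrow> smooth_fun M g \<Longrightarrow> w (\<lambda>x. f x * g x) = f p * w g + g p * w f"
  using w by (simp add: tangent_space_def)

lemma tangent_const: "w (\<lambda>x. c) = 0"
proof -
  have "w (\<lambda>x. 1) = 0" using tangent_mult[of "\<lambda>x. 1" "\<lambda>x. 1"] by (simp add: smooth_fun_const)
  then show ?thesis using tangent_cmult[of "\<lambda>x. 1" c] by (simp add: smooth_fun_const)
qed

lemma tangent_diff:
  assumes "open_charts M" "smooth_fun M f" "smooth_fun M g"
  shows "w (\<lambda>x. f x - g x) = w f - w g"
  using tangent_add[OF assms(2) smooth_fun_cmult[OF assms(1,3), of "-1"]]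
    tangent_cmult[OF assms(3), of "-1"] by simp

lemma tangent_sum:
  assumes "open_charts M" "\<And>i. i \<in> A \<Longrightarrow> smooth_fun M (f i)"
  shows "w (\<lambda>x. \<Sum>i\<in>A. f i x) = (\<Sum>i\<in>A. w (f i))"
  using assms(2)
  by (induction A rule: infinite_finite_induct)
    (auto simp: tangent_const tangent_add smooth_fun_sum[OF assms(1)])

text \<open>If \<open>b\<close> is \<open>1\<close> at \<open>p\<close> and \<open>f = g\<close> where \<open>b \<noteq> 0\<close>, then \<open>f - g\<close> is the product of \<open>f - g\<close> and
  \<open>1 - b\<close>, which both vanish at \<open>p\<close>.\<close>

lemma tangent_local:
  assumes "open_charts M" "smooth_fun M f" "smooth_fun M g" "smooth_fun M b"
    and "b p = 1" "\<And>x. b x \<noteq> 0 \<Longrightarrow> f x = g x"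
  shows "w f = w g"
proof -
  have eq: "(\<lambda>x. f x - g x) = (\<lambda>x. (f x - g x) * (1 - b x))"
    using assms(6) by (auto simp: fun_eq_iff)
  have "w (\<lambda>x. f x - g x) = 0"
    by (subst eq, subst tangent_mult) (use assms in \<open>auto intro!: smooth_fun_diff smooth_fun_const\<close>)
  then show ?thesis using tangent_diff[OF assms(1-3)] by simp
qed

end

lemma sum_fun_apply: "(\<Sum>i\<in>A. f i) x = (\<Sum>i\<in>A. f i x)"
  by (induction A rule: infinite_finite_induct) auto

lemma tangent_space_add:
  "u \<in> tangent_space M p \<Longrightarrow> v \<in> tangent_space M p \<Longrightarrow> u + v \<in> tangent_space M p"
  by (auto simp: tangent_space_def plus_fun_def algebra_simps)

lemma tangent_space_scaleR: "u \<in> tangent_space M p \<Longrightarrow> c *\<^sub>R u \<in> tangent_space M p"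
  by (auto simp: tangent_space_def scaleR_fun_def algebra_simps)

lemma tangent_space_0: "0 \<in> tangent_space M p"
  by (auto simp: tangent_space_def zero_fun_def)

lemma subspace_tangent_space: "subspace (tangent_space M p)"
  by (simp add: subspace_def tangent_space_add tangent_space_scaleR tangent_space_0)

section \<open>Lie groups in a chart around the identity\<close>

text \<open>A single chart around the identity serves for the whole group: left translations carry it to
  every other point.\<close>

locale lie_chart =
  fixes G :: "('a, 'b) monoid_scheme" (structure)
    and X :: "('a, 'e::euclidean_space) mfd"
    and U :: "'a set" and \<phi> :: "'a \<Rightarrow> 'e"
  assumes lie: "lie_group G X"
    and chart: "(U, \<phi>) \<in> charts X"
    and one_U: "\<one> \<in> U"

sublocale lie_chart \<subseteq> group G
  using lie by (simp add: lie_group_def)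

context lie_chart
begin

abbreviation "T \<equiv> mtop X"
abbreviation "\<gg> \<equiv> lie_algebra G X"
abbreviation "D \<equiv> \<phi> ` U"
abbreviation "\<psi> \<equiv> inv_into U \<phi>"
abbreviation "e0 \<equiv> \<phi> \<one>"

lemma points_X: "points X = carrier G"
  and mfd: "smooth_manifold X"
  and mult_smooth_map: "smooth_map (prod_mfd X X) X (\<lambda>(x, y). x \<otimes> y)"
  and inv_smooth_map: "smooth_map X X (\<lambda>x. inv x)"
  using lie by (auto simp: lie_group_def)

lemma continuous_mult: "continuous_map (prod_topology T T) T (\<lambda>(x, y). x \<otimes> y)"
  using mult_smooth_map by (simp add: smooth_map_def prod_mfd_def)

lemma continuous_inv: "continuous_map T T (\<lambda>x. inv x)"
  using inv_smooth_map by (simp add: smooth_map_def)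

lemma Hausdorff: "Hausdorff_space T"
  using mfd by (simp add: smooth_manifold_def)

lemma chart_at: "g \<in> carrier G \<Longrightarrow> \<exists>V \<kappa>. (V, \<kappa>) \<in> charts X \<and> g \<in> V"
proof -
  assume "g \<in> carrier G"
  then have "g \<in> (\<Union>(V, \<kappa>)\<in>charts X. V)"
    using mfd points_X by (simp add: smooth_manifold_def)
  then show ?thesis by auto
qed

lemma open_charts_X: "open_charts X"
  using mfd by (auto simp: smooth_manifold_def open_charts_def)

context
  fixes V :: "'a set" and \<kappa> :: "'a \<Rightarrow> 'e"
  assumes ch: "(V, \<kappa>) \<in> charts X"
begin

lemma chart_open: "openin T V" "open (\<kappa> ` V)"
  and chart_homeo: "homeomorphic_map (subtopology T V) (top_of_set (\<kappa> ` V)) \<kappa>"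
  using mfd ch by (auto simp: smooth_manifold_def)

lemma chart_sub: "V \<subseteq> carrier G"
  using chart_open(1) openin_subset points_X by fastforce

lemma topspace_chart: "topspace (subtopology T V) = V"
  using chart_sub points_X by auto

lemma chart_inj: "inj_on \<kappa> V"
  using chart_homeo topspace_chart by (metis homeomorphic_imp_injective_map)

lemma chart_inv: "y \<in> \<kappa> ` V \<Longrightarrow> inv_into V \<kappa> y \<in> V" "y \<in> \<kappa> ` V \<Longrightarrow> \<kappa> (inv_into V \<kappa> y) = y"
  "x \<in> V \<Longrightarrow> inv_into V \<kappa> (\<kappa> x) = x"
  using chart_inj by (auto simp: inv_into_into f_inv_into_f)

lemma chart_inv_carrier: "y \<in> \<kappa> ` V \<Longrightarrow> inv_into V \<kappa> y \<in> carrier G"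
  using chart_inv(1) chart_sub by blast

lemma chart_image_open:
  assumes "openin T S" shows "open (\<kappa> ` (V \<inter> S))"
proof -
  have "openin (subtopology T V) (V \<inter> S)"
    using assms openin_subtopology_Int2 by blast
  then have "openin (top_of_set (\<kappa> ` V)) (\<kappa> ` (V \<inter> S))"
    using chart_homeo homeomorphic_imp_open_map open_map_def by blast
  then show ?thesis using chart_open(2) openin_open_eq by blast
qed

lemma chart_preimage_open:
  assumes "open S" shows "openin T {x \<in> V. \<kappa> x \<in> S}"
proof -
  have "continuous_map (subtopology T V) (top_of_set (\<kappa> ` V)) \<kappa>"
    using chart_homeo homeomorphic_imp_continuous_map by blast
  moreover have "openin (top_of_set (\<kappa> ` V)) (\<kappa> ` V \<inter> S)" using assms by auto
  ultimately have "openin (subtopology T V) {x \<in> topspace (subtopology T V). \<kappa> x \<in> \<kappa> ` V \<inter> S}"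
    by (rule openin_continuous_map_preimage)
  moreover have "{x \<in> topspace (subtopology T V). \<kappa> x \<in> \<kappa> ` V \<inter> S} = {x \<in> V. \<kappa> x \<in> S}"
    by (auto simp: topspace_chart simp del: topspace_subtopology)
  ultimately have "openin (subtopology T V) {x \<in> V. \<kappa> x \<in> S}" by (simp only:)
  then show ?thesis using openin_open_subtopology[OF chart_open(1)] by blast
qed

lemma chart_inv_open:
  assumes "openin T S" shows "open {y \<in> \<kappa> ` V. inv_into V \<kappa> y \<in> S}"
proof -
  have "{y \<in> \<kappa> ` V. inv_into V \<kappa> y \<in> S} = \<kappa> ` (V \<inter> S)"
    using chart_inv by force
  then show ?thesis using chart_image_open[OF assms] by simp
qed

lemma smooth_fun_chart: "smooth_fun X f \<Longrightarrow> smooth_on (\<kappa> ` V) (\<lambda>y. f (inv_into V \<kappa> y))"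
  using ch by (auto simp: smooth_fun_def o_def)

end

lemma prod_chart_image_open:
  assumes "(V, \<kappa>) \<in> charts X" "(W, \<omega>) \<in> charts X" "openin (prod_topology T T) S" "S \<subseteq> V \<times> W"
  shows "open (map_prod \<kappa> \<omega> ` S)"
proof (rule openI)
  fix z assume "z \<in> map_prod \<kappa> \<omega> ` S"
  then obtain a b where ab: "(a, b) \<in> S" "z = (\<kappa> a, \<omega> b)" by auto
  then obtain A B where AB: "openin T A" "openin T B" "a \<in> A" "b \<in> B" "A \<times> B \<subseteq> S"
    using assms(3)[unfolded openin_prod_topology_alt, rule_format, OF ab(1)] by blast
  have "A \<subseteq> V" "B \<subseteq> W" using AB assms(4) by auto
  then have "open (\<kappa> ` A)" "open (\<omega> ` B)"
    using chart_image_open[OF assms(1) AB(1)] chart_image_open[OF assms(2) AB(2)]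
    by (auto simp: Int_absorb1)
  then have "open (\<kappa> ` A \<times> \<omega> ` B)" by (rule open_Times)
  moreover have "\<kappa> ` A \<times> \<omega> ` B \<subseteq> map_prod \<kappa> \<omega> ` S" using AB(5) by force
  moreover have "z \<in> \<kappa> ` A \<times> \<omega> ` B" using AB ab by auto
  ultimately show "\<exists>e>0. ball z e \<subseteq> map_prod \<kappa> \<omega> ` S"
    by (meson open_contains_ball subset_trans)
qed

lemma mult_chart:
  assumes "(V, \<kappa>) \<in> charts X" "(W, \<omega>) \<in> charts X" "(Y, \<xi>) \<in> charts X"
  defines "S \<equiv> {(y, z). y \<in> \<kappa> ` V \<and> z \<in> \<omega> ` W \<and> inv_into V \<kappa> y \<otimes> inv_into W \<omega> z \<in> Y}"
  shows "open S" "smooth_on S (\<lambda>(y, z). \<xi> (inv_into V \<kappa> y \<otimes> inv_into W \<omega> z))"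
proof -
  let ?m = "\<lambda>(x, y). x \<otimes> y"
  let ?P = "(V \<times> W) \<inter> ?m -` Y"
  have eq: "S = map_prod \<kappa> \<omega> ` ?P"
    unfolding S_def using chart_inv[OF assms(1)] chart_inv[OF assms(2)]
    by (auto simp: image_iff)
  have "openin (prod_topology T T) {p \<in> topspace (prod_topology T T). ?m p \<in> Y}"
    by (rule openin_continuous_map_preimage[OF continuous_mult chart_open(1)[OF assms(3)]])
  moreover have "openin (prod_topology T T) (V \<times> W)"
    using chart_open(1)[OF assms(1)] chart_open(1)[OF assms(2)] by (simp add: openin_prod_Times_iff)
  ultimately have "openin (prod_topology T T) ((V \<times> W) \<inter> {p \<in> topspace (prod_topology T T). ?m p \<in> Y})"
    by blast
  moreover have "(V \<times> W) \<inter> {p \<in> topspace (prod_topology T T). ?m p \<in> Y} = ?P"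
    using chart_sub[OF assms(1)] chart_sub[OF assms(2)] points_X by auto
  ultimately have op: "openin (prod_topology T T) ?P" by simp
  show S: "open S"
    unfolding eq by (rule prod_chart_image_open[OF assms(1,2) op]) auto
  have "(V \<times> W, map_prod \<kappa> \<omega>) \<in> charts (prod_mfd X X)"
    using assms(1,2) by (auto simp: prod_mfd_def)
  then have sm: "smooth_on S (\<xi> \<circ> ?m \<circ> inv_into (V \<times> W) (map_prod \<kappa> \<omega>))"
    using mult_smooth_map assms(3) unfolding smooth_map_def eq by blast
  have "inv_into (V \<times> W) (map_prod \<kappa> \<omega>) (y, z) = (inv_into V \<kappa> y, inv_into W \<omega> z)"
    if "y \<in> \<kappa> ` V" "z \<in> \<omega> ` W" for y z
  proof (rule inv_into_f_eq)
    show "inj_on (map_prod \<kappa> \<omega>) (V \<times> W)"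
      using chart_inj[OF assms(1)] chart_inj[OF assms(2)] by (auto simp: inj_on_def)
  qed (use that chart_inv[OF assms(1)] chart_inv[OF assms(2)] in auto)
  then show "smooth_on S (\<lambda>(y, z). \<xi> (inv_into V \<kappa> y \<otimes> inv_into W \<omega> z))"
    using smooth_on_cong[OF S, of "\<xi> \<circ> ?m \<circ> inv_into (V \<times> W) (map_prod \<kappa> \<omega>)"
        "\<lambda>(y, z). \<xi> (inv_into V \<kappa> y \<otimes> inv_into W \<omega> z)"] sm
    by (auto simp: S_def)
qed

text \<open>Locally the product lies in some chart of the group, and the function is a composition of
  smooth maps.\<close>

lemma smooth_fun_mult_chart:
  assumes "(V, \<kappa>) \<in> charts X" "(W, \<omega>) \<in> charts X" "smooth_fun X f"
  shows "smooth_on (\<kappa> ` V \<times> \<omega> ` W) (\<lambda>(y, z). f (inv_into V \<kappa> y \<otimes> inv_into W \<omega> z))"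
proof (rule smooth_on_local)
  fix p assume p: "p \<in> \<kappa> ` V \<times> \<omega> ` W"
  obtain y0 z0 where yz: "p = (y0, z0)" "y0 \<in> \<kappa> ` V" "z0 \<in> \<omega> ` W" using p by auto
  let ?m = "\<lambda>(y, z). inv_into V \<kappa> y \<otimes> inv_into W \<omega> z"
  have "inv_into V \<kappa> y0 \<otimes> inv_into W \<omega> z0 \<in> carrier G"
    using yz chart_inv_carrier[OF assms(1)] chart_inv_carrier[OF assms(2)] by auto
  then obtain Y \<xi> where Y: "(Y, \<xi>) \<in> charts X" "inv_into V \<kappa> y0 \<otimes> inv_into W \<omega> z0 \<in> Y"
    using chart_at by blast
  let ?S = "{(y, z). y \<in> \<kappa> ` V \<and> z \<in> \<omega> ` W \<and> inv_into V \<kappa> y \<otimes> inv_into W \<omega> z \<in> Y}"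
  note S = mult_chart[OF assms(1,2) Y(1)]
  have "smooth_on ?S (\<lambda>p. f (inv_into Y \<xi> ((\<lambda>(y, z). \<xi> (inv_into V \<kappa> y \<otimes> inv_into W \<omega> z)) p)))"
    by (rule smooth_on_compose[OF S(1) chart_open(2)[OF Y(1)] _ S(2) smooth_fun_chart[OF Y(1) assms(3)]]) auto
  then have "smooth_on ?S (\<lambda>p. f (?m p))"
    by (subst smooth_on_cong[OF S(1)]) (auto simp: chart_inv(3)[OF Y(1)])
  then have "smooth_on ?S (\<lambda>(y, z). f (inv_into V \<kappa> y \<otimes> inv_into W \<omega> z))"
    by (simp add: case_prod_unfold)
  then show "\<exists>S. open S \<and> p \<in> S \<and> smooth_on S (\<lambda>(y, z). f (inv_into V \<kappa> y \<otimes> inv_into W \<omega> z))"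
    using S(1) yz Y by blast
qed

lemma smooth_on_Pair_left: "open S \<Longrightarrow> smooth_on S (\<lambda>z. (c, z))"
  by (intro smooth_on_Pair smooth_on_const smooth_on_id)

lemma smooth_on_Pair_right: "open S \<Longrightarrow> smooth_on S (\<lambda>z. (z, c))"
  by (intro smooth_on_Pair smooth_on_const smooth_on_id)

lemma smooth_fun_left:
  assumes "smooth_fun X f" "g \<in> carrier G"
  shows "smooth_fun X (\<lambda>x. f (g \<otimes> x))"
  unfolding smooth_fun_def
proof clarify
  fix V \<kappa> assume V: "(V, \<kappa>) \<in> charts X"
  obtain W \<omega> where W: "(W, \<omega>) \<in> charts X" "g \<in> W" using chart_at assms(2) by blast
  have "smooth_on (\<kappa> ` V) (\<lambda>z. (\<lambda>(y, z). f (inv_into W \<omega> y \<otimes> inv_into V \<kappa> z)) (\<omega> g, z))"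
    by (rule smooth_on_compose[OF _ _ _ smooth_on_Pair_left smooth_fun_mult_chart[OF W(1) V assms(1)]])
      (use chart_open(2)[OF V] chart_open(2)[OF W(1)] W(2) in \<open>auto intro: open_Times\<close>)
  then show "smooth_on (\<kappa> ` V) ((\<lambda>x. f (g \<otimes> x)) \<circ> inv_into V \<kappa>)"
    by (simp add: o_def chart_inv(3)[OF W])
qed

lemma smooth_fun_right:
  assumes "smooth_fun X f" "g \<in> carrier G"
  shows "smooth_fun X (\<lambda>x. f (x \<otimes> g))"
  unfolding smooth_fun_def
proof clarify
  fix V \<kappa> assume V: "(V, \<kappa>) \<in> charts X"
  obtain W \<omega> where W: "(W, \<omega>) \<in> charts X" "g \<in> W" using chart_at assms(2) by blast
  have "smooth_on (\<kappa> ` V) (\<lambda>z. (\<lambda>(y, z). f (inv_into V \<kappa> y \<otimes> inv_into W \<omega> z)) (z, \<omega> g))"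
    by (rule smooth_on_compose[OF _ _ _ smooth_on_Pair_right smooth_fun_mult_chart[OF V W(1) assms(1)]])
      (use chart_open(2)[OF V] chart_open(2)[OF W(1)] W(2) in \<open>auto intro: open_Times\<close>)
  then show "smooth_on (\<kappa> ` V) ((\<lambda>x. f (x \<otimes> g)) \<circ> inv_into V \<kappa>)"
    by (simp add: o_def chart_inv(3)[OF W])
qed

lemma continuous_left: "g \<in> carrier G \<Longrightarrow> continuous_map T T (\<lambda>x. g \<otimes> x)"
  using continuous_map_compose[OF _ continuous_mult, of T "\<lambda>x. (g, x)"] points_X
  by (simp add: o_def continuous_map_pairedI)

lemma continuous_right: "g \<in> carrier G \<Longrightarrow> continuous_map T T (\<lambda>x. x \<otimes> g)"
  using continuous_map_compose[OF _ continuous_mult, of T "\<lambda>x. (x, g)"] points_X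
  by (simp add: o_def continuous_map_pairedI)

lemma left_open: "g \<in> carrier G \<Longrightarrow> openin T S \<Longrightarrow> openin T {x \<in> carrier G. g \<otimes> x \<in> S}"
  using openin_continuous_map_preimage[OF continuous_left] points_X by simp

lemma right_open: "g \<in> carrier G \<Longrightarrow> openin T S \<Longrightarrow> openin T {x \<in> carrier G. x \<otimes> g \<in> S}"
  using openin_continuous_map_preimage[OF continuous_right] points_X by simp

lemma left_chart:
  assumes g: "g \<in> carrier G" and V: "(V, \<kappa>) \<in> charts X" and W: "(W, \<omega>) \<in> charts X"
  shows "open {y \<in> \<kappa> ` V. g \<otimes> inv_into V \<kappa> y \<in> W}"
    "smooth_on {y \<in> \<kappa> ` V. g \<otimes> inv_into V \<kappa> y \<in> W} (\<lambda>y. \<omega> (g \<otimes> inv_into V \<kappa> y))"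
proof -
  show o: "open {y \<in> \<kappa> ` V. g \<otimes> inv_into V \<kappa> y \<in> W}"
    using chart_inv_open[OF V left_open[OF g chart_open(1)[OF W]]] chart_inv_carrier[OF V]
    by (simp add: conj_assoc cong: conj_cong)
  obtain Y \<xi> where Y: "(Y, \<xi>) \<in> charts X" "g \<in> Y" using chart_at g by blast
  have "smooth_on {y \<in> \<kappa> ` V. g \<otimes> inv_into V \<kappa> y \<in> W} (\<lambda>z. (\<lambda>(y, z). \<omega> (inv_into Y \<xi> y \<otimes> inv_into V \<kappa> z)) (\<xi> g, z))"
    by (rule smooth_on_compose[OF o mult_chart(1)[OF Y(1) V W] _ smooth_on_Pair_left[OF o] mult_chart(2)[OF Y(1) V W]])
      (use Y(2) in \<open>auto simp: chart_inv(3)[OF Y(1)]\<close>)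
  then show "smooth_on {y \<in> \<kappa> ` V. g \<otimes> inv_into V \<kappa> y \<in> W} (\<lambda>y. \<omega> (g \<otimes> inv_into V \<kappa> y))"
    by (simp add: chart_inv(3)[OF Y])
qed

lemma right_chart:
  assumes g: "g \<in> carrier G" and V: "(V, \<kappa>) \<in> charts X" and W: "(W, \<omega>) \<in> charts X"
  shows "open {y \<in> \<kappa> ` V. inv_into V \<kappa> y \<otimes> g \<in> W}"
    "smooth_on {y \<in> \<kappa> ` V. inv_into V \<kappa> y \<otimes> g \<in> W} (\<lambda>y. \<omega> (inv_into V \<kappa> y \<otimes> g))"
proof -
  show o: "open {y \<in> \<kappa> ` V. inv_into V \<kappa> y \<otimes> g \<in> W}"
    using chart_inv_open[OF V right_open[OF g chart_open(1)[OF W]]] chart_inv_carrier[OF V]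
    by (simp add: conj_assoc cong: conj_cong)
  obtain Y \<xi> where Y: "(Y, \<xi>) \<in> charts X" "g \<in> Y" using chart_at g by blast
  have "smooth_on {y \<in> \<kappa> ` V. inv_into V \<kappa> y \<otimes> g \<in> W} (\<lambda>z. (\<lambda>(y, z). \<omega> (inv_into V \<kappa> y \<otimes> inv_into Y \<xi> z)) (z, \<xi> g))"
    by (rule smooth_on_compose[OF o mult_chart(1)[OF V Y(1) W] _ smooth_on_Pair_right[OF o] mult_chart(2)[OF V Y(1) W]])
      (use Y(2) in \<open>auto simp: chart_inv(3)[OF Y(1)]\<close>)
  then show "smooth_on {y \<in> \<kappa> ` V. inv_into V \<kappa> y \<otimes> g \<in> W} (\<lambda>y. \<omega> (inv_into V \<kappa> y \<otimes> g))"
    by (simp add: chart_inv(3)[OF Y])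
qed

lemma div_nbhd:
  assumes "openin T S" "\<one> \<in> S"
  shows "\<exists>W. openin T W \<and> \<one> \<in> W \<and> (\<forall>a\<in>W. \<forall>b\<in>W. a \<otimes> inv b \<in> S)"
proof -
  have "continuous_map (prod_topology T T) T (\<lambda>p. (\<lambda>(x, y). x \<otimes> y) (fst p, inv (snd p)))"
  proof -
    have "continuous_map (prod_topology T T) T (\<lambda>p. inv (snd p))"
      using continuous_map_compose[OF continuous_map_snd continuous_inv] by (simp add: o_def)
    from continuous_map_compose[OF continuous_map_pairedI[OF continuous_map_fst this] continuous_mult]
    show ?thesis by (simp add: o_def)
  qed
  then have "openin (prod_topology T T) {p \<in> topspace (prod_topology T T). fst p \<otimes> inv (snd p) \<in> S}"
    using openin_continuous_map_preimage[OF _ assms(1)] by fastforce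
  moreover have "(\<one>, \<one>) \<in> {p \<in> topspace (prod_topology T T). fst p \<otimes> inv (snd p) \<in> S}"
    using assms(2) points_X by auto
  ultimately have "\<exists>A B. openin T A \<and> openin T B \<and> \<one> \<in> A \<and> \<one> \<in> B \<and>
      A \<times> B \<subseteq> {p \<in> topspace (prod_topology T T). fst p \<otimes> inv (snd p) \<in> S}"
    unfolding openin_prod_topology_alt by (elim allE impE)
  then obtain A B where AB: "openin T A" "openin T B" "\<one> \<in> A" "\<one> \<in> B"
      "A \<times> B \<subseteq> {p \<in> topspace (prod_topology T T). fst p \<otimes> inv (snd p) \<in> S}"
    by blast
  then show ?thesis by (intro exI[of _ "A \<inter> B"]) auto
qed

subsection \<open>The chart at the identity\<close>

lemma U_sub: "U \<subseteq> carrier G" using chart_sub[OF chart] .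
lemma open_D: "open D" using chart_open(2)[OF chart] .
lemma e0_D: "e0 \<in> D" using one_U by simp
lemma psi_U: "y \<in> D \<Longrightarrow> \<psi> y \<in> U" by (rule chart_inv(1)[OF chart])
lemma psi_carrier: "y \<in> D \<Longrightarrow> \<psi> y \<in> carrier G" by (rule chart_inv_carrier[OF chart])
lemma phi_psi: "y \<in> D \<Longrightarrow> \<phi> (\<psi> y) = y" by (rule chart_inv(2)[OF chart])
lemma psi_phi: "x \<in> U \<Longrightarrow> \<psi> (\<phi> x) = x" by (rule chart_inv(3)[OF chart])
lemma psi_e0: "\<psi> e0 = \<one>" by (rule psi_phi[OF one_U])

lemma ball_in_open:
  assumes "openin T S" "\<one> \<in> S"
  shows "\<exists>r>0. ball e0 r \<subseteq> D \<and> (\<forall>y\<in>ball e0 r. \<psi> y \<in> S)"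
proof -
  have "open {y \<in> D. \<psi> y \<in> S}" "e0 \<in> {y \<in> D. \<psi> y \<in> S}"
    using chart_inv_open[OF chart assms(1)] assms(2) e0_D psi_e0 by auto
  then obtain r where "r > 0" "ball e0 r \<subseteq> {y \<in> D. \<psi> y \<in> S}" by (meson openE)
  then show ?thesis by (intro exI[of _ r]) blast
qed

text \<open>Near \<open>g\<close>, any chart differs from the chart at the identity by the left translation by \<open>inv g\<close>,
  read in these two charts.\<close>

lemma smooth_funI_local:
  assumes "\<And>g. g \<in> carrier G \<Longrightarrow> \<exists>r>0. smooth_on (ball e0 r \<inter> D) (\<lambda>y. f (g \<otimes> \<psi> y))"
  shows "smooth_fun X f"
  unfolding smooth_fun_def o_def
proof (clarify, rule smooth_on_local)
  fix V \<kappa> y1 assume V: "(V, \<kappa>) \<in> charts X" and y1: "y1 \<in> \<kappa> ` V"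
  define g where "g = inv_into V \<kappa> y1"
  have g: "g \<in> carrier G" unfolding g_def using y1 chart_inv_carrier[OF V] by blast
  obtain r where r: "r > 0" "smooth_on (ball e0 r \<inter> D) (\<lambda>y. f (g \<otimes> \<psi> y))" using assms[OF g] by blast
  let ?S = "{y \<in> \<kappa> ` V. inv g \<otimes> inv_into V \<kappa> y \<in> U}"
  let ?k = "\<lambda>y. \<phi> (inv g \<otimes> inv_into V \<kappa> y)"
  note S = left_chart[OF inv_closed[OF g] V chart]
  have oB: "open (ball e0 r \<inter> D)" using open_D by auto
  let ?S2 = "?S \<inter> ?k -` (ball e0 r \<inter> D)"
  have o2: "open ?S2"
    using continuous_open_preimage[OF smooth_on_continuous[OF S(2)] S(1) oB] .
  have y1S: "y1 \<in> ?S2"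
    using y1 r(1) one_U e0_D g by (auto simp: g_def[symmetric] l_inv)
  have "smooth_on ?S2 (\<lambda>y. f (g \<otimes> \<psi> (?k y)))"
    by (rule smooth_on_compose[OF o2 oB _ smooth_on_subset[OF o2 _ S(2)] r(2)]) auto
  then have "smooth_on ?S2 (\<lambda>y. f (inv_into V \<kappa> y))"
  proof (subst smooth_on_cong[OF o2])
    fix y assume y: "y \<in> ?S2"
    have "g \<otimes> (inv g \<otimes> inv_into V \<kappa> y) = inv_into V \<kappa> y"
      using g y chart_inv_carrier[OF V] by (auto simp: m_assoc[symmetric])
    then show "f (inv_into V \<kappa> y) = f (g \<otimes> \<psi> (?k y))" using y psi_phi by auto
  qed
  then show "\<exists>S. open S \<and> y1 \<in> S \<and> smooth_on S (\<lambda>y. f (inv_into V \<kappa> y))"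
    using o2 y1S by blast
qed

lemma smooth_on_D: "smooth_fun X f \<Longrightarrow> smooth_on D (\<lambda>y. f (\<psi> y))"
  by (rule smooth_fun_chart[OF chart])

lemma smooth_on_D_left: "smooth_fun X f \<Longrightarrow> g \<in> carrier G \<Longrightarrow> smooth_on D (\<lambda>y. f (g \<otimes> \<psi> y))"
  using smooth_on_D[OF smooth_fun_left] .

lemma smooth_on_DD:
  assumes "smooth_fun X f" "g \<in> carrier G"
  shows "smooth_on (D \<times> D) (\<lambda>(y, z). f (g \<otimes> \<psi> y \<otimes> \<psi> z))"
proof -
  have "smooth_on (D \<times> D) (\<lambda>(y, z). f (g \<otimes> (\<psi> y \<otimes> \<psi> z)))"
    using smooth_fun_mult_chart[OF chart chart smooth_fun_left[OF assms]] .
  then show ?thesis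
    by (subst smooth_on_cong[OF open_Times[OF open_D open_D]]) (auto simp: m_assoc assms psi_carrier)
qed

lemma smooth_fun_iff: "smooth_fun X f \<longleftrightarrow> (\<forall>g\<in>carrier G. smooth_on D (\<lambda>y. f (g \<otimes> \<psi> y)))"
proof
  assume "\<forall>g\<in>carrier G. smooth_on D (\<lambda>y. f (g \<otimes> \<psi> y))"
  then show "smooth_fun X f"
    by (intro smooth_funI_local exI[of _ 1]) (auto intro: smooth_on_subset[of _ D] simp: open_D open_Int)
qed (simp add: smooth_on_D_left)

text \<open>Left and (further below) right translations read in the chart at the identity, with the open
  sets on which they do not leave the chart.\<close>

definition ltrans :: "'a \<Rightarrow> 'e \<Rightarrow> 'e" where "ltrans g y = \<phi> (g \<otimes> \<psi> y)"
definition ltrans_dom :: "'a \<Rightarrow> 'e set" where "ltrans_dom g = {y \<in> D. g \<otimes> \<psi> y \<in> U}"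

lemma ltrans_smooth: "g \<in> carrier G \<Longrightarrow> open (ltrans_dom g)" "g \<in> carrier G \<Longrightarrow> smooth_on (ltrans_dom g) (ltrans g)"
  using left_chart[OF _ chart chart] by (simp_all add: ltrans_dom_def ltrans_def[abs_def])

text \<open>The function \<open>k\<close> of the coordinates, cut off and extended by zero to the group.\<close>

definition bump_ext :: "real \<Rightarrow> ('e \<Rightarrow> real) \<Rightarrow> 'a \<Rightarrow> real" where
  "bump_ext r k x = (if x \<in> U \<and> \<phi> x \<in> ball e0 r then bump r (\<phi> x - e0) * k (\<phi> x) else 0)"

text \<open>The cut-off function vanishes outside the closed coordinate ball of radius \<open>r / 2\<close>. The image of this ball in
  the group is compact and therefore closed, so every point outside of it has a neighbourhood on
  which the extension is zero.\<close>

lemma smooth_bump_ext: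
  assumes r: "r > 0" "ball e0 r \<subseteq> D" and k: "smooth_on (ball e0 r) k"
  shows "smooth_fun X (bump_ext r k)"
proof (rule smooth_funI_local)
  fix g assume g: "g \<in> carrier G"
  define C where "C = \<psi> ` cball e0 (r/2)"
  have cD: "cball e0 (r/2) \<subseteq> ball e0 r" using r by auto
  show "\<exists>s>0. smooth_on (ball e0 s \<inter> D) (\<lambda>y. bump_ext r k (g \<otimes> \<psi> y))"
  proof (cases "g \<in> U \<and> \<phi> g \<in> ball e0 r")
    case True
    let ?S = "ltrans_dom g \<inter> ltrans g -` ball e0 r"
    have o: "open ?S"
      using continuous_open_preimage[OF smooth_on_continuous[OF ltrans_smooth(2)[OF g]] ltrans_smooth(1)[OF g]] by simp
    have "e0 \<in> ?S" using True g e0_D by (auto simp: ltrans_dom_def ltrans_def psi_e0)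
    then obtain s where s: "s > 0" "ball e0 s \<subseteq> ?S" using o openE by blast
    have "smooth_on ?S (\<lambda>y. bump r (ltrans g y - e0) * k (ltrans g y))"
    proof (intro smooth_on_mult o)
      have l: "smooth_on ?S (ltrans g)" by (rule smooth_on_subset[OF o _ ltrans_smooth(2)[OF g]]) auto
      show "smooth_on ?S (\<lambda>y. k (ltrans g y))"
        by (rule smooth_on_compose[OF o open_ball _ l k]) auto
      show "smooth_on ?S (\<lambda>y. bump r (ltrans g y - e0))"
        by (rule smooth_on_compose[OF o open_UNIV subset_UNIV smooth_on_diff[OF o l smooth_on_const] smooth_on_bump])
    qed
    then have "smooth_on (ball e0 s \<inter> D) (\<lambda>y. bump r (ltrans g y - e0) * k (ltrans g y))"
      by (rule smooth_on_subset[rotated 2]) (use s open_D in auto)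
    then have "smooth_on (ball e0 s \<inter> D) (\<lambda>y. bump_ext r k (g \<otimes> \<psi> y))"
    proof (subst smooth_on_cong)
      show "open (ball e0 s \<inter> D)" using open_D by auto
      show "bump_ext r k (g \<otimes> \<psi> y) = bump r (ltrans g y - e0) * k (ltrans g y)" if "y \<in> ball e0 s \<inter> D" for y
        using that s(2) by (auto simp: bump_ext_def ltrans_def ltrans_dom_def)
    qed
    then show ?thesis using s(1) by blast
  next
    case False
    have "compactin T C"
    proof -
      have "continuous_map (top_of_set D) T \<psi>"
        using chart_inv_open[OF chart] psi_carrier points_X open_D
        by (auto simp: continuous_map_def openin_open_eq)
      moreover have "compactin (top_of_set D) (cball e0 (r/2))"
        using cD r(2) by (simp add: compactin_subtopology)
      ultimately show ?thesis unfolding C_def by (rule image_compactin[rotated])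
    qed
    then have "closedin T C" by (rule compactin_imp_closedin[OF Hausdorff])
    then have "openin T (carrier G - C)" unfolding closedin_def points_X by (rule conjunct2)
    then have "openin T {x \<in> carrier G. g \<otimes> x \<in> carrier G - C}" using left_open[OF g] by blast
    moreover have "g \<notin> C"
    proof
      assume "g \<in> C"
      then obtain y where "y \<in> cball e0 (r/2)" "g = \<psi> y" unfolding C_def by auto
      moreover from this have "y \<in> ball e0 r" "y \<in> D" using cD r(2) by blast+
      ultimately show False using False psi_U[of y] phi_psi[of y] by simp
    qed
    ultimately have "openin T {x \<in> carrier G. g \<otimes> x \<in> carrier G - C}"
      "\<one> \<in> {x \<in> carrier G. g \<otimes> x \<in> carrier G - C}" using g by auto
    from ball_in_open[OF this]
    obtain s where s: "s > 0" "ball e0 s \<subseteq> D" "\<forall>y\<in>ball e0 s. g \<otimes> \<psi> y \<in> carrier G - C"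
      by (metis (mono_tags, lifting) mem_Collect_eq)
    have "bump_ext r k (g \<otimes> \<psi> y) = 0" if y: "y \<in> ball e0 s" for y
    proof -
      let ?x = "g \<otimes> \<psi> y"
      have "bump r (\<phi> ?x - e0) = 0" if "?x \<in> U" "\<phi> ?x \<in> ball e0 r"
      proof (rule bump_eq_0[OF r(1)])
        have "\<phi> ?x \<notin> cball e0 (r/2)" using bspec[OF s(3) y] psi_phi[OF that(1)] unfolding C_def
          by (metis DiffD2 image_eqI)
        then show "r / 2 \<le> norm (\<phi> ?x - e0)" by (simp add: dist_norm norm_minus_commute)
      qed
      then show ?thesis by (simp add: bump_ext_def)
    qed
    then have "smooth_on (ball e0 s \<inter> D) (\<lambda>y. bump_ext r k (g \<otimes> \<psi> y))"
      by (subst smooth_on_cong[of _ _ "\<lambda>y. 0"]) (auto simp: open_D open_Int smooth_on_const)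
    then show ?thesis using s(1) by blast
  qed
qed

lemma bump_ext_plateau:
  assumes "r > 0" "ball e0 r \<subseteq> D" "y \<in> ball e0 (r/3)" shows "bump_ext r k (\<psi> y) = k y"
proof -
  have y: "y \<in> ball e0 r" "norm (y - e0) \<le> r / 3" using assms(1,3) by (auto simp: dist_norm norm_minus_commute)
  then show ?thesis
    using assms(2) psi_U phi_psi bump_plateau[OF assms(1) y(2)] by (auto simp: bump_ext_def subset_iff)
qed

lemma bump_ext_nonzero: "bump_ext r k x \<noteq> 0 \<Longrightarrow> x \<in> U \<and> \<phi> x \<in> ball e0 r"
  by (auto simp: bump_ext_def split: if_splits)

definition supp_in :: "real \<Rightarrow> ('a \<Rightarrow> real) \<Rightarrow> bool" where
  "supp_in r F \<longleftrightarrow> (\<forall>x\<in>carrier G. F x \<noteq> 0 \<longrightarrow> x \<in> \<psi> ` ball e0 r)"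

lemma supp_bump_ext: "ball e0 r \<subseteq> D \<Longrightarrow> supp_in r (bump_ext r k)"
  unfolding supp_in_def by (metis bump_ext_nonzero image_eqI psi_phi)

lemma supp_mult: "supp_in r F \<Longrightarrow> supp_in r (\<lambda>x. F x * f x)"
  by (auto simp: supp_in_def)

text \<open>A derivation only depends on germs, because of the cut-off functions.\<close>

lemma tangent_local_X:
  assumes u: "u \<in> \<gg>" and f: "smooth_fun X f" "smooth_fun X f'" and r: "r > 0"
    and eq: "\<And>z. z \<in> ball e0 r \<Longrightarrow> z \<in> D \<Longrightarrow> f (\<psi> z) = f' (\<psi> z)"
  shows "u f = u f'"
proof -
  obtain s where s: "s > 0" "ball e0 s \<subseteq> D" using open_D e0_D openE by blast
  define t where "t = min r s"
  have t: "t > 0" "ball e0 t \<subseteq> D" "ball e0 t \<subseteq> ball e0 r" using r s by (auto simp: t_def)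
  show ?thesis
  proof (rule tangent_local[OF u open_charts_X f smooth_bump_ext[OF t(1,2) smooth_on_const[of _ 1]]])
    show "bump_ext t (\<lambda>x. 1) \<one> = 1" using bump_ext_plateau[OF t(1,2), of e0] t(1) by (simp add: psi_e0)
    fix x assume "bump_ext t (\<lambda>x. 1) x \<noteq> 0"
    from bump_ext_nonzero[OF this] show "f x = f' x" using eq[of "\<phi> x"] t psi_phi by auto
  qed
qed

subsection \<open>Tangent vectors at the identity\<close>

definition dvec :: "'e \<Rightarrow> 'a tvec" where
  "dvec c f = (if smooth_fun X f then frechet_derivative (\<lambda>y. f (\<psi> y)) (at e0) c else 0)"

lemma dvec_has_derivative:
  "smooth_fun X f \<Longrightarrow> ((\<lambda>y. f (\<psi> y)) has_derivative (\<lambda>c. dvec c f)) (at e0)"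
  using smooth_on_has_derivative[OF open_D smooth_on_D e0_D] by (simp add: dvec_def[abs_def])

lemma dvec_eqI:
  "smooth_fun X f \<Longrightarrow> ((\<lambda>y. f (\<psi> y)) has_derivative f') (at e0) \<Longrightarrow> dvec c f = f' c"
  using dvec_has_derivative has_derivative_unique by metis

lemma dvec_in: "dvec c \<in> \<gg>"
  unfolding tangent_space_def
proof (safe)
  fix f g assume f: "smooth_fun X f" and g: "smooth_fun X g"
  show "dvec c (\<lambda>x. f x + g x) = dvec c f + dvec c g"
    by (rule dvec_eqI[OF smooth_fun_add[OF open_charts_X f g]
         has_derivative_add[OF dvec_has_derivative[OF f] dvec_has_derivative[OF g]]])
  show "dvec c (\<lambda>x. f x * g x) = f \<one> * dvec c g + g \<one> * dvec c f"
    using dvec_eqI[OF smooth_fun_mult[OF open_charts_X f g]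
         has_derivative_mult[OF dvec_has_derivative[OF f] dvec_has_derivative[OF g]]]
    by (simp add: psi_e0 mult.commute)
next
  fix a f assume f: "smooth_fun X f"
  show "dvec c (\<lambda>x. a * f x) = a * dvec c f"
    by (rule dvec_eqI[OF smooth_fun_cmult[OF open_charts_X f]
         has_derivative_mult_right[OF dvec_has_derivative[OF f]]])
qed (simp add: dvec_def)

lemma linear_dvec: "linear dvec"
proof (rule linearI)
  show "dvec (a + b) = dvec a + dvec b" for a b
    using linear_add[OF has_derivative_linear[OF dvec_has_derivative]]
    by (auto simp: fun_eq_iff) (metis add.right_neutral dvec_def)
  show "dvec (s *\<^sub>R b) = s *\<^sub>R dvec b" for s b
    using linear_cmul[OF has_derivative_linear[OF dvec_has_derivative]]
    by (auto simp: fun_eq_iff scaleR_fun_def) (metis dvec_def mult_zero_right)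
qed

definition r0 :: real where "r0 = (SOME r. r > 0 \<and> ball e0 r \<subseteq> D)"

lemma r0: "r0 > 0" "ball e0 r0 \<subseteq> D"
proof -
  have "\<exists>r. r > 0 \<and> ball e0 r \<subseteq> D" using open_D e0_D openE by metis
  then show "r0 > 0" "ball e0 r0 \<subseteq> D" unfolding r0_def by (metis (mono_tags, lifting) someI_ex)+
qed

definition coordf :: "'e \<Rightarrow> 'a \<Rightarrow> real" where "coordf b = bump_ext r0 (\<lambda>y. (y - e0) \<bullet> b)"

lemma smooth_coordf: "smooth_fun X (coordf b)"
  unfolding coordf_def
  by (rule smooth_bump_ext[OF r0 smooth_on_linear[OF open_ball bounded_linear_inner_left smooth_on_diff[OF open_ball smooth_on_id smooth_on_const]]])

lemma coordf_near: "y \<in> ball e0 (r0/3) \<Longrightarrow> coordf b (\<psi> y) = (y - e0) \<bullet> b"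
  unfolding coordf_def by (rule bump_ext_plateau[OF r0])

definition coordv :: "'a tvec \<Rightarrow> 'e" where "coordv u = (\<Sum>b\<in>Basis. u (coordf b) *\<^sub>R b)"

text \<open>By Hadamard's lemma \<open>f - f \<one>\<close> is, near the identity, a sum of products of coordinate functions
  with smooth functions. All coordinates vanish at the identity, so a derivation only differentiates them.\<close>

lemma dvec_coordv:
  assumes u: "u \<in> \<gg>" shows "dvec (coordv u) = u"
proof
  fix f
  show "dvec (coordv u) f = u f"
  proof (cases "smooth_fun X f")
    case False
    then show ?thesis using tangent_nonsmooth[OF u] by (simp add: dvec_def)
  next
    case f: True
    have fb: "smooth_on (ball e0 r0) (\<lambda>y. f (\<psi> y))"
      by (rule smooth_on_subset[OF open_ball r0(2) smooth_on_D[OF f]])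
    obtain h where h: "\<And>b. smooth_on (ball e0 r0) (h b)"
      "\<And>b. h b e0 = frechet_derivative (\<lambda>y. f (\<psi> y)) (at e0) b"
      "\<And>y. y \<in> ball e0 r0 \<Longrightarrow> f (\<psi> y) = f (\<psi> e0) + (\<Sum>b\<in>Basis. ((y - e0) \<bullet> b) * h b y)"
      using Hadamard[OF r0(1) fb] by blast
    let ?H = "\<lambda>b. bump_ext r0 (h b)"
    have H: "smooth_fun X (?H b)" for b by (rule smooth_bump_ext[OF r0 h(1)])
    have cH: "smooth_fun X (\<lambda>x. coordf b x * ?H b x)" for b
      by (rule smooth_fun_mult[OF open_charts_X smooth_coordf H])
    have "u f = u (\<lambda>x. f \<one> + (\<Sum>b\<in>Basis. coordf b x * ?H b x))"
    proof (rule tangent_local_X[OF u f, of _ "r0/3"])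
      show "f (\<psi> z) = f \<one> + (\<Sum>b\<in>Basis. coordf b (\<psi> z) * ?H b (\<psi> z))" if z: "z \<in> ball e0 (r0/3)" for z
      proof -
        have "z \<in> ball e0 r0" using z r0 by auto
        then show ?thesis using h(3) by (simp add: psi_e0 coordf_near[OF z] bump_ext_plateau[OF r0 z])
      qed
    qed (use r0 in \<open>auto intro!: smooth_fun_add smooth_fun_const smooth_fun_sum cH open_charts_X\<close>)
    also have "\<dots> = (\<Sum>b\<in>Basis. u (\<lambda>x. coordf b x * ?H b x))"
      by (subst tangent_add[OF u])
        (auto simp: tangent_const[OF u] tangent_sum[OF u open_charts_X cH] intro!: smooth_fun_const smooth_fun_sum cH open_charts_X)
    also have "\<dots> = (\<Sum>b\<in>Basis. u (coordf b) * dvec b f)"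
    proof (rule sum.cong[OF refl])
      fix b
      have e: "e0 \<in> ball e0 (r0/3)" using r0 by simp
      have "coordf b \<one> = 0" using coordf_near[OF e] by (simp add: psi_e0)
      moreover have "?H b \<one> = dvec b f" using bump_ext_plateau[OF r0 e, of "h b"] f by (simp add: psi_e0 h(2) dvec_def)
      ultimately show "u (\<lambda>x. coordf b x * ?H b x) = u (coordf b) * dvec b f"
        by (simp add: tangent_mult[OF u smooth_coordf H])
    qed
    also have "\<dots> = dvec (coordv u) f"
      unfolding coordv_def linear_sum[OF linear_dvec] linear_cmul[OF linear_dvec]
      by (simp add: sum_fun_apply scaleR_fun_def)
    finally show ?thesis ..
  qed
qed

text \<open>The derivative of \<open>f\<close> along the left-invariant vector field extending \<open>u\<close>.\<close>

definition lder :: "'a tvec \<Rightarrow> ('a \<Rightarrow> real) \<Rightarrow> 'a \<Rightarrow> real" where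
  "lder u f g = u (\<lambda>x. f (g \<otimes> x))"

text \<open>The function \<open>(y, z) \<mapsto> f (g \<otimes> \<psi> y \<otimes> \<psi> z)\<close> is smooth in both variables, and the derivative along a
  left-invariant field is a partial derivative of it. Smoothness in \<open>y\<close> is then evident.\<close>

lemma lder_dvec_DD:
  assumes f: "smooth_fun X f" and g: "g \<in> carrier G" and y: "y \<in> D"
  shows "lder (dvec c) f (g \<otimes> \<psi> y) =
    frechet_derivative (\<lambda>(y, z). f (g \<otimes> \<psi> y \<otimes> \<psi> z)) (at (y, e0)) (0, c)"
proof -
  let ?F = "\<lambda>(y, z). f (g \<otimes> \<psi> y \<otimes> \<psi> z)"
  have "(?F has_derivative frechet_derivative ?F (at (y, e0))) (at (y, e0))"
    by (rule smooth_on_has_derivative[OF open_Times[OF open_D open_D] smooth_on_DD[OF f g]])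
      (use y e0_D in auto)
  moreover have "((\<lambda>z. (y, z)) has_derivative (\<lambda>v. (0, v))) (at e0)"
    by (auto intro!: derivative_eq_intros)
  ultimately have "((\<lambda>z. ?F (y, z)) has_derivative (\<lambda>v. frechet_derivative ?F (at (y, e0)) (0, v))) (at e0)"
    using has_derivative_compose by blast
  then show ?thesis
    unfolding lder_def
    by (intro dvec_eqI[OF smooth_fun_left[OF f]]) (auto simp: g y psi_carrier)
qed

lemma smooth_lder:
  assumes u: "u \<in> \<gg>" and f: "smooth_fun X f" shows "smooth_fun X (lder u f)"
  unfolding smooth_fun_iff
proof
  fix g assume g: "g \<in> carrier G"
  let ?F = "\<lambda>(y, z). f (g \<otimes> \<psi> y \<otimes> \<psi> z)"
  have "smooth_on D (\<lambda>y. frechet_derivative ?F (at (y, e0)) (0, coordv u))"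
    by (rule smooth_on_compose[OF open_D open_Times[OF open_D open_D] _ smooth_on_Pair_right[OF open_D]
       smooth_on_frechet_derivative[OF smooth_on_DD[OF f g]]]) (use e0_D in auto)
  then show "smooth_on D (\<lambda>y. lder u f (g \<otimes> \<psi> y))"
    by (subst smooth_on_cong[OF open_D lder_dvec_DD[OF f g, of _ "coordv u", unfolded dvec_coordv[OF u]]])
qed

end

section \<open>The quotient by a discrete subgroup\<close>

lemma topspace_quotient_topology: "topspace (quotient_topology T \<pi>) = \<pi> ` topspace T"
proof (rule subset_antisym)
  show "topspace (quotient_topology T \<pi>) \<subseteq> \<pi> ` topspace T"
    using openin_topspace[of "quotient_topology T \<pi>"] unfolding openin_quotient_topology by blast
  have "{x \<in> topspace T. \<pi> x \<in> \<pi> ` topspace T} = topspace T" by auto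
  then have "openin (quotient_topology T \<pi>) (\<pi> ` topspace T)" by (simp add: openin_quotient_topology)
  then show "\<pi> ` topspace T \<subseteq> topspace (quotient_topology T \<pi>)" by (rule openin_subset)
qed

locale lie_quotient = lie_chart G X U \<phi>
  for G :: "('a, 'b) monoid_scheme" (structure) and X :: "('a, 'e::euclidean_space) mfd"
    and U :: "'a set" and \<phi> :: "'a \<Rightarrow> 'e" +
  fixes \<Gamma> :: "'a set"
  assumes discrete: "discrete_subgroup G X \<Gamma>"
begin

abbreviation "N \<equiv> quotient_mfd G X \<Gamma>"
abbreviation "\<pi> g \<equiv> \<Gamma> #> g"

lemma Gamma: "subgroup \<Gamma> G" using discrete by (simp add: discrete_subgroup_def)

lemma Gamma_sub: "\<Gamma> \<subseteq> carrier G" using Gamma by (rule subgroup.subset)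

lemma Gamma_carrier: "\<gamma> \<in> \<Gamma> \<Longrightarrow> \<gamma> \<in> carrier G" using Gamma_sub by blast

lemma inv_cancel_left:
  "x \<in> carrier G \<Longrightarrow> y \<in> carrier G \<Longrightarrow> inv x \<otimes> (x \<otimes> y) = y"
  "x \<in> carrier G \<Longrightarrow> y \<in> carrier G \<Longrightarrow> x \<otimes> (inv x \<otimes> y) = y"
  by (simp_all add: m_assoc[symmetric])

lemma pi_eq_iff:
  assumes "g \<in> carrier G" "h \<in> carrier G"
  shows "\<pi> g = \<pi> h \<longleftrightarrow> (\<exists>\<gamma>\<in>\<Gamma>. g = \<gamma> \<otimes> h)"
proof
  assume "\<pi> g = \<pi> h"
  then have "g \<in> \<pi> h" using rcos_self[OF assms(1) Gamma] by simp
  then show "\<exists>\<gamma>\<in>\<Gamma>. g = \<gamma> \<otimes> h" by (auto simp: r_coset_def)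
next
  assume "\<exists>\<gamma>\<in>\<Gamma>. g = \<gamma> \<otimes> h"
  then have "g \<in> \<pi> h" by (auto simp: r_coset_def)
  then show "\<pi> g = \<pi> h" using repr_independence[OF _ assms(2) Gamma] by simp
qed

lemma pi_mult: "g \<in> carrier G \<Longrightarrow> h \<in> carrier G \<Longrightarrow> \<pi> g #> h = \<pi> (g \<otimes> h)"
  by (rule coset_mult_assoc[OF Gamma_sub])

lemma mtop_N: "mtop N = quotient_topology T (\<lambda>g. \<pi> g)"
  by (simp add: quotient_mfd_def Let_def)

lemma points_N: "points N = (\<lambda>g. \<pi> g) ` carrier G"
  by (simp add: mtop_N topspace_quotient_topology points_X)

lemma pi_points: "g \<in> carrier G \<Longrightarrow> \<pi> g \<in> points N"
  using points_N by blast

lemma points_N_E: "p \<in> points N \<Longrightarrow> (\<And>g. g \<in> carrier G \<Longrightarrow> p = \<pi> g \<Longrightarrow> thesis) \<Longrightarrow> thesis"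
  using points_N by blast

subsection \<open>Neighbourhoods adapted to the group\<close>

text \<open>A radius is adapted to \<open>g\<close> if an element of \<open>\<Gamma>\<close> that identifies a point near some \<open>h\<close> with a point near \<open>g\<close> is
  determined by \<open>h\<close> (\<open>adapted_single\<close>). The product of four factors is the one that arises from two such
  identifications.\<close>

definition adapted :: "'a \<Rightarrow> real \<Rightarrow> bool" where
  "adapted g r \<longleftrightarrow> r > 0 \<and> ball e0 r \<subseteq> D \<and>
    (\<forall>a\<in>ball e0 r. \<forall>b\<in>ball e0 r. \<forall>c\<in>ball e0 r. \<forall>d\<in>ball e0 r.
       g \<otimes> (\<psi> a \<otimes> inv (\<psi> b) \<otimes> (\<psi> c \<otimes> inv (\<psi> d))) \<otimes> inv g \<in> \<Gamma> \<longrightarrow>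
       g \<otimes> (\<psi> a \<otimes> inv (\<psi> b) \<otimes> (\<psi> c \<otimes> inv (\<psi> d))) \<otimes> inv g = \<one>)"

lemma adaptedD: "adapted g r \<Longrightarrow> r > 0" "adapted g r \<Longrightarrow> ball e0 r \<subseteq> D"
  by (auto simp: adapted_def)

lemma adapted_mono: "adapted g r \<Longrightarrow> 0 < s \<Longrightarrow> s \<le> r \<Longrightarrow> adapted g s"
  unfolding adapted_def using subset_ball[of s r e0] by blast

text \<open>The identity is an isolated point of \<open>\<Gamma>\<close>; continuity of the division is used twice.\<close>

lemma ex_adapted:
  assumes g: "g \<in> carrier G" shows "\<exists>r. adapted g r"
proof -
  have "openin (subtopology T \<Gamma>) {\<one>}"
    using discrete subgroup.one_closed[OF Gamma] by (simp add: discrete_subgroup_def)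
  then obtain S where S: "openin T S" "{\<one>} = S \<inter> \<Gamma>" by (auto simp: openin_subtopology)
  let ?S1 = "{x \<in> carrier G. g \<otimes> x \<in> {x \<in> carrier G. x \<otimes> inv g \<in> S}}"
  have "openin T ?S1" using left_open[OF g right_open[OF inv_closed[OF g] S(1)]] .
  moreover have "\<one> \<in> ?S1" using g S(2) by auto
  ultimately obtain W1 where W1: "openin T W1" "\<one> \<in> W1" "\<forall>a\<in>W1. \<forall>b\<in>W1. a \<otimes> inv b \<in> ?S1"
    using div_nbhd by blast
  obtain W2 where W2: "openin T W2" "\<one> \<in> W2" "\<forall>a\<in>W2. \<forall>b\<in>W2. a \<otimes> inv b \<in> W1"
    using div_nbhd[OF W1(1,2)] by blast
  obtain r where r: "r > 0" "ball e0 r \<subseteq> D" "\<forall>y\<in>ball e0 r. \<psi> y \<in> W2"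
    using ball_in_open[OF W2(1,2)] by blast
  have "g \<otimes> (\<psi> a \<otimes> inv (\<psi> b) \<otimes> (\<psi> c \<otimes> inv (\<psi> d))) \<otimes> inv g \<in> S"
    if B: "a \<in> ball e0 r" "b \<in> ball e0 r" "c \<in> ball e0 r" "d \<in> ball e0 r" for a b c d
  proof -
    have C: "\<psi> a \<in> carrier G" "\<psi> b \<in> carrier G" "\<psi> c \<in> carrier G" "\<psi> d \<in> carrier G"
      using B r(2) psi_carrier by blast+
    have "\<psi> a \<otimes> inv (\<psi> b) \<in> W1" "\<psi> d \<otimes> inv (\<psi> c) \<in> W1"
      using r(3) W2(3) B by blast+
    then have "\<psi> a \<otimes> inv (\<psi> b) \<otimes> inv (\<psi> d \<otimes> inv (\<psi> c)) \<in> ?S1" using W1(3) by blast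
    then show ?thesis using C by (simp add: inv_mult_group)
  qed
  then show ?thesis using S(2) r unfolding adapted_def by blast
qed

text \<open>From \<open>h \<otimes> a\<^sub>i = \<gamma>\<^sub>i \<otimes> g \<otimes> b\<^sub>i\<close> one gets
  \<open>inv \<gamma>\<^sub>1 \<otimes> \<gamma>\<^sub>2 = g \<otimes> b\<^sub>1 \<otimes> inv a\<^sub>1 \<otimes> a\<^sub>2 \<otimes> inv b\<^sub>2 \<otimes> inv g\<close>. The variant after it requires the radius
  to be adapted to \<open>h\<close> instead of \<open>g\<close>.\<close>

lemma adapted_single:
  assumes gd: "adapted g r" and gh: "g \<in> carrier G" "h \<in> carrier G"
    and B: "a1 \<in> ball e0 r" "a2 \<in> ball e0 r" "b1 \<in> ball e0 r" "b2 \<in> ball e0 r"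
    and \<gamma>: "\<gamma>1 \<in> \<Gamma>" "\<gamma>2 \<in> \<Gamma>"
    and eq: "h \<otimes> \<psi> a1 = \<gamma>1 \<otimes> (g \<otimes> \<psi> b1)" "h \<otimes> \<psi> a2 = \<gamma>2 \<otimes> (g \<otimes> \<psi> b2)"
  shows "\<gamma>1 = \<gamma>2"
proof -
  have C: "\<psi> a1 \<in> carrier G" "\<psi> a2 \<in> carrier G" "\<psi> b1 \<in> carrier G" "\<psi> b2 \<in> carrier G"
    "\<gamma>1 \<in> carrier G" "\<gamma>2 \<in> carrier G"
    using B adaptedD(2)[OF gd] psi_carrier \<gamma> Gamma_carrier by blast+
  have 1: "\<gamma>1 = h \<otimes> \<psi> a1 \<otimes> inv (g \<otimes> \<psi> b1)" and 2: "\<gamma>2 = h \<otimes> \<psi> a2 \<otimes> inv (g \<otimes> \<psi> b2)"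
    unfolding eq using C gh by (simp_all add: m_assoc)
  have "inv \<gamma>1 \<otimes> \<gamma>2 = g \<otimes> (\<psi> b1 \<otimes> inv (\<psi> a1) \<otimes> (\<psi> a2 \<otimes> inv (\<psi> b2))) \<otimes> inv g"
    unfolding 1 2 using C gh by (simp add: m_assoc inv_mult_group inv_cancel_left)
  moreover have "inv \<gamma>1 \<otimes> \<gamma>2 \<in> \<Gamma>"
    using \<gamma> subgroup.m_closed[OF Gamma] subgroup.m_inv_closed[OF Gamma] by blast
  ultimately have "inv \<gamma>1 \<otimes> \<gamma>2 = \<one>" using gd B unfolding adapted_def by metis
  then show ?thesis using C(5,6) by (metis inv_equality inv_inv inv_closed)
qed

lemma adapted_single':
  assumes gd: "adapted h r" and gh: "g \<in> carrier G" "h \<in> carrier G"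
    and B: "a1 \<in> ball e0 r" "a2 \<in> ball e0 r" "b1 \<in> ball e0 r" "b2 \<in> ball e0 r"
    and \<gamma>: "\<gamma>1 \<in> \<Gamma>" "\<gamma>2 \<in> \<Gamma>"
    and eq: "h \<otimes> \<psi> a1 = \<gamma>1 \<otimes> (g \<otimes> \<psi> b1)" "h \<otimes> \<psi> a2 = \<gamma>2 \<otimes> (g \<otimes> \<psi> b2)"
  shows "\<gamma>1 = \<gamma>2"
proof -
  have C: "\<psi> a1 \<in> carrier G" "\<psi> a2 \<in> carrier G" "\<psi> b1 \<in> carrier G" "\<psi> b2 \<in> carrier G"
    "\<gamma>1 \<in> carrier G" "\<gamma>2 \<in> carrier G"
    using B adaptedD(2)[OF gd] psi_carrier \<gamma> Gamma_carrier by blast+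
  have "inv \<gamma>1 = inv \<gamma>2"
  proof (rule adapted_single[OF gd gh(2,1) B(3,4,1,2)])
    show "g \<otimes> \<psi> b1 = inv \<gamma>1 \<otimes> (h \<otimes> \<psi> a1)" "g \<otimes> \<psi> b2 = inv \<gamma>2 \<otimes> (h \<otimes> \<psi> a2)"
      unfolding eq using C gh by (simp_all add: inv_cancel_left)
  qed (use \<gamma> subgroup.m_inv_closed[OF Gamma] in auto)
  then show ?thesis using C by (metis inv_inv)
qed

lemma adapted_inj:
  assumes "adapted g r" "g \<in> carrier G" "a \<in> ball e0 r" "b \<in> ball e0 r" "\<pi> (g \<otimes> \<psi> a) = \<pi> (g \<otimes> \<psi> b)"
  shows "a = b"
proof -
  have D: "a \<in> D" "b \<in> D" using assms adaptedD(2) by blast+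
  then have C: "\<psi> a \<in> carrier G" "\<psi> b \<in> carrier G" using psi_carrier by blast+
  then obtain \<gamma> where \<gamma>: "\<gamma> \<in> \<Gamma>" "g \<otimes> \<psi> a = \<gamma> \<otimes> (g \<otimes> \<psi> b)"
    using assms(2,5) pi_eq_iff[of "g \<otimes> \<psi> a" "g \<otimes> \<psi> b"] by auto
  have "\<gamma> = \<one>"
    by (rule adapted_single[OF assms(1,2,2) assms(3,3,4,3) \<gamma>(1) subgroup.one_closed[OF Gamma] \<gamma>(2)])
      (use C assms(2) in simp)
  then have "\<psi> a = \<psi> b" using \<gamma> C assms(2) by simp
  then show ?thesis using phi_psi D by metis
qed

lemma translated_ball_open:
  assumes "g \<in> carrier G" "ball e0 r \<subseteq> D"
  shows "openin T ((\<lambda>z. g \<otimes> \<psi> z) ` ball e0 r)"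
proof -
  have "(\<lambda>z. g \<otimes> \<psi> z) ` ball e0 r = {x \<in> carrier G. inv g \<otimes> x \<in> {x \<in> U. \<phi> x \<in> ball e0 r}}"
    (is "?L = ?R")
  proof (rule subset_antisym)
    show "?L \<subseteq> ?R"
      using assms psi_U phi_psi psi_carrier by (auto simp: inv_cancel_left subset_iff)
    show "?R \<subseteq> ?L"
    proof
      fix x assume x: "x \<in> ?R"
      then have "x = g \<otimes> \<psi> (\<phi> (inv g \<otimes> x))" using assms(1) psi_phi by (auto simp: inv_cancel_left)
      then show "x \<in> ?L" using x by blast
    qed
  qed
  then show ?thesis using left_open[OF inv_closed[OF assms(1)] chart_preimage_open[OF chart open_ball]] by simp
qed

subsection \<open>Smooth functions on the quotient\<close>

lemma charts_N: "(A, \<kappa>) \<in> charts N \<longleftrightarrow> (\<exists>W \<omega> V. A = (\<lambda>g. \<pi> g) ` V \<and> \<kappa> = \<omega> \<circ> inv_into V (\<lambda>g. \<pi> g) \<and>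
    (W, \<omega>) \<in> charts X \<and> V \<subseteq> W \<and> openin T V \<and> inj_on (\<lambda>g. \<pi> g) V)"
  by (auto simp: quotient_mfd_def Let_def)

text \<open>The inverse of a chart of the quotient is the inverse of the underlying chart of the group,
  followed by the projection.\<close>

lemma chart_N_image:
  assumes "(W, \<omega>) \<in> charts X" "V \<subseteq> W" "openin T V" "inj_on (\<lambda>g. \<pi> g) V"
  shows "(\<omega> \<circ> inv_into V (\<lambda>g. \<pi> g)) ` (\<lambda>g. \<pi> g) ` V = \<omega> ` V"
    and "open (\<omega> ` V)"
    and "y \<in> \<omega> ` V \<Longrightarrow> inv_into ((\<lambda>g. \<pi> g) ` V) (\<omega> \<circ> inv_into V (\<lambda>g. \<pi> g)) y = \<pi> (inv_into W \<omega> y)"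
proof -
  show 1: "(\<omega> \<circ> inv_into V (\<lambda>g. \<pi> g)) ` (\<lambda>g. \<pi> g) ` V = \<omega> ` V"
    using assms(4) by (force simp: image_image)
  show "open (\<omega> ` V)" using chart_image_open[OF assms(1,3)] assms(2) by (simp add: Int_absorb1)
  assume "y \<in> \<omega> ` V"
  then obtain v where v: "v \<in> V" "y = \<omega> v" by blast
  have io: "inj_on \<omega> V" using chart_inj[OF assms(1)] assms(2) by (rule inj_on_subset)
  have inj: "inj_on (\<omega> \<circ> inv_into V (\<lambda>g. \<pi> g)) ((\<lambda>g. \<pi> g) ` V)"
    by (rule comp_inj_on[OF inj_on_inv_into[OF subset_refl]]) (use assms(4) io in \<open>simp add: inv_into_image_cancel\<close>)
  have "inv_into W \<omega> y = v" using v assms(2) chart_inv(3)[OF assms(1)] by auto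
  then show "inv_into ((\<lambda>g. \<pi> g) ` V) (\<omega> \<circ> inv_into V (\<lambda>g. \<pi> g)) y = \<pi> (inv_into W \<omega> y)"
    using v assms(4) by (intro inv_into_f_eq[OF inj]) auto
qed

lemma open_charts_N: "open_charts N"
  unfolding open_charts_def charts_N case_prod_beta
proof clarify
  fix A \<kappa> assume "(A, \<kappa>) \<in> charts N"
  then show "open (snd (A, \<kappa>) ` fst (A, \<kappa>))"
    unfolding charts_N using chart_N_image(1,2) by (auto simp del: image_image)
qed

text \<open>On an open set where the projection is injective, \<open>f\<close> looks in a chart of the quotient exactly as
  \<open>f \<circ> \<pi>\<close> does in the underlying chart of the group.\<close>

lemma smooth_fun_N: "smooth_fun N f \<longleftrightarrow> smooth_fun X (\<lambda>x. f (\<pi> x))"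
proof
  assume f: "smooth_fun X (\<lambda>x. f (\<pi> x))"
  show "smooth_fun N f"
    unfolding smooth_fun_def
  proof clarify
    fix A \<kappa> assume "(A, \<kappa>) \<in> charts N"
    then obtain W \<omega> V where W: "A = (\<lambda>g. \<pi> g) ` V" "\<kappa> = \<omega> \<circ> inv_into V (\<lambda>g. \<pi> g)"
      "(W, \<omega>) \<in> charts X" "V \<subseteq> W" "openin T V" "inj_on (\<lambda>g. \<pi> g) V"
      unfolding charts_N by blast
    note c = chart_N_image[OF W(3-6)]
    have "smooth_on (\<omega> ` V) (\<lambda>y. f (\<pi> (inv_into W \<omega> y)))"
      by (rule smooth_on_subset[OF c(2) _ smooth_fun_chart[OF W(3) f]]) (use W(4) in auto)
    then show "smooth_on (\<kappa> ` A) (f \<circ> inv_into A \<kappa>)"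
      unfolding W(1,2) c(1) by (subst smooth_on_cong[OF c(2)]) (auto simp only: o_apply c(3))
  qed
next
  assume f: "smooth_fun N f"
  show "smooth_fun X (\<lambda>x. f (\<pi> x))"
    unfolding smooth_fun_def o_def
  proof (clarify, rule smooth_on_local)
    fix W \<omega> y assume W: "(W, \<omega>) \<in> charts X" and y: "y \<in> \<omega> ` W"
    define g where "g = inv_into W \<omega> y"
    have g: "g \<in> W" "\<omega> g = y" "g \<in> carrier G"
      unfolding g_def using y chart_inv[OF W] chart_inv_carrier[OF W] by auto
    obtain r where r: "adapted g r" using ex_adapted g by blast
    define V where "V = W \<inter> (\<lambda>z. g \<otimes> \<psi> z) ` ball e0 r"
    have V: "V \<subseteq> W" "openin T V"
      using translated_ball_open[OF g(3) adaptedD(2)[OF r]] chart_open(1)[OF W] by (auto simp: V_def)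
    have V3: "inj_on (\<lambda>g. \<pi> g) V"
      unfolding V_def by (rule inj_onI) (use adapted_inj[OF r g(3)] in blast)
    note V = V V3
    have gV: "g \<in> V" using g adaptedD[OF r] psi_e0 by (auto simp: V_def intro!: image_eqI[of _ _ e0])
    note c = chart_N_image[OF W V]
    have "((\<lambda>g. \<pi> g) ` V, \<omega> \<circ> inv_into V (\<lambda>g. \<pi> g)) \<in> charts N"
      unfolding charts_N using W V by blast
    then have "smooth_on (\<omega> ` V) (f \<circ> inv_into ((\<lambda>g. \<pi> g) ` V) (\<omega> \<circ> inv_into V (\<lambda>g. \<pi> g)))"
      using f unfolding smooth_fun_def using c(1) by fastforce
    then have "smooth_on (\<omega> ` V) (\<lambda>y. f (\<pi> (inv_into W \<omega> y)))"
      by (subst smooth_on_cong[OF c(2)]) (auto simp only: o_apply c(3))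
    then show "\<exists>S. open S \<and> y \<in> S \<and> smooth_on S (\<lambda>y. f (\<pi> (inv_into W \<omega> y)))"
      using c(2) gV g(2) by blast
  qed
qed

lemma smooth_fun_X_cong:
  "(\<And>x. x \<in> carrier G \<Longrightarrow> f x = f' x) \<Longrightarrow> smooth_fun X f \<longleftrightarrow> smooth_fun X f'"
  by (rule smooth_fun_cong[OF open_charts_X]) (use chart_sub in blast)

lemma smooth_fun_N_cong:
  "(\<And>p. p \<in> points N \<Longrightarrow> f p = f' p) \<Longrightarrow> smooth_fun N f \<longleftrightarrow> smooth_fun N f'"
  unfolding smooth_fun_N by (rule smooth_fun_X_cong) (use pi_points in blast)

text \<open>A function \<open>F\<close> supported near the identity is moved to \<open>g\<close> by a left translation, projected to the
  quotient and extended by zero. For an adapted radius, the \<open>z\<close> in question is unique.\<close>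

definition descend :: "'a \<Rightarrow> real \<Rightarrow> ('a \<Rightarrow> real) \<Rightarrow> 'a set \<Rightarrow> real" where
  "descend g r F c = (if \<exists>z\<in>ball e0 r. c = \<pi> (g \<otimes> \<psi> z)
     then F (\<psi> (THE z. z \<in> ball e0 r \<and> c = \<pi> (g \<otimes> \<psi> z))) else 0)"

lemma descend_at:
  assumes "adapted g r" "g \<in> carrier G" "z \<in> ball e0 r"
  shows "descend g r F (\<pi> (g \<otimes> \<psi> z)) = F (\<psi> z)"
proof -
  have "(THE z'. z' \<in> ball e0 r \<and> \<pi> (g \<otimes> \<psi> z) = \<pi> (g \<otimes> \<psi> z')) = z"
    by (rule the_equality) (use assms adapted_inj[OF assms(1,2)] in auto)
  then show ?thesis using assms(3) unfolding descend_def by (metis (no_types, lifting))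
qed

lemma descend_0: "\<nexists>z. z \<in> ball e0 r \<and> c = \<pi> (g \<otimes> \<psi> z) \<Longrightarrow> descend g r F c = 0"
  by (auto simp: descend_def)

lemma descend_nonzero: "descend g r F c \<noteq> 0 \<Longrightarrow> \<exists>z\<in>ball e0 r. c = \<pi> (g \<otimes> \<psi> z)"
  by (auto simp: descend_def split: if_splits)

text \<open>The hypothesis \<open>u\<close> says that \<open>\<gamma>\<close> is the only element of \<open>\<Gamma>\<close> through which the point can be equivalent to a point near
  \<open>g\<close>. Then \<open>F\<close> composed with one left translation gives the right value there, also when this is zero.\<close>

lemma descend_translate:
  assumes gd: "adapted g r" and g: "g \<in> carrier G" and h: "h \<in> carrier G" and F: "supp_in r F"
    and \<gamma>: "\<gamma> \<in> \<Gamma>" and y: "h \<otimes> \<psi> y \<in> carrier G"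
    and u: "\<And>\<gamma>' z. \<gamma>' \<in> \<Gamma> \<Longrightarrow> z \<in> ball e0 r \<Longrightarrow> h \<otimes> \<psi> y = \<gamma>' \<otimes> (g \<otimes> \<psi> z) \<Longrightarrow> \<gamma>' = \<gamma>"
  shows "descend g r F (\<pi> (h \<otimes> \<psi> y)) = F (inv (\<gamma> \<otimes> g) \<otimes> (h \<otimes> \<psi> y))"
proof (cases "\<exists>z\<in>ball e0 r. \<pi> (h \<otimes> \<psi> y) = \<pi> (g \<otimes> \<psi> z)")
  case True
  then obtain z where z: "z \<in> ball e0 r" "\<pi> (h \<otimes> \<psi> y) = \<pi> (g \<otimes> \<psi> z)" by blast
  have C: "\<psi> z \<in> carrier G" "\<gamma> \<in> carrier G" using z(1) adaptedD(2)[OF gd] psi_carrier \<gamma> Gamma_carrier by blast+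
  then obtain \<gamma>' where \<gamma>': "\<gamma>' \<in> \<Gamma>" "h \<otimes> \<psi> y = \<gamma>' \<otimes> (g \<otimes> \<psi> z)"
    using z(2) pi_eq_iff[OF y, of "g \<otimes> \<psi> z"] g by auto
  have "\<gamma>' = \<gamma>" using u[OF \<gamma>'(1) z(1) \<gamma>'(2)] .
  then have "inv (\<gamma> \<otimes> g) \<otimes> (h \<otimes> \<psi> y) = \<psi> z"
    unfolding \<gamma>'(2) using C g by (simp add: inv_mult_group m_assoc inv_cancel_left)
  then show ?thesis using descend_at[OF gd g z(1)] z(2) by simp
next
  case False
  have C: "\<gamma> \<in> carrier G" using \<gamma> Gamma_carrier by blast
  have "F (inv (\<gamma> \<otimes> g) \<otimes> (h \<otimes> \<psi> y)) = 0"
  proof (rule ccontr)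
    assume "F (inv (\<gamma> \<otimes> g) \<otimes> (h \<otimes> \<psi> y)) \<noteq> 0"
    moreover have "inv (\<gamma> \<otimes> g) \<otimes> (h \<otimes> \<psi> y) \<in> carrier G" using C g y by auto
    ultimately obtain z where z: "z \<in> ball e0 r" "inv (\<gamma> \<otimes> g) \<otimes> (h \<otimes> \<psi> y) = \<psi> z"
      using F unfolding supp_in_def by blast
    have "h \<otimes> \<psi> y = (\<gamma> \<otimes> g) \<otimes> (inv (\<gamma> \<otimes> g) \<otimes> (h \<otimes> \<psi> y))" using C g y by (simp add: inv_cancel_left)
    then have "h \<otimes> \<psi> y = \<gamma> \<otimes> (g \<otimes> \<psi> z)"
      using z C g adaptedD(2)[OF gd] psi_carrier by (simp add: m_assoc subset_iff)
    moreover have "g \<otimes> \<psi> z \<in> carrier G" using z g adaptedD(2)[OF gd] psi_carrier by blast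
    ultimately have "\<pi> (h \<otimes> \<psi> y) = \<pi> (g \<otimes> \<psi> z)" using pi_eq_iff[OF y] \<gamma> by blast
    then show False using False z(1) by blast
  qed
  then show ?thesis using False by (auto simp: descend_def)
qed

text \<open>On a ball around \<open>h\<close> at most one element of \<open>\<Gamma>\<close> is involved, so the function is either zero on this ball
  or \<open>F\<close> composed with a left translation.\<close>

lemma smooth_descend:
  assumes gd: "adapted g r" and g: "g \<in> carrier G" and F: "smooth_fun X F" "supp_in r F"
  shows "smooth_fun N (descend g r F)"
  unfolding smooth_fun_N
proof (rule smooth_funI_local)
  fix h assume h: "h \<in> carrier G"
  note B = adaptedD[OF gd]
  have C: "\<psi> y \<in> carrier G" "h \<otimes> \<psi> y \<in> carrier G" if "y \<in> ball e0 r" for y using that B psi_carrier h by blast+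
  have oB: "open (ball e0 r \<inter> D)" using open_D by auto
  have "smooth_on (ball e0 r \<inter> D) (\<lambda>y. descend g r F (\<pi> (h \<otimes> \<psi> y)))"
  proof (cases "\<exists>\<gamma>\<in>\<Gamma>. \<exists>a\<in>ball e0 r. \<exists>b\<in>ball e0 r. h \<otimes> \<psi> a = \<gamma> \<otimes> (g \<otimes> \<psi> b)")
    case True
    then obtain \<gamma> a b where \<gamma>: "\<gamma> \<in> \<Gamma>" "a \<in> ball e0 r" "b \<in> ball e0 r" "h \<otimes> \<psi> a = \<gamma> \<otimes> (g \<otimes> \<psi> b)" by blast
    have \<gamma>C: "\<gamma> \<in> carrier G" using \<gamma> Gamma_carrier by blast
    have eq: "descend g r F (\<pi> (h \<otimes> \<psi> y)) = F (inv (\<gamma> \<otimes> g) \<otimes> h \<otimes> \<psi> y)" if y: "y \<in> ball e0 r" for y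
    proof -
      have "descend g r F (\<pi> (h \<otimes> \<psi> y)) = F (inv (\<gamma> \<otimes> g) \<otimes> (h \<otimes> \<psi> y))"
      proof (rule descend_translate[OF gd g h F(2) \<gamma>(1) C(2)[OF y]])
        show "\<gamma>' = \<gamma>" if "\<gamma>' \<in> \<Gamma>" "z \<in> ball e0 r" "h \<otimes> \<psi> y = \<gamma>' \<otimes> (g \<otimes> \<psi> z)" for \<gamma>' z
          by (rule adapted_single[OF gd g h y \<gamma>(2) that(2) \<gamma>(3) that(1) \<gamma>(1) that(3) \<gamma>(4)])
      qed
      then show ?thesis using \<gamma>C g h C(1)[OF y] by (simp add: m_assoc)
    qed
    have "smooth_on (ball e0 r \<inter> D) (\<lambda>y. F (inv (\<gamma> \<otimes> g) \<otimes> h \<otimes> \<psi> y))"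
      by (rule smooth_on_subset[OF oB _ smooth_on_D_left[OF F(1)]]) (use \<gamma>C g h in auto)
    then show ?thesis by (subst smooth_on_cong[OF oB]) (auto simp: eq)
  next
    case False
    have "descend g r F (\<pi> (h \<otimes> \<psi> y)) = 0" if y: "y \<in> ball e0 r" for y
    proof (rule descend_0, safe)
      fix z assume z: "z \<in> ball e0 r" "\<pi> (h \<otimes> \<psi> y) = \<pi> (g \<otimes> \<psi> z)"
      have "g \<otimes> \<psi> z \<in> carrier G" using z(1) B psi_carrier g by blast
      then show False using z False y pi_eq_iff[OF C(2)[OF y], of "g \<otimes> \<psi> z"] by blast
    qed
    then show ?thesis by (subst smooth_on_cong[OF oB, of _ "\<lambda>y. 0"]) (auto simp: smooth_on_const)
  qed
  then show "\<exists>s>0. smooth_on (ball e0 s \<inter> D) (\<lambda>y. descend g r F (\<pi> (h \<otimes> \<psi> y)))" using B(1) by blast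
qed

lemma tangent_local_N:
  assumes g: "g \<in> carrier G" and w: "w \<in> tangent_space N (\<pi> g)" and f: "smooth_fun N f" "smooth_fun N f'"
    and r: "r > 0" and eq: "\<And>z. z \<in> ball e0 r \<Longrightarrow> z \<in> D \<Longrightarrow> f (\<pi> (g \<otimes> \<psi> z)) = f' (\<pi> (g \<otimes> \<psi> z))"
  shows "w f = w f'"
proof -
  obtain s where s: "adapted g s" using ex_adapted g by blast
  define t where "t = min r s"
  have t: "adapted g t" "ball e0 t \<subseteq> ball e0 r"
    using adapted_mono[OF s, of t] r adaptedD(1)[OF s] by (auto simp: t_def)
  note B = adaptedD[OF t(1)]
  let ?b = "descend g t (bump_ext t (\<lambda>x. 1))"
  show ?thesis
  proof (rule tangent_local[OF w open_charts_N f])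
    show "smooth_fun N ?b"
      by (rule smooth_descend[OF t(1) g smooth_bump_ext[OF B smooth_on_const] supp_bump_ext[OF B(2)]])
    have "?b (\<pi> (g \<otimes> \<psi> e0)) = 1"
      using descend_at[OF t(1) g, of e0] bump_ext_plateau[OF B, of e0 "\<lambda>x. 1"] B(1) by simp
    then show "?b (\<pi> g) = 1" using g by (simp add: psi_e0)
    fix c assume "?b c \<noteq> 0"
    then obtain z where "z \<in> ball e0 t" "c = \<pi> (g \<otimes> \<psi> z)" using descend_nonzero by blast
    then show "f c = f' c" using eq[of z] t(2) B(2) by blast
  qed
qed

lemma tangent_cong_X:
  assumes u: "u \<in> \<gg>" and f: "smooth_fun X f" and eq: "\<And>x. x \<in> carrier G \<Longrightarrow> f x = f' x"
  shows "u f = u f'"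
  by (rule tangent_local_X[OF u f _ zero_less_one])
    (use f eq psi_carrier smooth_fun_X_cong[OF eq] in auto)

lemma tangent_cong_N:
  assumes p: "p \<in> points N" and w: "w \<in> tangent_space N p" and f: "smooth_fun N f"
    and eq: "\<And>x. x \<in> points N \<Longrightarrow> f x = f' x"
  shows "w f = w f'"
proof -
  obtain g where g: "g \<in> carrier G" "p = \<pi> g" using points_N_E[OF p] by blast
  show ?thesis
    by (rule tangent_local_N[OF g(1) w[unfolded g(2)] f _ zero_less_one])
      (use f eq psi_carrier g pi_points smooth_fun_N_cong[OF eq] in auto)
qed

subsection \<open>The frame of left-invariant vector fields\<close>

abbreviation "fr \<equiv> frame G X \<Gamma>"
abbreviation "cofr \<equiv> coframe G X \<Gamma>"
abbreviation "br \<equiv> lie_bracket G X"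

lemma smooth_pullback: "g \<in> carrier G \<Longrightarrow> smooth_fun N f \<Longrightarrow> smooth_fun X (\<lambda>x. f (\<pi> (g \<otimes> x)))"
  using smooth_fun_left[of "\<lambda>x. f (\<pi> x)" g] smooth_fun_N by blast

lemma frame_apply:
  assumes "g \<in> carrier G" "u \<in> \<gg>" "smooth_fun N f"
  shows "fr (\<pi> g) u f = u (\<lambda>x. f (\<pi> (g \<otimes> x)))"
  using tangent_cong_X[OF assms(2) smooth_pullback[OF assms(1,3)], of "\<lambda>x. f (\<pi> g #> x)"] assms
  by (auto simp: frame_def pushforward_def o_def pi_mult)

lemma frame_nonsmooth: "\<not> smooth_fun N f \<Longrightarrow> fr p u f = 0"
  by (simp add: frame_def pushforward_def)

lemma frame_in:
  assumes g: "g \<in> carrier G" and u: "u \<in> \<gg>" shows "fr (\<pi> g) u \<in> tangent_space N (\<pi> g)"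
  unfolding tangent_space_def
proof safe
  fix f h assume fh: "smooth_fun N f" "smooth_fun N h"
  note s = smooth_pullback[OF g fh(1)] smooth_pullback[OF g fh(2)]
  show "fr (\<pi> g) u (\<lambda>x. f x + h x) = fr (\<pi> g) u f + fr (\<pi> g) u h"
    using tangent_add[OF u s] smooth_fun_add[OF open_charts_N fh] by (simp add: frame_apply[OF g u] fh)
  show "fr (\<pi> g) u (\<lambda>x. f x * h x) = f (\<pi> g) * fr (\<pi> g) u h + h (\<pi> g) * fr (\<pi> g) u f"
    using tangent_mult[OF u s] smooth_fun_mult[OF open_charts_N fh] by (simp add: frame_apply[OF g u] fh g)
next
  fix c f assume f: "smooth_fun N f"
  show "fr (\<pi> g) u (\<lambda>x. c * f x) = c * fr (\<pi> g) u f"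
    using tangent_cmult[OF u smooth_pullback[OF g f]] smooth_fun_cmult[OF open_charts_N f]
    by (simp add: frame_apply[OF g u] f)
qed (simp add: frame_nonsmooth)

lemma frame_add: "fr p (u + v) = fr p u + fr p v"
  by (auto simp: frame_def pushforward_def fun_eq_iff)

lemma frame_scaleR: "fr p (c *\<^sub>R u) = c *\<^sub>R fr p u"
  by (auto simp: frame_def pushforward_def fun_eq_iff scaleR_fun_def)

text \<open>A function that descends from the group agrees, near the identity, with the given one after
  pulling it back; so \<open>u\<close> can be recovered from its image.\<close>

lemma frame_inj:
  assumes g: "g \<in> carrier G" and u: "u \<in> \<gg>" and v: "v \<in> \<gg>" and eq: "fr (\<pi> g) u = fr (\<pi> g) v"
  shows "u = v"
proof
  obtain r where r: "adapted g r" using ex_adapted g by blast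
  note B = adaptedD[OF r]
  fix f
  show "u f = v f"
  proof (cases "smooth_fun X f")
    case False
    then show ?thesis using tangent_nonsmooth[OF u] tangent_nonsmooth[OF v] by simp
  next
    case f: True
    let ?F = "\<lambda>x. bump_ext r (\<lambda>x. 1) x * f x"
    have F: "smooth_fun X ?F" by (rule smooth_fun_mult[OF open_charts_X smooth_bump_ext[OF B smooth_on_const] f])
    have P: "smooth_fun N (descend g r ?F)"
      by (rule smooth_descend[OF r g F supp_mult[OF supp_bump_ext[OF B(2)]]])
    have *: "w f = fr (\<pi> g) w (descend g r ?F)" if w: "w \<in> \<gg>" for w
      unfolding frame_apply[OF g w P]
    proof (rule tangent_local_X[OF w f smooth_pullback[OF g P], of "r/3"])
      fix z assume z: "z \<in> ball e0 (r/3)"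
      then have "z \<in> ball e0 r" using B(1) by auto
      then show "f (\<psi> z) = descend g r ?F (\<pi> (g \<otimes> \<psi> z))"
        using descend_at[OF r g, of z] bump_ext_plateau[OF B z, of "\<lambda>x. 1"] by simp
    qed (use B in simp)
    show ?thesis using *[OF u] *[OF v] eq by simp
  qed
qed

text \<open>The preimage of \<open>w\<close> sends \<open>f\<close> to the value of \<open>w\<close> at the function that descends from the cut-off of \<open>f\<close>. The
  cut-off is \<open>1\<close> near the identity and \<open>w\<close> only sees germs, which gives the Leibniz rule.\<close>

lemma frame_surj:
  assumes g: "g \<in> carrier G" and w: "w \<in> tangent_space N (\<pi> g)"
  shows "\<exists>u\<in>\<gg>. fr (\<pi> g) u = w"
proof -
  obtain r where r: "adapted g r" using ex_adapted g by blast
  note B = adaptedD[OF r]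
  have e: "e0 \<in> ball e0 r" "e0 \<in> ball e0 (r/3)" using B(1) by auto
  define P where "P f = descend g r (\<lambda>x. bump_ext r (\<lambda>x. 1) x * f x)" for f
  have P: "smooth_fun N (P f)" if f: "smooth_fun X f" for f
    unfolding P_def
    by (rule smooth_descend[OF r g smooth_fun_mult[OF open_charts_X smooth_bump_ext[OF B smooth_on_const] f] supp_mult[OF supp_bump_ext[OF B(2)]]])
  have P_at: "P f (\<pi> (g \<otimes> \<psi> z)) = f (\<psi> z)" if z: "z \<in> ball e0 (r/3)" for f z
  proof -
    have "z \<in> ball e0 r" using z B(1) by auto
    then show ?thesis unfolding P_def using descend_at[OF r g, of z] bump_ext_plateau[OF B z, of "\<lambda>x. 1"] by simp
  qed
  have P_1: "P f (\<pi> g) = f \<one>" for f using P_at[OF e(2)] g by (simp add: psi_e0)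
  define u where "u = (\<lambda>f. if smooth_fun X f then w (P f) else 0)"
  have "u \<in> \<gg>"
    unfolding tangent_space_def
  proof safe
    fix f h assume f: "smooth_fun X f" and h: "smooth_fun X h"
    have "P (\<lambda>x. f x + h x) = (\<lambda>c. P f c + P h c)" by (auto simp: P_def descend_def fun_eq_iff distrib_left)
    then show "u (\<lambda>x. f x + h x) = u f + u h"
      using f h smooth_fun_add[OF open_charts_X f h] tangent_add[OF w P[OF f] P[OF h]] by (simp add: u_def)
    have fh: "smooth_fun X (\<lambda>x. f x * h x)" by (rule smooth_fun_mult[OF open_charts_X f h])
    have "w (P (\<lambda>x. f x * h x)) = w (\<lambda>c. P f c * P h c)"
      by (rule tangent_local_N[OF g w P[OF fh] smooth_fun_mult[OF open_charts_N P[OF f] P[OF h]], of "r/3"])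
        (use B P_at in auto)
    then show "u (\<lambda>x. f x * h x) = f \<one> * u h + h \<one> * u f"
      using tangent_mult[OF w P[OF f] P[OF h]] fh f h by (simp add: u_def P_1)
  next
    fix c f assume f: "smooth_fun X f"
    have "P (\<lambda>x. c * f x) = (\<lambda>x. c * P f x)" by (auto simp: P_def descend_def fun_eq_iff)
    then show "u (\<lambda>x. c * f x) = c * u f"
      using f smooth_fun_cmult[OF open_charts_X f] tangent_cmult[OF w P[OF f]] by (simp add: u_def)
  qed (simp add: u_def)
  moreover have "fr (\<pi> g) u = w"
  proof
    fix f
    show "fr (\<pi> g) u f = w f"
    proof (cases "smooth_fun N f")
      case False
      then show ?thesis using tangent_nonsmooth[OF w] by (simp add: frame_nonsmooth)
    next
      case f: True
      note s = smooth_pullback[OF g f]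
      have "w (P (\<lambda>x. f (\<pi> (g \<otimes> x)))) = w f"
        by (rule tangent_local_N[OF g w P[OF s] f, of "r/3"]) (use B P_at in auto)
      then show ?thesis unfolding frame_apply[OF g \<open>u \<in> \<gg>\<close> f] using s by (simp add: u_def)
    qed
  qed
  ultimately show ?thesis by blast
qed

lemma frame_bij: "p \<in> points N \<Longrightarrow> bij_betw (fr p) \<gg> (tangent_space N p)"
  using frame_inj frame_surj frame_in
  by (elim points_N_E) (auto simp: bij_betw_def inj_on_def image_iff, metis)

lemma frame_tangent: "p \<in> points N \<Longrightarrow> u \<in> \<gg> \<Longrightarrow> fr p u \<in> tangent_space N p"
  using frame_bij bij_betwE by blast

lemma coframe_frame: "p \<in> points N \<Longrightarrow> u \<in> \<gg> \<Longrightarrow> cofr p (fr p u) = u"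
  unfolding coframe_def using frame_bij by (metis bij_betw_inv_into_left)

lemma frame_coframe: "p \<in> points N \<Longrightarrow> w \<in> tangent_space N p \<Longrightarrow> fr p (cofr p w) = w"
  unfolding coframe_def using frame_bij by (metis bij_betw_inv_into_right)

lemma coframe_in: "p \<in> points N \<Longrightarrow> w \<in> tangent_space N p \<Longrightarrow> cofr p w \<in> \<gg>"
  unfolding coframe_def using frame_bij by (metis bij_betw_def inv_into_into)

lemma coframe_add:
  assumes "p \<in> points N" "v \<in> tangent_space N p" "w \<in> tangent_space N p"
  shows "cofr p (v + w) = cofr p v + cofr p w"
proof -
  have "cofr p v + cofr p w \<in> \<gg>" by (intro tangent_space_add coframe_in assms)
  from coframe_frame[OF assms(1) this] show ?thesis
    by (simp only: frame_add frame_coframe[OF assms(1,2)] frame_coframe[OF assms(1,3)])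
qed

lemma coframe_scaleR:
  assumes "p \<in> points N" "w \<in> tangent_space N p"
  shows "cofr p (c *\<^sub>R w) = c *\<^sub>R cofr p w"
proof -
  have "c *\<^sub>R cofr p w \<in> \<gg>" by (intro tangent_space_scaleR coframe_in assms)
  from coframe_frame[OF assms(1) this] show ?thesis
    by (simp only: frame_scaleR frame_coframe[OF assms(1,2)])
qed

lemma frame_lder:
  assumes "g \<in> carrier G" "u \<in> \<gg>" "smooth_fun N f"
  shows "fr (\<pi> g) u f = lder u (\<lambda>x. f (\<pi> x)) g"
  by (simp add: frame_apply[OF assms] lder_def)

lemma smooth_frame_fun:
  assumes u: "u \<in> \<gg>" and f: "smooth_fun N f"
  shows "smooth_fun N (\<lambda>p. fr p u f)"
  unfolding smooth_fun_N
  using smooth_lder[OF u f[unfolded smooth_fun_N]]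
  by (subst smooth_fun_X_cong[OF frame_lder[OF _ u f]])

lemma smooth_vf_frame: "u \<in> \<gg> \<Longrightarrow> smooth_vf N (\<lambda>p. fr p u)"
  by (simp add: smooth_vf_def frame_tangent smooth_frame_fun)

lemma lder_cong:
  assumes "u \<in> \<gg>" "smooth_fun X f" "\<And>x. x \<in> carrier G \<Longrightarrow> f x = f' x" "g \<in> carrier G"
  shows "lder u f g = lder u f' g"
  unfolding lder_def by (rule tangent_cong_X[OF assms(1) smooth_fun_left]) (use assms in auto)

lemma lie_bracket_apply:
  assumes u: "u \<in> \<gg>" and v: "v \<in> \<gg>" and f: "smooth_fun X f"
  shows "br u v f = u (lder v f) - v (lder u f)"
proof -
  have L: "left_inv_vf G X w q f = lder w f q" for w q
    using f by (simp add: left_inv_vf_def pushforward_def lder_def o_def)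
  have "left_inv_vf G X a \<one> (lder b f) = a (lder b f)" if "a \<in> \<gg>" "b \<in> \<gg>" for a b
    using smooth_lder[OF that(2) f] tangent_cong_X[OF that(1) smooth_fun_left[OF smooth_lder[OF that(2) f] one_closed], of "lder b f"]
    by (simp add: left_inv_vf_def pushforward_def o_def)
  then show ?thesis using u v by (simp add: lie_bracket_def vf_bracket_def L)
qed

lemma lie_bracket_nonsmooth:
  assumes u: "u \<in> \<gg>" and v: "v \<in> \<gg>" and f: "\<not> smooth_fun X f"
  shows "br u v f = 0"
  using f tangent_const[OF u] tangent_const[OF v]
  by (simp add: lie_bracket_def vf_bracket_def left_inv_vf_def pushforward_def o_def)

lemma lder_tangent:
  assumes v: "v \<in> \<gg>" and f: "smooth_fun X f" and h: "smooth_fun X h" and q: "q \<in> carrier G"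
  shows "lder v (\<lambda>x. f x + h x) q = lder v f q + lder v h q"
    "lder v (\<lambda>x. f x * h x) q = f q * lder v h q + h q * lder v f q"
    "lder v (\<lambda>x. c * f x) q = c * lder v f q"
  using tangent_add[OF v smooth_fun_left[OF f q] smooth_fun_left[OF h q]]
    tangent_mult[OF v smooth_fun_left[OF f q] smooth_fun_left[OF h q]]
    tangent_cmult[OF v smooth_fun_left[OF f q]] q
  by (auto simp: lder_def)

lemma lder_one: "v \<in> \<gg> \<Longrightarrow> smooth_fun X f \<Longrightarrow> lder v f \<one> = v f"
  unfolding lder_def
  by (rule tangent_cong_X[OF _ smooth_fun_left]) auto

lemma lie_bracket_in:
  assumes u: "u \<in> \<gg>" and v: "v \<in> \<gg>" shows "br u v \<in> \<gg>"
  unfolding tangent_space_def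
proof safe
  fix f h assume f: "smooth_fun X f" and h: "smooth_fun X h"
  note o = open_charts_X
  have add: "a (lder b (\<lambda>x. f x + h x)) = a (lder b f) + a (lder b h)" if ab: "a \<in> \<gg>" "b \<in> \<gg>" for a b
    unfolding tangent_add[OF ab(1) smooth_lder[OF ab(2) f] smooth_lder[OF ab(2) h], symmetric]
    by (rule tangent_cong_X[OF ab(1) smooth_lder[OF ab(2) smooth_fun_add[OF o f h]]])
      (rule lder_tangent[OF ab(2) f h])
  show "br u v (\<lambda>x. f x + h x) = br u v f + br u v h"
    by (simp add: lie_bracket_apply[OF u v] f h smooth_fun_add[OF o f h] add[OF u v] add[OF v u])
  have mult: "a (lder b (\<lambda>x. f x * h x)) =
      f \<one> * a (lder b h) + b h * a f + h \<one> * a (lder b f) + b f * a h" if ab: "a \<in> \<gg>" "b \<in> \<gg>" for a b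
  proof -
    note s = smooth_lder[OF ab(2) f] smooth_lder[OF ab(2) h]
    have "a (lder b (\<lambda>x. f x * h x)) = a (\<lambda>x. f x * lder b h x + h x * lder b f x)"
      by (rule tangent_cong_X[OF ab(1) smooth_lder[OF ab(2) smooth_fun_mult[OF o f h]]])
        (rule lder_tangent[OF ab(2) f h])
    then show ?thesis
      using lder_one[OF ab(2) f] lder_one[OF ab(2) h]
      by (simp add: tangent_add[OF ab(1)] tangent_mult[OF ab(1)] smooth_fun_mult[OF o] s f h)
  qed
  show "br u v (\<lambda>x. f x * h x) = f \<one> * br u v h + h \<one> * br u v f"
    by (simp add: lie_bracket_apply[OF u v] f h smooth_fun_mult[OF o f h] mult[OF u v] mult[OF v u] algebra_simps)
next
  fix c f assume f: "smooth_fun X f"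
  have cm: "a (lder b (\<lambda>x. c * f x)) = c * a (lder b f)" if ab: "a \<in> \<gg>" "b \<in> \<gg>" for a b
    unfolding tangent_cmult[OF ab(1) smooth_lder[OF ab(2) f], symmetric]
    by (rule tangent_cong_X[OF ab(1) smooth_lder[OF ab(2) smooth_fun_cmult[OF open_charts_X f]]])
      (rule lder_tangent(3)[OF ab(2) f f])
  show "br u v (\<lambda>x. c * f x) = c * br u v f"
    by (simp add: lie_bracket_apply[OF u v] f smooth_fun_cmult[OF open_charts_X f] cm[OF u v] cm[OF v u] algebra_simps)
qed (rule lie_bracket_nonsmooth[OF u v])

lemma frame_frame:
  assumes u: "u \<in> \<gg>" and v: "v \<in> \<gg>" and g: "g \<in> carrier G" and f: "smooth_fun N f"
  shows "fr (\<pi> g) u (\<lambda>q. fr q v f) = u (lder v (\<lambda>x. f (\<pi> (g \<otimes> x))))"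
proof -
  have "fr (\<pi> g) u (\<lambda>q. fr q v f) = u (\<lambda>x. fr (\<pi> (g \<otimes> x)) v f)"
    by (rule frame_apply[OF g u smooth_frame_fun[OF v f]])
  also have "\<dots> = u (lder v (\<lambda>x. f (\<pi> (g \<otimes> x))))"
  proof (rule tangent_cong_X[OF u smooth_pullback[OF g smooth_frame_fun[OF v f]]])
    fix x assume x: "x \<in> carrier G"
    have gx: "g \<otimes> x \<in> carrier G" using g x by auto
    show "fr (\<pi> (g \<otimes> x)) v f = lder v (\<lambda>x. f (\<pi> (g \<otimes> x))) x"
      unfolding frame_apply[OF gx v f] lder_def
      by (rule tangent_cong_X[OF v smooth_pullback[OF gx f]]) (use g x in \<open>auto simp: m_assoc\<close>)
  qed
  finally show ?thesis .
qed

text \<open>Pulled back along \<open>x \<mapsto> \<pi> (g \<otimes> x)\<close>, both sides become the same combination of second derivatives at the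
  identity.\<close>

lemma frame_bracket:
  assumes u: "u \<in> \<gg>" and v: "v \<in> \<gg>" and p: "p \<in> points N"
  shows "vf_bracket (\<lambda>p. fr p u) (\<lambda>p. fr p v) p = fr p (br u v)"
proof
  obtain g where g: "g \<in> carrier G" "p = \<pi> g" using points_N_E[OF p] by blast
  fix f
  show "vf_bracket (\<lambda>p. fr p u) (\<lambda>p. fr p v) p f = fr p (br u v) f"
  proof (cases "smooth_fun N f")
    case f: True
    show ?thesis
      unfolding g(2) vf_bracket_def frame_apply[OF g(1) lie_bracket_in[OF u v] f]
        lie_bracket_apply[OF u v smooth_pullback[OF g(1) f]] frame_frame[OF u v g(1) f] frame_frame[OF v u g(1) f] ..
  next
    case False
    then show ?thesis
      using tangent_const[OF frame_tangent[OF p u]] tangent_const[OF frame_tangent[OF p v]]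
      by (simp add: vf_bracket_def frame_nonsmooth)
  qed
qed

end

section \<open>Coordinates of vector fields in the left-invariant frame\<close>

lemma linear_formsD:
  assumes "\<theta> \<in> linear_forms V"
  shows "u \<in> V \<Longrightarrow> v \<in> V \<Longrightarrow> \<theta> (u + v) = \<theta> u + \<theta> v" "u \<in> V \<Longrightarrow> \<theta> (c *\<^sub>R u) = c * \<theta> u"
  using assms by (auto simp: linear_forms_def)

lemma alt_forms2D:
  assumes "\<alpha> \<in> alt_forms2 V"
  shows "u \<in> V \<Longrightarrow> \<alpha> u \<in> linear_forms V" "u \<in> V \<Longrightarrow> v \<in> V \<Longrightarrow> \<alpha> u v = - \<alpha> v u"
  using assms unfolding alt_forms2_def by blast+

lemma alt_forms2_left:
  assumes "\<alpha> \<in> alt_forms2 V" "subspace V" "v \<in> V"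
  shows "(\<lambda>u. \<alpha> u v) \<in> linear_forms V"
  unfolding linear_forms_def
proof safe
  show "\<alpha> u v = 0" if "u \<notin> V" for u using assms that unfolding alt_forms2_def by blast
  note l = linear_formsD[OF alt_forms2D(1)[OF assms(1,3)]]
  note a = alt_forms2D(2)[OF assms(1) _ assms(3)]
  show "\<alpha> (u + w) v = \<alpha> u v + \<alpha> w v" if "u \<in> V" "w \<in> V" for u w
    by (simp add: a[OF that(1)] a[OF that(2)] a[OF subspace_add[OF assms(2) that]] l(1)[OF that])
  show "\<alpha> (c *\<^sub>R u) v = c * \<alpha> u v" if "u \<in> V" for c u
    by (simp add: a[OF that] a[OF subspace_scale[OF assms(2) that]] l(2)[OF that])
qed

lemma linear_forms_sum:
  assumes "\<theta> \<in> linear_forms V" "subspace V" "\<And>i. i \<in> A \<Longrightarrow> f i \<in> V"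
  shows "\<theta> (\<Sum>i\<in>A. c i *\<^sub>R f i) = (\<Sum>i\<in>A. c i * \<theta> (f i))"
  using assms(3)
proof (induction A rule: infinite_finite_induct)
  case (insert x F)
  have "(\<Sum>i\<in>F. c i *\<^sub>R f i) \<in> V" using insert.prems assms(2) by (auto intro!: subspace_sum subspace_scale)
  moreover have "c x *\<^sub>R f x \<in> V" using insert.prems assms(2) by (auto intro!: subspace_scale)
  ultimately show ?case
    using insert linear_formsD[OF assms(1)] by (simp add: insert.prems)
next
  case empty
  have "\<theta> (0 *\<^sub>R 0) = 0 * \<theta> 0"
    using linear_formsD(2)[OF assms(1)] subspace_0[OF assms(2)] by blast
  then show ?case by simp
next
  case (infinite A)
  have "\<theta> (0 *\<^sub>R 0) = 0 * \<theta> 0"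
    using linear_formsD(2)[OF assms(1)] subspace_0[OF assms(2)] by blast
  then show ?case using infinite by simp
qed

context lie_chart
begin

lemma ltrans_e0: "g \<in> U \<Longrightarrow> ltrans g e0 = \<phi> g" "g \<in> U \<Longrightarrow> e0 \<in> ltrans_dom g"
  using U_sub one_U by (auto simp: ltrans_def ltrans_dom_def psi_e0)

lemma ltrans_D: "y \<in> ltrans_dom g \<Longrightarrow> ltrans g y \<in> D" "y \<in> ltrans_dom g \<Longrightarrow> \<psi> (ltrans g y) = g \<otimes> \<psi> y"
  by (auto simp: ltrans_def ltrans_dom_def psi_phi)

lemma ltrans_has_derivative:
  "g \<in> carrier G \<Longrightarrow> y \<in> ltrans_dom g \<Longrightarrow> (ltrans g has_derivative frechet_derivative (ltrans g) (at y)) (at y)"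
  using smooth_on_has_derivative ltrans_smooth by blast

lemma open_ltrans_preimage:
  assumes "g \<in> carrier G" "open S" shows "open (ltrans_dom g \<inter> ltrans g -` S)"
  using continuous_open_preimage[OF smooth_on_continuous[OF ltrans_smooth(2)] ltrans_smooth(1)] assms by blast

abbreviation "inv_dom \<equiv> {z \<in> D. inv (\<psi> z) \<in> U}"

lemma inv_chart: "open inv_dom" "smooth_on inv_dom (\<lambda>z. \<phi> (inv (\<psi> z)))" "e0 \<in> inv_dom"
proof -
  have "\<phi> ` (U \<inter> (\<lambda>x. inv x) -` U) = inv_dom" using psi_phi psi_U phi_psi by (auto simp: image_iff)
  moreover have "smooth_on (\<phi> ` (U \<inter> (\<lambda>x. inv x) -` U)) (\<phi> \<circ> (\<lambda>x. inv x) \<circ> \<psi>)"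
    using inv_smooth_map chart by (auto simp: smooth_map_def)
  ultimately show "smooth_on inv_dom (\<lambda>z. \<phi> (inv (\<psi> z)))" by (simp add: o_def)
  have "openin T {x \<in> carrier G. inv x \<in> U}"
    using openin_continuous_map_preimage[OF continuous_inv chart_open(1)[OF chart]] points_X by simp
  from chart_inv_open[OF chart this] show "open inv_dom"
    using psi_carrier by (simp add: conj_assoc cong: conj_cong)
  show "e0 \<in> inv_dom" using one_U by (simp add: psi_e0)
qed

text \<open>Left division, read in the chart.\<close>

definition ldiv :: "'e \<times> 'e \<Rightarrow> 'e" where "ldiv = (\<lambda>(z, w). \<phi> (inv (\<psi> z) \<otimes> \<psi> w))"
definition ldiv_dom :: "('e \<times> 'e) set" where "ldiv_dom = {(z, w). z \<in> inv_dom \<and> w \<in> D \<and> inv (\<psi> z) \<otimes> \<psi> w \<in> U}"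

lemma ldiv_smooth: "open ldiv_dom" "smooth_on ldiv_dom ldiv"
proof -
  let ?S = "{(y, z). y \<in> D \<and> z \<in> D \<and> \<psi> y \<otimes> \<psi> z \<in> U}"
  let ?i = "\<lambda>p. (\<phi> (inv (\<psi> (fst p))), snd p)"
  note S = mult_chart[OF chart chart chart]
  have o: "open (inv_dom \<times> D)" using inv_chart(1) open_D by (rule open_Times)
  have i: "smooth_on (inv_dom \<times> D) ?i"
  proof (rule smooth_on_Pair[OF o])
    show "smooth_on (inv_dom \<times> D) (\<lambda>p. \<phi> (inv (\<psi> (fst p))))"
      by (rule smooth_on_compose[OF o inv_chart(1) _ smooth_on_linear[OF o bounded_linear_fst smooth_on_id] inv_chart(2)]) auto
    show "smooth_on (inv_dom \<times> D) snd"
      by (rule smooth_on_linear[OF o bounded_linear_snd smooth_on_id])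
  qed
  have ldiv_dom: "ldiv_dom = (inv_dom \<times> D) \<inter> ?i -` ?S"
  proof (rule Set.set_eqI)
    fix p :: "'e \<times> 'e"
    obtain z w where p: "p = (z, w)" by fastforce
    have "\<phi> (inv (\<psi> z)) \<in> D" "\<psi> (\<phi> (inv (\<psi> z))) = inv (\<psi> z)" if "inv (\<psi> z) \<in> U"
      using that psi_phi by blast+
    then show "p \<in> ldiv_dom \<longleftrightarrow> p \<in> (inv_dom \<times> D) \<inter> ?i -` ?S"
      unfolding p ldiv_dom_def by (cases "inv (\<psi> z) \<in> U") simp_all
  qed
  show ldiv: "open ldiv_dom"
    unfolding ldiv_dom by (rule continuous_open_preimage[OF smooth_on_continuous[OF i] o S(1)])
  have "smooth_on ldiv_dom (\<lambda>p. (\<lambda>(y, z). \<phi> (\<psi> y \<otimes> \<psi> z)) (?i p))"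
    by (rule smooth_on_compose[OF ldiv S(1) _ smooth_on_subset[OF ldiv _ i] S(2)]) (auto simp: ldiv_dom)
  then show "smooth_on ldiv_dom ldiv"
    by (subst smooth_on_cong[OF ldiv]) (auto simp: ldiv_dom_def ldiv_def psi_phi)
qed

text \<open>The map \<open>w \<mapsto> inv z \<otimes> (z \<otimes> w)\<close> is the identity. Hence the partial derivative of left division in its second
  argument, which depends smoothly on \<open>z\<close>, inverts the derivative of a left translation.\<close>

lemma ldiv_inverse:
  assumes z: "z \<in> inv_dom"
  shows "frechet_derivative ldiv (at (z, z)) (0, frechet_derivative (ltrans (\<psi> z)) (at e0) a) = a"
proof -
  have zD: "z \<in> D" "\<psi> z \<in> carrier G" "\<psi> z \<in> U" using z psi_carrier psi_U by auto
  let ?L = "frechet_derivative (ltrans (\<psi> z)) (at e0)"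
  have zz: "(z, z) \<in> ldiv_dom" using z zD one_U by (simp add: ldiv_dom_def)
  have e: "ltrans (\<psi> z) e0 = z" using ltrans_e0[OF zD(3)] phi_psi[OF zD(1)] by simp
  have "((\<lambda>w. (z, ltrans (\<psi> z) w)) has_derivative (\<lambda>v. (0, ?L v))) (at e0)"
    by (intro has_derivative_Pair has_derivative_const ltrans_has_derivative[OF zD(2) ltrans_e0(2)[OF zD(3)]])
  from has_derivative_compose[OF this, of ldiv "frechet_derivative ldiv (at (z, z))"]
  have "((\<lambda>w. ldiv (z, ltrans (\<psi> z) w)) has_derivative (\<lambda>v. frechet_derivative ldiv (at (z, z)) (0, ?L v))) (at e0)"
    using smooth_on_has_derivative[OF ldiv_smooth zz] by (simp add: e)
  moreover have "((\<lambda>w. ldiv (z, ltrans (\<psi> z) w)) has_derivative (\<lambda>v. v)) (at e0)"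
  proof (rule has_derivative_transform_within_open[OF has_derivative_ident ltrans_smooth(1)[OF zD(2)] ltrans_e0(2)[OF zD(3)]])
    fix w assume w: "w \<in> ltrans_dom (\<psi> z)"
    then have "\<psi> w \<in> carrier G" "w \<in> D" using psi_carrier by (auto simp: ltrans_dom_def)
    then show "w = ldiv (z, ltrans (\<psi> z) w)"
      using ltrans_D(2)[OF w] zD by (simp add: ldiv_def m_assoc[symmetric] phi_psi)
  qed
  ultimately have "(\<lambda>v. frechet_derivative ldiv (at (z, z)) (0, ?L v)) = (\<lambda>v. v)"
    by (rule has_derivative_unique)
  then show ?thesis by metis
qed

end

context lie_quotient
begin

definition vf_coords :: "('a set \<Rightarrow> 'a set tvec) \<Rightarrow> 'a set \<Rightarrow> 'e" where
  "vf_coords Y p = coordv (cofr p (Y p))"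

lemma vf_tangent: "smooth_vf N Y \<Longrightarrow> p \<in> points N \<Longrightarrow> Y p \<in> tangent_space N p"
  by (simp add: smooth_vf_def)

lemma vf_smooth: "smooth_vf N Y \<Longrightarrow> smooth_fun N f \<Longrightarrow> smooth_fun N (\<lambda>p. Y p f)"
  by (simp add: smooth_vf_def)

lemma dvec_vf_coords:
  assumes "smooth_vf N Y" "p \<in> points N" shows "dvec (vf_coords Y p) = cofr p (Y p)"
  unfolding vf_coords_def by (rule dvec_coordv[OF coframe_in[OF assms(2) vf_tangent[OF assms]]])

lemma frame_dvec_vf_coords:
  assumes "smooth_vf N Y" "p \<in> points N" shows "fr p (dvec (vf_coords Y p)) = Y p"
  unfolding dvec_vf_coords[OF assms] by (rule frame_coframe[OF assms(2) vf_tangent[OF assms]])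

text \<open>Differentiating the coordinates around \<open>g\<close> along \<open>Y\<close> gives smooth functions. At the point with coordinates \<open>z\<close> they are
  the image of the coefficient vector of \<open>Y\<close> under the derivative of the left translation by \<open>\<psi> z\<close>,
  because the frame consists of left-invariant fields. By \<open>ldiv_inverse\<close> one can solve smoothly for the
  coefficients.\<close>

lemma smooth_vf_coords:
  assumes Y: "smooth_vf N Y" shows "smooth_fun N (\<lambda>p. vf_coords Y p \<bullet> b)"
  unfolding smooth_fun_N
proof (rule smooth_funI_local)
  fix g assume g: "g \<in> carrier G"
  obtain r where r: "adapted g r" using ex_adapted g by blast
  note B = adaptedD[OF r]
  define yy where "yy b = descend g r (bump_ext r (\<lambda>y. (y - e0) \<bullet> b))" for b
  have yy: "smooth_fun N (yy b)" for b
    unfolding yy_def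
    by (rule smooth_descend[OF r g smooth_bump_ext[OF B smooth_on_linear[OF open_ball bounded_linear_inner_left
       smooth_on_diff[OF open_ball smooth_on_id smooth_on_const]]] supp_bump_ext[OF B(2)]])
  let ?O = "inv_dom \<inter> ball e0 (r/3)"
  have o: "open ?O" using inv_chart(1) by auto
  \<comment> \<open>The derivatives along \<open>Y\<close> of all coordinates around \<open>g\<close>, as one vector.\<close>
  define V where "V z = (\<Sum>b\<in>Basis. Y (\<pi> (g \<otimes> \<psi> z)) (yy b) *\<^sub>R b)" for z
  have a: "vf_coords Y (\<pi> (g \<otimes> \<psi> z)) = frechet_derivative ldiv (at (z, z)) (0, V z)" if z: "z \<in> ?O" for z
  proof -
    have zD: "z \<in> D" "\<psi> z \<in> carrier G" "\<psi> z \<in> U" using z psi_carrier psi_U by auto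
    let ?L = "frechet_derivative (ltrans (\<psi> z)) (at e0)"
    let ?p = "\<pi> (g \<otimes> \<psi> z)" and ?a = "vf_coords Y (\<pi> (g \<otimes> \<psi> z))"
    have gz: "g \<otimes> \<psi> z \<in> carrier G" using g zD by auto
    have L: "(ltrans (\<psi> z) has_derivative ?L) (at e0)"
      by (rule ltrans_has_derivative[OF zD(2) ltrans_e0(2)[OF zD(3)]])
    have "Y ?p (yy b) = ?L ?a \<bullet> b" for b
    proof -
      have "Y ?p (yy b) = fr ?p (dvec ?a) (yy b)" using frame_dvec_vf_coords[OF Y pi_points[OF gz]] by simp
      also have "\<dots> = dvec ?a (\<lambda>x. yy b (\<pi> (g \<otimes> \<psi> z \<otimes> x)))" by (rule frame_apply[OF gz dvec_in yy])
      also have "\<dots> = ?L ?a \<bullet> b"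
      proof (rule dvec_eqI[OF smooth_pullback[OF gz yy]])
        have "((\<lambda>w. (ltrans (\<psi> z) w - e0) \<bullet> b) has_derivative (\<lambda>a. ?L a \<bullet> b)) (at e0)"
          using L by (auto intro!: derivative_eq_intros)
        then show "((\<lambda>w. yy b (\<pi> (g \<otimes> \<psi> z \<otimes> \<psi> w))) has_derivative (\<lambda>a. ?L a \<bullet> b)) (at e0)"
        proof (rule has_derivative_transform_within_open[OF _ open_ltrans_preimage[OF zD(2) open_ball[of e0 "r/3"]]])
          show "e0 \<in> ltrans_dom (\<psi> z) \<inter> ltrans (\<psi> z) -` ball e0 (r/3)"
            using ltrans_e0[OF zD(3)] phi_psi[OF zD(1)] z by simp
          fix w assume w: "w \<in> ltrans_dom (\<psi> z) \<inter> ltrans (\<psi> z) -` ball e0 (r/3)"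
          then have "\<psi> w \<in> carrier G" using psi_carrier by (auto simp: ltrans_dom_def)
          then have "g \<otimes> \<psi> z \<otimes> \<psi> w = g \<otimes> \<psi> (ltrans (\<psi> z) w)"
            using ltrans_D(2)[of w "\<psi> z"] w g zD by (simp add: m_assoc)
          moreover have "ltrans (\<psi> z) w \<in> ball e0 r" "ltrans (\<psi> z) w \<in> ball e0 (r/3)" using w B(1) by auto
          ultimately show "(ltrans (\<psi> z) w - e0) \<bullet> b = yy b (\<pi> (g \<otimes> \<psi> z \<otimes> \<psi> w))"
            unfolding yy_def by (simp only: descend_at[OF r g] bump_ext_plateau[OF B])
        qed
      qed
      finally show ?thesis .
    qed
    then have "V z = ?L ?a" by (simp add: V_def euclidean_representation)
    then show ?thesis using ldiv_inverse[of z ?a] z by simp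
  qed
  have "smooth_on ?O (\<lambda>z. vf_coords Y (\<pi> (g \<otimes> \<psi> z)))"
  proof -
    have zz: "(z, z) \<in> ldiv_dom" if "z \<in> ?O" for z using that one_U psi_carrier by (auto simp: ldiv_dom_def)
    have "smooth_on ?O (\<lambda>z. \<Sum>b\<in>Basis. Y (\<pi> (g \<otimes> \<psi> z)) (yy b) *\<^sub>R frechet_derivative ldiv (at (z, z)) (0, b))"
    proof (intro smooth_on_sum smooth_on_scaleR o)
      fix b
      show "smooth_on ?O (\<lambda>z. Y (\<pi> (g \<otimes> \<psi> z)) (yy b))"
        by (rule smooth_on_subset[OF o _ smooth_on_D_left[OF vf_smooth[OF Y yy, unfolded smooth_fun_N] g]]) auto
      show "smooth_on ?O (\<lambda>z. frechet_derivative ldiv (at (z, z)) (0, b))"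
        by (rule smooth_on_compose[OF o ldiv_smooth(1) _ smooth_on_Pair[OF o smooth_on_id smooth_on_id]
              smooth_on_frechet_derivative[OF ldiv_smooth(2)]]) (use zz in auto)
    qed
    then show ?thesis
    proof (subst smooth_on_cong[OF o])
      fix z assume z: "z \<in> ?O"
      note l = linear_compose[OF _ linear_frechet_smooth_on[OF ldiv_smooth zz[OF z]], unfolded o_def]
      have "linear (\<lambda>v. (0::'e, v::'e))" by (auto intro!: linearI)
      from linear_sum[OF l[OF this], of "\<lambda>b. Y (\<pi> (g \<otimes> \<psi> z)) (yy b) *\<^sub>R b" Basis] linear_cmul[OF l[OF this]]
      show "vf_coords Y (\<pi> (g \<otimes> \<psi> z)) =
        (\<Sum>b\<in>Basis. Y (\<pi> (g \<otimes> \<psi> z)) (yy b) *\<^sub>R frechet_derivative ldiv (at (z, z)) (0, b))"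
        by (simp only: a[OF z] V_def)
    qed
  qed
  then have s: "smooth_on ?O (\<lambda>z. vf_coords Y (\<pi> (g \<otimes> \<psi> z)) \<bullet> b)"
    by (rule smooth_on_linear[OF o bounded_linear_inner_left])
  have "e0 \<in> ?O" using inv_chart(3) B(1) by auto
  then obtain s where s': "s > 0" "ball e0 s \<subseteq> ?O" using o openE by blast
  have "smooth_on (ball e0 s \<inter> D) (\<lambda>z. vf_coords Y (\<pi> (g \<otimes> \<psi> z)) \<bullet> b)"
    by (rule smooth_on_subset[OF _ _ s]) (use s' open_D in auto)
  then show "\<exists>s>0. smooth_on (ball e0 s \<inter> D) (\<lambda>z. vf_coords Y (\<pi> (g \<otimes> \<psi> z)) \<bullet> b)" using s' by blast
qed

definition deriv_along :: "'a set tvec \<Rightarrow> ('a set \<Rightarrow> 'e) \<Rightarrow> 'e" where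
  "deriv_along w B = (\<Sum>b\<in>Basis. w (\<lambda>q. B q \<bullet> b) *\<^sub>R b)"

lemma subspace_g: "subspace \<gg>" by (rule subspace_tangent_space)

lemma linear_forms_dvec:
  assumes "\<theta> \<in> linear_forms \<gg>" shows "\<theta> (dvec c) = (\<Sum>b\<in>Basis. (c \<bullet> b) * \<theta> (dvec b))"
proof -
  have "dvec c = (\<Sum>b\<in>Basis. (c \<bullet> b) *\<^sub>R dvec b)"
    by (subst euclidean_representation[of c, symmetric])
      (simp add: linear_sum[OF linear_dvec] linear_cmul[OF linear_dvec])
  then show ?thesis using linear_forms_sum[OF assms subspace_g, of Basis dvec] dvec_in by metis
qed

lemma linear_forms_deriv_along:
  assumes "\<theta> \<in> linear_forms \<gg>" shows "\<theta> (dvec (deriv_along w B)) = (\<Sum>b\<in>Basis. w (\<lambda>q. B q \<bullet> b) * \<theta> (dvec b))"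
  unfolding deriv_along_def linear_sum[OF linear_dvec] linear_cmul[OF linear_dvec]
  by (rule linear_forms_sum[OF assms subspace_g]) (rule dvec_in)

context
  fixes p w assumes p: "p \<in> points N" and w: "w \<in> tangent_space N p"
begin

lemma tangent_form1:
  assumes \<theta>: "\<theta> \<in> linear_forms \<gg>" and B: "\<And>b. smooth_fun N (\<lambda>q. B q \<bullet> b)"
  shows "w (\<lambda>q. \<theta> (dvec (B q))) = \<theta> (dvec (deriv_along w B))" "smooth_fun N (\<lambda>q. \<theta> (dvec (B q)))"
proof -
  have *: "smooth_fun N (\<lambda>q. (B q \<bullet> b) * \<theta> (dvec b))" for b
    by (rule smooth_fun_mult[OF open_charts_N B smooth_fun_const])
  have **: "w (\<lambda>q. (B q \<bullet> b) * \<theta> (dvec b)) = w (\<lambda>q. B q \<bullet> b) * \<theta> (dvec b)" for b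
    using tangent_cmult[OF w B[of b], of "\<theta> (dvec b)"] by (simp add: mult.commute)
  have e: "(\<lambda>q. \<theta> (dvec (B q))) = (\<lambda>q. \<Sum>b\<in>Basis. (B q \<bullet> b) * \<theta> (dvec b))"
    by (rule ext) (rule linear_forms_dvec[OF \<theta>])
  show "w (\<lambda>q. \<theta> (dvec (B q))) = \<theta> (dvec (deriv_along w B))"
    by (simp only: e tangent_sum[OF w open_charts_N *] ** linear_forms_deriv_along[OF \<theta>])
  show "smooth_fun N (\<lambda>q. \<theta> (dvec (B q)))"
    by (simp only: e smooth_fun_sum[OF open_charts_N *])
qed

lemma tangent_form2:
  assumes \<beta>: "\<beta> \<in> alt_forms2 \<gg>" and B: "\<And>b. smooth_fun N (\<lambda>q. B q \<bullet> b)" and C: "\<And>b. smooth_fun N (\<lambda>q. C q \<bullet> b)"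
  shows "w (\<lambda>q. \<beta> (dvec (B q)) (dvec (C q))) =
      \<beta> (dvec (deriv_along w B)) (dvec (C p)) + \<beta> (dvec (B p)) (dvec (deriv_along w C))"
    "smooth_fun N (\<lambda>q. \<beta> (dvec (B q)) (dvec (C q)))"
proof -
  note L = alt_forms2_left[OF \<beta> subspace_g dvec_in]
  note R = alt_forms2D(1)[OF \<beta> dvec_in]
  have e: "\<beta> (dvec a) (dvec c) = (\<Sum>b\<in>Basis. (a \<bullet> b) * \<beta> (dvec b) (dvec c))" for a c
    by (rule linear_forms_dvec[OF L])
  have e': "(\<lambda>q. \<beta> (dvec (B q)) (dvec (C q))) = (\<lambda>q. \<Sum>b\<in>Basis. (B q \<bullet> b) * \<beta> (dvec b) (dvec (C q)))"
    by (rule ext) (rule e)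
  have s: "smooth_fun N (\<lambda>q. (B q \<bullet> b) * \<beta> (dvec b) (dvec (C q)))" for b
    by (rule smooth_fun_mult[OF open_charts_N B tangent_form1(2)[OF R C]])
  show "smooth_fun N (\<lambda>q. \<beta> (dvec (B q)) (dvec (C q)))"
    unfolding e' by (rule smooth_fun_sum[OF open_charts_N s])
  have "w (\<lambda>q. \<beta> (dvec (B q)) (dvec (C q))) = (\<Sum>b\<in>Basis. w (\<lambda>q. (B q \<bullet> b) * \<beta> (dvec b) (dvec (C q))))"
    unfolding e' by (rule tangent_sum[OF w open_charts_N s])
  also have "\<dots> = (\<Sum>b\<in>Basis. w (\<lambda>q. B q \<bullet> b) * \<beta> (dvec b) (dvec (C p))) +
      (\<Sum>b\<in>Basis. (B p \<bullet> b) * \<beta> (dvec b) (dvec (deriv_along w C)))"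
    by (simp add: tangent_mult[OF w B tangent_form1(2)[OF R C]] tangent_form1(1)[OF R C] sum.distrib mult.commute add.commute)
  also have "\<dots> = \<beta> (dvec (deriv_along w B)) (dvec (C p)) + \<beta> (dvec (B p)) (dvec (deriv_along w C))"
    using linear_forms_deriv_along[OF alt_forms2_left[OF \<beta> subspace_g dvec_in[of "C p"]], of w B] e[of "B p" "deriv_along w C"] by simp
  finally show "w (\<lambda>q. \<beta> (dvec (B q)) (dvec (C q))) =
      \<beta> (dvec (deriv_along w B)) (dvec (C p)) + \<beta> (dvec (B p)) (dvec (deriv_along w C))" .
qed

text \<open>The product rule for \<open>Z\<close> written as a combination of frame fields: either the coefficients are
  differentiated, or they are frozen at \<open>p\<close> and the frame is.\<close>

lemma tangent_vf:
  assumes Z: "smooth_vf N Z" and f: "smooth_fun N f"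
  shows "w (\<lambda>q. Z q f) = fr p (dvec (deriv_along w (vf_coords Z))) f + w (\<lambda>q. fr q (cofr p (Z p)) f)"
proof -
  have s: "smooth_fun N (\<lambda>q. fr q (dvec b) f)" for b by (rule smooth_frame_fun[OF dvec_in f])
  have sm: "smooth_fun N (\<lambda>q. (vf_coords Z q \<bullet> b) * fr q (dvec b) f)" for b
    by (rule smooth_fun_mult[OF open_charts_N smooth_vf_coords[OF Z] s])
  have fs: "fr q (c *\<^sub>R u) f = c * fr q u f" for q c u
    by (subst frame_scaleR) (simp add: scaleR_fun_def)
  have lin: "fr q (dvec c) f = (\<Sum>b\<in>Basis. (c \<bullet> b) * fr q (dvec b) f)" for q c
  proof -
    have l: "linear (\<lambda>c. fr q (dvec c) f)"
      by (rule linearI) (simp_all add: linear_add[OF linear_dvec] linear_cmul[OF linear_dvec] frame_add fs)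
    show ?thesis
      using linear_sum[OF l, of "\<lambda>b. (c \<bullet> b) *\<^sub>R b" Basis] by (simp add: euclidean_representation linear_cmul[OF l])
  qed
  have "w (\<lambda>q. Z q f) = w (\<lambda>q. \<Sum>b\<in>Basis. (vf_coords Z q \<bullet> b) * fr q (dvec b) f)"
    by (rule tangent_cong_N[OF p w vf_smooth[OF Z f]])
      (simp only: lin[symmetric] frame_dvec_vf_coords[OF Z])
  also have "\<dots> = (\<Sum>b\<in>Basis. w (\<lambda>q. vf_coords Z q \<bullet> b) * fr p (dvec b) f) + (\<Sum>b\<in>Basis. (vf_coords Z p \<bullet> b) * w (\<lambda>q. fr q (dvec b) f))"
    by (simp add: tangent_sum[OF w open_charts_N sm] tangent_mult[OF w smooth_vf_coords[OF Z] s] sum.distrib mult.commute add.commute)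
  also have "(\<Sum>b\<in>Basis. w (\<lambda>q. vf_coords Z q \<bullet> b) * fr p (dvec b) f) = fr p (dvec (deriv_along w (vf_coords Z))) f"
    unfolding lin[of p "deriv_along w (vf_coords Z)"] by (simp add: deriv_along_def)
  also have "(\<Sum>b\<in>Basis. (vf_coords Z p \<bullet> b) * w (\<lambda>q. fr q (dvec b) f)) = w (\<lambda>q. fr q (dvec (vf_coords Z p)) f)"
    by (simp only: lin[of _ "vf_coords Z p"] tangent_sum[OF w open_charts_N smooth_fun_cmult[OF open_charts_N s]] tangent_cmult[OF w s])
  finally show ?thesis by (simp add: dvec_vf_coords[OF Z p])
qed

lemma tangent_vf_nonsmooth:
  assumes "smooth_vf N Z" "\<not> smooth_fun N f" shows "w (\<lambda>q. Z q f) = 0"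
proof -
  have "w (\<lambda>q. 0) = w (\<lambda>q. Z q f)"
    by (rule tangent_cong_N[OF p w smooth_fun_const]) (use tangent_nonsmooth[OF vf_tangent[OF assms(1)]] assms(2) in simp)
  then show ?thesis using tangent_const[OF w] by simp
qed

end

text \<open>With frozen coefficients, the bracket is that of two frame fields.\<close>

lemma vf_bracket_frame:
  assumes Y: "smooth_vf N Y" and Z: "smooth_vf N Z" and p: "p \<in> points N"
  shows "vf_bracket Y Z p = fr p (dvec (deriv_along (Y p) (vf_coords Z)) - dvec (deriv_along (Z p) (vf_coords Y)) + br (cofr p (Y p)) (cofr p (Z p)))"
proof
  fix f
  note w = vf_tangent[OF Y p] vf_tangent[OF Z p]
  note c = coframe_in[OF p w(1)] coframe_in[OF p w(2)]
  show "vf_bracket Y Z p f = fr p (dvec (deriv_along (Y p) (vf_coords Z)) - dvec (deriv_along (Z p) (vf_coords Y)) + br (cofr p (Y p)) (cofr p (Z p))) f"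
  proof (cases "smooth_fun N f")
    case False
    then show ?thesis
      using tangent_vf_nonsmooth[OF p w(1) Z] tangent_vf_nonsmooth[OF p w(2) Y] by (simp add: vf_bracket_def frame_nonsmooth)
  next
    case f: True
    have m: "fr p (a - b) f = fr p a f - fr p b f" for a b
      using frame_add[of p "a - b" b] by (simp add: fun_eq_iff)
    have "fr p (br (cofr p (Y p)) (cofr p (Z p))) f =
        Y p (\<lambda>q. fr q (cofr p (Z p)) f) - Z p (\<lambda>q. fr q (cofr p (Y p)) f)"
      unfolding frame_bracket[OF c p, symmetric] by (simp add: vf_bracket_def frame_coframe[OF p] w)
    then show ?thesis
      unfolding vf_bracket_def tangent_vf[OF p w(1) Z f] tangent_vf[OF p w(2) Y f]
      by (simp add: frame_add m)
  qed
qed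

lemma coframe_bracket:
  assumes Y: "smooth_vf N Y" and Z: "smooth_vf N Z" and p: "p \<in> points N"
  shows "cofr p (vf_bracket Y Z p) = dvec (deriv_along (Y p) (vf_coords Z)) - dvec (deriv_along (Z p) (vf_coords Y)) + br (cofr p (Y p)) (cofr p (Z p))"
    "vf_bracket Y Z p \<in> tangent_space N p"
proof -
  have "dvec (deriv_along (Y p) (vf_coords Z)) - dvec (deriv_along (Z p) (vf_coords Y)) + br (cofr p (Y p)) (cofr p (Z p)) \<in> \<gg>"
    by (intro subspace_add[OF subspace_g] subspace_diff[OF subspace_g] dvec_in lie_bracket_in
       coframe_in[OF p] vf_tangent[OF Y p] vf_tangent[OF Z p])
  then show "cofr p (vf_bracket Y Z p) = dvec (deriv_along (Y p) (vf_coords Z)) - dvec (deriv_along (Z p) (vf_coords Y)) + br (cofr p (Y p)) (cofr p (Z p))"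
    "vf_bracket Y Z p \<in> tangent_space N p"
    unfolding vf_bracket_frame[OF assms] using coframe_frame[OF p] frame_tangent[OF p] by blast+
qed

section \<open>Left-invariant forms\<close>

definition left_inv_form1 :: "('a tvec \<Rightarrow> real) \<Rightarrow> 'a set \<Rightarrow> 'a set tvec \<Rightarrow> real" where
  "left_inv_form1 \<theta> p u = (if p \<in> points N \<and> u \<in> tangent_space N p then \<theta> (cofr p u) else 0)"

abbreviation "lif \<equiv> left_inv_form G X \<Gamma>"

lemma lif_apply:
  "p \<in> points N \<Longrightarrow> u \<in> tangent_space N p \<Longrightarrow> v \<in> tangent_space N p \<Longrightarrow> lif \<alpha> p u v = \<alpha> (cofr p u) (cofr p v)"
  by (simp add: left_inv_form_def Let_def)

lemma lif_outside: "\<not> (p \<in> points N \<and> u \<in> tangent_space N p \<and> v \<in> tangent_space N p) \<Longrightarrow> lif \<alpha> p u v = 0"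
  by (auto simp: left_inv_form_def Let_def)

lemma lif_vf:
  assumes "smooth_vf N Y" "smooth_vf N Z" "p \<in> points N"
  shows "lif \<alpha> p (Y p) (Z p) = \<alpha> (dvec (vf_coords Y p)) (dvec (vf_coords Z p))"
  using assms by (simp add: lif_apply vf_tangent dvec_vf_coords)

lemma lif1_vf:
  assumes "smooth_vf N Y" "p \<in> points N"
  shows "left_inv_form1 \<theta> p (Y p) = \<theta> (dvec (vf_coords Y p))"
  using assms by (simp add: left_inv_form1_def vf_tangent dvec_vf_coords)

lemma smooth_form1:
  assumes "\<theta> \<in> linear_forms \<gg>" "\<And>b. smooth_fun N (\<lambda>q. B q \<bullet> b)"
  shows "smooth_fun N (\<lambda>q. \<theta> (dvec (B q)))"
  using tangent_form1(2)[OF pi_points[OF one_closed] tangent_space_0] assms by blast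

lemma smooth_form2:
  assumes "\<beta> \<in> alt_forms2 \<gg>" "\<And>b. smooth_fun N (\<lambda>q. B q \<bullet> b)" "\<And>b. smooth_fun N (\<lambda>q. C q \<bullet> b)"
  shows "smooth_fun N (\<lambda>q. \<beta> (dvec (B q)) (dvec (C q)))"
  using tangent_form2(2)[OF pi_points[OF one_closed] tangent_space_0] assms by blast

lemma left_inv_form1_one_form:
  assumes \<theta>: "\<theta> \<in> linear_forms \<gg>" shows "left_inv_form1 \<theta> \<in> one_forms N"
  unfolding one_forms_def
proof safe
  fix p assume p: "p \<in> points N"
  show "left_inv_form1 \<theta> p \<in> linear_forms (tangent_space N p)"
    unfolding linear_forms_def
    using p by (auto simp: left_inv_form1_def tangent_space_add tangent_space_scaleR coframe_add coframe_scaleR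
       linear_formsD[OF \<theta>] coframe_in)
next
  fix p assume "p \<notin> points N"
  then show "left_inv_form1 \<theta> p = 0" by (auto simp: left_inv_form1_def fun_eq_iff)
next
  fix Y assume Y: "smooth_vf N Y"
  show "smooth_fun N (\<lambda>p. left_inv_form1 \<theta> p (Y p))"
    using smooth_form1[OF \<theta> smooth_vf_coords[OF Y]] by (subst smooth_fun_N_cong[OF lif1_vf[OF Y]])
qed

lemma lif_two_form:
  assumes \<alpha>: "\<alpha> \<in> alt_forms2 \<gg>" shows "lif \<alpha> \<in> two_forms N"
  unfolding two_forms_def
proof safe
  fix p assume p: "p \<in> points N"
  show "lif \<alpha> p \<in> alt_forms2 (tangent_space N p)"
    unfolding alt_forms2_def
  proof safe
    fix u assume u: "u \<in> tangent_space N p"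
    note l = linear_formsD[OF alt_forms2D(1)[OF \<alpha> coframe_in[OF p u]]]
    show "lif \<alpha> p u \<in> linear_forms (tangent_space N p)"
      unfolding linear_forms_def
      using p u by (auto simp: lif_apply lif_outside tangent_space_add tangent_space_scaleR coframe_add
         coframe_scaleR l coframe_in)
  next
    fix u v assume uv: "u \<in> tangent_space N p" "v \<in> tangent_space N p"
    show "lif \<alpha> p u v = - lif \<alpha> p v u"
      unfolding lif_apply[OF p uv] lif_apply[OF p uv(2,1)]
      by (rule alt_forms2D(2)[OF \<alpha> coframe_in[OF p uv(1)] coframe_in[OF p uv(2)]])
  qed (simp_all add: lif_outside)
next
  fix p assume "p \<notin> points N"
  then show "lif \<alpha> p = 0" by (auto simp: lif_outside fun_eq_iff)
next
  fix Y Z assume Y: "smooth_vf N Y" and Z: "smooth_vf N Z"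
  show "smooth_fun N (\<lambda>p. lif \<alpha> p (Y p) (Z p))"
    using smooth_form2[OF \<alpha> smooth_vf_coords[OF Y] smooth_vf_coords[OF Z]] by (subst smooth_fun_N_cong[OF lif_vf[OF Y Z]])
qed

lemma vf_form1:
  assumes \<theta>: "\<theta> \<in> linear_forms \<gg>" and p: "p \<in> points N" and W: "smooth_vf N W" and Y: "smooth_vf N Y"
  shows "W p (\<lambda>q. left_inv_form1 \<theta> q (Y q)) = \<theta> (dvec (deriv_along (W p) (vf_coords Y)))"
proof -
  note w = vf_tangent[OF W p]
  have "W p (\<lambda>q. left_inv_form1 \<theta> q (Y q)) = W p (\<lambda>q. \<theta> (dvec (vf_coords Y q)))"
    by (rule tangent_cong_N[OF p w _ lif1_vf[OF Y]])
      (use left_inv_form1_one_form[OF \<theta>] Y in \<open>auto simp: one_forms_def\<close>)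
  then show ?thesis by (simp add: tangent_form1(1)[OF p w \<theta> smooth_vf_coords[OF Y]])
qed

lemma vf_form2:
  assumes \<beta>: "\<beta> \<in> alt_forms2 \<gg>" and p: "p \<in> points N" and W: "smooth_vf N W"
    and Y: "smooth_vf N Y" and Z: "smooth_vf N Z"
  shows "W p (\<lambda>q. lif \<beta> q (Y q) (Z q)) =
    \<beta> (dvec (deriv_along (W p) (vf_coords Y))) (cofr p (Z p)) + \<beta> (cofr p (Y p)) (dvec (deriv_along (W p) (vf_coords Z)))"
proof -
  note w = vf_tangent[OF W p]
  have "W p (\<lambda>q. lif \<beta> q (Y q) (Z q)) = W p (\<lambda>q. \<beta> (dvec (vf_coords Y q)) (dvec (vf_coords Z q)))"
    by (rule tangent_cong_N[OF p w _ lif_vf[OF Y Z]])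
      (use lif_two_form[OF \<beta>] Y Z in \<open>auto simp: two_forms_def\<close>)
  then show ?thesis
    by (simp add: tangent_form2(1)[OF p w \<beta> smooth_vf_coords[OF Y] smooth_vf_coords[OF Z]] dvec_vf_coords[OF Y p] dvec_vf_coords[OF Z p])
qed

lemma linear_forms_diff:
  assumes "\<theta> \<in> linear_forms \<gg>" "u \<in> \<gg>" "v \<in> \<gg>" shows "\<theta> (u - v) = \<theta> u - \<theta> v"
  using linear_formsD(1)[OF assms(1) subspace_diff[OF subspace_g assms(2,3)] assms(3)] by simp

lemma ext_d1_left_inv:
  assumes \<theta>: "\<theta> \<in> linear_forms \<gg>" and Y: "smooth_vf N Y" and Z: "smooth_vf N Z" and p: "p \<in> points N"
  shows "ext_d1 (left_inv_form1 \<theta>) Y Z p = - \<theta> (br (cofr p (Y p)) (cofr p (Z p)))"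
proof -
  have b: "br (cofr p (Y p)) (cofr p (Z p)) \<in> \<gg>"
    by (intro lie_bracket_in coframe_in[OF p] vf_tangent[OF Y p] vf_tangent[OF Z p])
  show ?thesis
    unfolding ext_d1_def vf_form1[OF \<theta> p Y Z] vf_form1[OF \<theta> p Z Y]
    using coframe_bracket[OF Y Z p] p
    by (simp add: left_inv_form1_def linear_formsD(1)[OF \<theta> subspace_diff[OF subspace_g dvec_in dvec_in] b]
       linear_forms_diff[OF \<theta> dvec_in dvec_in])
qed

text \<open>The terms in which coefficients of the vector fields are differentiated cancel in pairs, by the
  antisymmetry of \<open>\<beta>\<close>. The brackets of frozen coefficients remain.\<close>

lemma ext_d2_left_inv:
  assumes \<beta>: "\<beta> \<in> alt_forms2 \<gg>" and W: "smooth_vf N W" and Y: "smooth_vf N Y" and Z: "smooth_vf N Z"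
    and p: "p \<in> points N"
  shows "ext_d2 (lif \<beta>) W Y Z p = ce_d2 br \<beta> (cofr p (W p)) (cofr p (Y p)) (cofr p (Z p))"
proof -
  have bra: "lif \<beta> p (vf_bracket A B p) (C p) = \<beta> (dvec (deriv_along (A p) (vf_coords B))) (cofr p (C p))
       - \<beta> (dvec (deriv_along (B p) (vf_coords A))) (cofr p (C p)) + \<beta> (br (cofr p (A p)) (cofr p (B p))) (cofr p (C p))"
    if A: "smooth_vf N A" and B: "smooth_vf N B" and C: "smooth_vf N C" for A B C
  proof -
    have c: "cofr p (C p) \<in> \<gg>" by (rule coframe_in[OF p vf_tangent[OF C p]])
    have b: "br (cofr p (A p)) (cofr p (B p)) \<in> \<gg>"
      by (intro lie_bracket_in coframe_in[OF p] vf_tangent[OF A p] vf_tangent[OF B p])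
    note l = alt_forms2_left[OF \<beta> subspace_g c]
    show ?thesis
      using coframe_bracket[OF A B p] vf_tangent[OF C p] p
        linear_formsD(1)[OF l subspace_diff[OF subspace_g dvec_in dvec_in] b] linear_forms_diff[OF l dvec_in dvec_in]
      by (simp add: lif_apply)
  qed
  have alt: "\<beta> (cofr p (A p)) (dvec x) = - \<beta> (dvec x) (cofr p (A p))" if "smooth_vf N A" for A x
    by (rule alt_forms2D(2)[OF \<beta> coframe_in[OF p vf_tangent[OF that p]] dvec_in])
  show ?thesis
    unfolding ext_d2_def ce_d2_def
    by (simp add: vf_form2[OF \<beta> p] bra W Y Z alt)
qed

lemma lif_closed:
  assumes "\<beta> \<in> ce_closed \<gg> br" shows "lif \<beta> \<in> closed_forms N"
proof -
  have \<beta>: "\<beta> \<in> alt_forms2 \<gg>" using assms by (simp add: ce_closed_def)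
  show ?thesis
    unfolding closed_forms_def
    using lif_two_form[OF \<beta>] ext_d2_left_inv[OF \<beta>] assms
    by (auto simp: ce_closed_def coframe_in vf_tangent)
qed

lemma lie_bracket_anti:
  assumes "u \<in> \<gg>" "v \<in> \<gg>" shows "br u v = - br v u"
proof
  fix f show "br u v f = (- br v u) f"
    using lie_bracket_apply[OF assms, of f] lie_bracket_apply[OF assms(2,1), of f] lie_bracket_nonsmooth[OF assms, of f]
      lie_bracket_nonsmooth[OF assms(2,1), of f] by (cases "smooth_fun X f") auto
qed

lemma lie_bracket_linear:
  assumes u: "u \<in> \<gg>" and v: "v \<in> \<gg>" and w: "w \<in> \<gg>"
  shows "br u (v + w) = br u v + br u w" "br u (c *\<^sub>R v) = c *\<^sub>R br u v"
proof -
  have vw: "v + w \<in> \<gg>" "c *\<^sub>R v \<in> \<gg>" using tangent_space_add[OF v w] tangent_space_scaleR[OF v] by auto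
  show "br u (v + w) = br u v + br u w"
  proof
    fix f show "br u (v + w) f = (br u v + br u w) f"
    proof (cases "smooth_fun X f")
      case f: True
      have "lder (v + w) f = (\<lambda>g. lder v f g + lder w f g)" by (auto simp: lder_def)
      then show ?thesis
        using tangent_add[OF u smooth_lder[OF v f] smooth_lder[OF w f]]
        by (simp add: lie_bracket_apply[OF u] v w vw f)
    qed (simp add: lie_bracket_nonsmooth u v w vw)
  qed
  show "br u (c *\<^sub>R v) = c *\<^sub>R br u v"
  proof
    fix f show "br u (c *\<^sub>R v) f = (c *\<^sub>R br u v) f"
    proof (cases "smooth_fun X f")
      case f: True
      have "lder (c *\<^sub>R v) f = (\<lambda>g. c * lder v f g)" by (auto simp: lder_def scaleR_fun_def)
      then show ?thesis
        unfolding lie_bracket_apply[OF u vw(2) f] scaleR_fun_def[of c "br u v"] lie_bracket_apply[OF u v f]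
        using tangent_cmult[OF u smooth_lder[OF v f]] by (simp add: scaleR_fun_def algebra_simps)
    next
      case False
      show ?thesis
        unfolding lie_bracket_nonsmooth[OF u vw(2) False] scaleR_fun_def[of c "br u v"]
          lie_bracket_nonsmooth[OF u v False] by simp
    qed
  qed
qed

lemma ce_d1_alt:
  assumes \<theta>: "\<theta> \<in> linear_forms \<gg>" shows "ce_d1 \<gg> br \<theta> \<in> alt_forms2 \<gg>"
  unfolding alt_forms2_def
proof safe
  fix u assume u: "u \<in> \<gg>"
  show "ce_d1 \<gg> br \<theta> u \<in> linear_forms \<gg>"
    unfolding linear_forms_def
    using u by (auto simp: ce_d1_def tangent_space_add tangent_space_scaleR lie_bracket_linear[OF u]
       linear_formsD[OF \<theta>] lie_bracket_in)
next
  fix u v assume uv: "u \<in> \<gg>" "v \<in> \<gg>"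
  have "\<theta> ((-1) *\<^sub>R br v u) = - 1 * \<theta> (br v u)"
    by (rule linear_formsD(2)[OF \<theta>]) (use lie_bracket_in uv in auto)
  then show "ce_d1 \<gg> br \<theta> u v = - ce_d1 \<gg> br \<theta> v u"
    using uv lie_bracket_anti[OF uv] by (simp add: ce_d1_def)
qed (auto simp: ce_d1_def)

lemma lif_exact:
  assumes "\<beta> \<in> ce_exact \<gg> br" shows "lif \<beta> \<in> exact_forms N"
proof -
  obtain \<theta> where \<theta>: "\<theta> \<in> linear_forms \<gg>" "\<beta> = ce_d1 \<gg> br \<theta>" using assms by (auto simp: ce_exact_def)
  have "lif \<beta> p (Y p) (Z p) = ext_d1 (left_inv_form1 \<theta>) Y Z p"
    if "smooth_vf N Y" "smooth_vf N Z" "p \<in> points N" for Y Z p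
    using ext_d1_left_inv[OF \<theta>(1) that] that
    by (simp add: \<theta>(2) lif_apply vf_tangent ce_d1_def coframe_in)
  then show ?thesis
    unfolding exact_forms_def using lif_two_form[OF ce_d1_alt[OF \<theta>(1)]] left_inv_form1_one_form[OF \<theta>(1)] \<theta>(2) by blast
qed

end

section \<open>Integration in the chart at the identity\<close>

lemma det_matrix_compose:
  fixes f g :: "real^'n \<Rightarrow> real^'n"
  assumes "linear f" "linear g"
  shows "det (matrix (\<lambda>v. g (f v))) = det (matrix g) * det (matrix f)"
  using matrix_compose[OF assms] by (simp add: o_def det_mul)

lemma integral_change_of_variables_real:
  fixes f :: "real^'n::{finite,wellorder} \<Rightarrow> real" and g :: "real^'n::_ \<Rightarrow> real^'n::_"
  assumes "S \<in> sets lebesgue" "\<And>x. x \<in> S \<Longrightarrow> (g has_derivative g' x) (at x within S)" "inj_on g S"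
    and f: "f absolutely_integrable_on (g ` S)"
  shows "integral S (\<lambda>x. \<bar>det (matrix (g' x))\<bar> * f (g x)) = integral (g ` S) f"
proof -
  let ?f = "\<lambda>x. vec (f x) :: real^1"
  have "?f absolutely_integrable_on (g ` S)" using f by (simp add: absolutely_integrable_on_1_iff)
  then have "integral S (\<lambda>x. \<bar>det (matrix (g' x))\<bar> *\<^sub>R ?f (g x)) = integral (g ` S) ?f"
    using has_absolute_integral_change_of_variables[OF assms(1-3), of ?f] by blast
  then show ?thesis by (simp add: integral_on_1_eq vec_eq_iff)
qed

locale lie_chart_cart = lie_chart G X U \<phi>
  for G :: "('a, 'b) monoid_scheme" (structure) and X :: "('a, real^'n::{finite,wellorder}) mfd"
    and U :: "'a set" and \<phi> :: "'a \<Rightarrow> real^'n::{finite,wellorder}"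
begin

definition jac :: "'a \<Rightarrow> (real^'n::_) \<Rightarrow> real" where
  "jac h y = det (matrix (frechet_derivative (ltrans h) (at y)))"

lemma jac_eqI: "(ltrans h has_derivative f') (at y) \<Longrightarrow> jac h y = det (matrix f')"
  unfolding jac_def using frechet_derivative_at by metis

lemma jac_mult:
  assumes h: "h \<in> carrier G" and k: "k \<in> carrier G" and y: "y \<in> ltrans_dom k" "h \<otimes> k \<otimes> \<psi> y \<in> U"
  shows "jac (h \<otimes> k) y = jac h (ltrans k y) * jac k y"
proof -
  have yC: "\<psi> y \<in> carrier G" using y psi_carrier by (auto simp: ltrans_dom_def)
  have ly: "ltrans k y \<in> ltrans_dom h"
    using ltrans_D[OF y(1)] y(2) h k yC by (auto simp: ltrans_dom_def m_assoc)
  note d = ltrans_has_derivative[OF k y(1)] ltrans_has_derivative[OF h ly]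
  have o: "open (ltrans_dom k \<inter> ltrans k -` ltrans_dom h)" by (rule open_ltrans_preimage[OF k ltrans_smooth(1)[OF h]])
  have "(ltrans (h \<otimes> k) has_derivative (\<lambda>v. frechet_derivative (ltrans h) (at (ltrans k y)) (frechet_derivative (ltrans k) (at y) v))) (at y)"
  proof (rule has_derivative_transform_within_open[OF has_derivative_compose[OF d] o])
    fix w assume w: "w \<in> ltrans_dom k \<inter> ltrans k -` ltrans_dom h"
    then have "\<psi> w \<in> carrier G" using psi_carrier by (auto simp: ltrans_dom_def)
    then show "ltrans h (ltrans k w) = ltrans (h \<otimes> k) w"
      using ltrans_D(2)[of w k] w h k by (simp add: ltrans_def[of h] ltrans_def[of "h \<otimes> k"] m_assoc)
  qed (use y ly in simp)
  from jac_eqI[OF this] show ?thesis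
    unfolding jac_def
    using det_matrix_compose[OF has_derivative_linear[OF d(1)] has_derivative_linear[OF d(2)]] by simp
qed

lemma jac_nonzero:
  assumes h: "h \<in> carrier G" and y: "y \<in> ltrans_dom h" shows "jac h y \<noteq> 0"
proof -
  have yC: "\<psi> y \<in> carrier G" "\<psi> y \<in> U" "y \<in> D" using y psi_carrier psi_U by (auto simp: ltrans_dom_def)
  have "jac \<one> y = det (matrix (\<lambda>v::real^'n::_. v))"
  proof (rule jac_eqI)
    show "(ltrans \<one> has_derivative (\<lambda>v. v)) (at y)"
      by (rule has_derivative_transform_within_open[OF has_derivative_ident open_D yC(3)])
        (simp add: ltrans_def phi_psi psi_carrier)
  qed
  also have "\<dots> = 1" by (simp add: matrix_id_mat_1[unfolded id_def])
  finally have "jac (inv h \<otimes> h) y = 1" using h by simp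
  then show ?thesis using jac_mult[OF inv_closed[OF h] h y] h yC by auto
qed

text \<open>The density of the left-invariant volume: the Euclidean volume at \<open>e0\<close>, carried to \<open>y\<close> by the left
  translation by \<open>\<psi> y\<close>.\<close>

definition rho :: "(real^'n::_) \<Rightarrow> real" where "rho y = 1 / \<bar>jac (\<psi> y) e0\<bar>"

lemma rho_pos: "y \<in> D \<Longrightarrow> rho y > 0"
  using jac_nonzero[OF psi_carrier ltrans_e0(2)[OF psi_U]] by (simp add: rho_def)

lemma rho_continuous: "continuous_on D rho"
proof -
  let ?M = "\<lambda>(y, z). \<phi> (\<psi> y \<otimes> \<psi> z)"
  let ?S = "{(y, z). y \<in> D \<and> z \<in> D \<and> \<psi> y \<otimes> \<psi> z \<in> U}"
  note S = mult_chart[OF chart chart chart]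
  have in_S: "(y, e0) \<in> ?S" if "y \<in> D" for y using that e0_D psi_U psi_carrier by (simp add: psi_e0)
  have L: "frechet_derivative (ltrans (\<psi> y)) (at e0) c = frechet_derivative ?M (at (y, e0)) (0, c)" if y: "y \<in> D" for y c
  proof -
    have "((\<lambda>z. (y, z)) has_derivative (\<lambda>v. (0, v))) (at e0)" by (auto intro!: derivative_eq_intros)
    from has_derivative_compose[OF this smooth_on_has_derivative[OF S in_S[OF y]]]
    have "(ltrans (\<psi> y) has_derivative (\<lambda>v. frechet_derivative ?M (at (y, e0)) (0, v))) (at e0)"
      by (simp add: ltrans_def[abs_def])
    then show ?thesis using frechet_derivative_at by metis
  qed
  have "smooth_on D (\<lambda>y. det (\<chi> i j. frechet_derivative ?M (at (y, e0)) (0, axis j 1) $ i))"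
  proof (rule smooth_on_det[OF open_D])
    fix i j :: 'n
    have "smooth_on D (\<lambda>y. frechet_derivative ?M (at (y, e0)) (0, axis j 1))"
      by (rule smooth_on_compose[OF open_D S(1) _ smooth_on_Pair_right[OF open_D] smooth_on_frechet_derivative[OF S(2)]])
        (use in_S in auto)
    then show "smooth_on D (\<lambda>y. (\<chi> i j. frechet_derivative ?M (at (y, e0)) (0, axis j 1) $ i) $ i $ j)"
      using smooth_on_nth[OF open_D] by simp
  qed
  then have "continuous_on D (\<lambda>y. det (\<chi> i j. frechet_derivative ?M (at (y, e0)) (0, axis j 1) $ i))"
    by (rule smooth_on_continuous)
  then have "continuous_on D (\<lambda>y. jac (\<psi> y) e0)"
    by (rule continuous_on_eq) (simp add: jac_def matrix_def L)
  then have "continuous_on D (\<lambda>y. 1 / \<bar>jac (\<psi> y) e0\<bar>)"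
    by (intro continuous_intros) (use jac_nonzero[OF psi_carrier ltrans_e0(2)[OF psi_U]] in auto)
  then show ?thesis by (simp add: rho_def[abs_def])
qed

lemma rho_left:
  assumes h: "h \<in> carrier G" and y: "y \<in> ltrans_dom h"
  shows "rho (ltrans h y) * \<bar>jac h y\<bar> = rho y"
proof -
  have yC: "\<psi> y \<in> carrier G" "\<psi> y \<in> U" "y \<in> D" "h \<otimes> \<psi> y \<in> U"
    using y psi_carrier psi_U by (auto simp: ltrans_dom_def)
  have "jac (h \<otimes> \<psi> y) e0 = jac h y * jac (\<psi> y) e0"
    using jac_mult[OF h yC(1) ltrans_e0(2)[OF yC(2)]] ltrans_e0(1)[OF yC(2)] yC h by (simp add: psi_e0 phi_psi)
  then show ?thesis
    using jac_nonzero[OF h y] jac_nonzero[OF yC(1) ltrans_e0(2)[OF yC(2)]]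
    by (simp add: rho_def ltrans_D(2)[OF y] abs_mult)
qed

definition rtrans :: "'a \<Rightarrow> (real^'n::_) \<Rightarrow> (real^'n::_)" where "rtrans s y = \<phi> (\<psi> y \<otimes> s)"
definition rtrans_dom :: "'a \<Rightarrow> (real^'n::_) set" where "rtrans_dom s = {y \<in> D. \<psi> y \<otimes> s \<in> U}"

lemma rtrans_smooth: "s \<in> carrier G \<Longrightarrow> open (rtrans_dom s)" "s \<in> carrier G \<Longrightarrow> smooth_on (rtrans_dom s) (rtrans s)"
  using right_chart[OF _ chart chart] by (simp_all add: rtrans_dom_def rtrans_def[abs_def])

lemma rtrans_D: "y \<in> rtrans_dom s \<Longrightarrow> rtrans s y \<in> D" "y \<in> rtrans_dom s \<Longrightarrow> \<psi> (rtrans s y) = \<psi> y \<otimes> s"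
  by (auto simp: rtrans_def rtrans_dom_def psi_phi)

definition rjac :: "'a \<Rightarrow> (real^'n::_) \<Rightarrow> real" where
  "rjac s y = det (matrix (frechet_derivative (rtrans s) (at y)))"

definition modulus :: "'a \<Rightarrow> real" where "modulus s = \<bar>rjac s e0\<bar> / \<bar>jac s e0\<bar>"

text \<open>The right translation by \<open>s\<close> commutes with left translations and therefore changes a left-invariant
  volume by the same factor at all points, namely by its factor at the identity.\<close>

lemma rho_right:
  assumes s: "s \<in> U" and y: "y \<in> rtrans_dom s"
  shows "rho (rtrans s y) * \<bar>rjac s y\<bar> = modulus s * rho y"
proof -
  define x where "x = \<psi> y"
  have C: "s \<in> carrier G" "x \<in> carrier G" "x \<in> U" "y \<in> D" "x \<otimes> s \<in> U" "\<psi> y = x"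
    using s U_sub y psi_carrier[of y] psi_U[of y] unfolding rtrans_dom_def x_def by blast+
  note x0 = ltrans_e0[OF C(3)]
  have lx: "ltrans x e0 = y" using x0(1) phi_psi[OF C(4)] unfolding C(6) by simp
  have e_rt: "e0 \<in> rtrans_dom s" "rtrans s e0 = \<phi> s"
    by (simp_all add: rtrans_dom_def rtrans_def psi_e0 e0_D s C(1))
  have \<sigma>: "\<phi> s \<in> ltrans_dom x" using s C psi_phi by (auto simp: ltrans_dom_def)
  note drt = smooth_on_has_derivative[OF rtrans_smooth[OF C(1)]]
  let ?R = "frechet_derivative (rtrans s)" and ?L = "frechet_derivative (ltrans x)"
  have o: "open (rtrans_dom s \<inter> (ltrans_dom x \<inter> ltrans x -` rtrans_dom s))"
    by (intro open_Int[OF rtrans_smooth(1)[OF C(1)] open_ltrans_preimage[OF C(2) rtrans_smooth(1)[OF C(1)]]])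
  have 1: "((\<lambda>w. rtrans s (ltrans x w)) has_derivative (\<lambda>v. ?R (at y) (?L (at e0) v))) (at e0)"
    using has_derivative_compose[OF ltrans_has_derivative[OF C(2) x0(2)], of "rtrans s" "?R (at y)"] drt[OF y] lx by simp
  have 2: "((\<lambda>w. ltrans x (rtrans s w)) has_derivative (\<lambda>v. ?L (at (\<phi> s)) (?R (at e0) v))) (at e0)"
    using has_derivative_compose[OF drt[OF e_rt(1)], of "ltrans x" "?L (at (\<phi> s))"] ltrans_has_derivative[OF C(2) \<sigma>] e_rt(2) by simp
  have "((\<lambda>w. rtrans s (ltrans x w)) has_derivative (\<lambda>v. ?L (at (\<phi> s)) (?R (at e0) v))) (at e0)"
  proof (rule has_derivative_transform_within_open[OF 2 o])
    show "e0 \<in> rtrans_dom s \<inter> (ltrans_dom x \<inter> ltrans x -` rtrans_dom s)" using e_rt(1) x0(2) lx y by simp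
    fix w assume w: "w \<in> rtrans_dom s \<inter> (ltrans_dom x \<inter> ltrans x -` rtrans_dom s)"
    then have "\<psi> w \<in> carrier G" using psi_carrier by (auto simp: rtrans_dom_def)
    then show "ltrans x (rtrans s w) = rtrans s (ltrans x w)"
      using rtrans_D(2)[of w s] ltrans_D(2)[of w x] w C by (simp add: ltrans_def[of x "rtrans s w"] rtrans_def[of s "ltrans x w"] m_assoc)
  qed
  with 1 have "(\<lambda>v. ?R (at y) (?L (at e0) v)) = (\<lambda>v. ?L (at (\<phi> s)) (?R (at e0) v))"
    by (rule has_derivative_unique)
  then have "det (matrix (\<lambda>v. ?R (at y) (?L (at e0) v))) = det (matrix (\<lambda>v. ?L (at (\<phi> s)) (?R (at e0) v)))"
    by simp
  then have A: "rjac s y * jac x e0 = jac x (\<phi> s) * rjac s e0"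
    unfolding jac_def rjac_def
    using det_matrix_compose[OF has_derivative_linear[OF ltrans_has_derivative[OF C(2) x0(2)]] has_derivative_linear[OF drt[OF y]]]
      det_matrix_compose[OF has_derivative_linear[OF drt[OF e_rt(1)]] has_derivative_linear[OF ltrans_has_derivative[OF C(2) \<sigma>]]]
    by simp
  have B: "jac (x \<otimes> s) e0 = jac x (\<phi> s) * jac s e0"
    using jac_mult[OF C(2,1) ltrans_e0(2)[OF s]] ltrans_e0(1)[OF s] C by (simp add: psi_e0)
  have nz: "jac x e0 \<noteq> 0" "jac s e0 \<noteq> 0" "jac x (\<phi> s) \<noteq> 0"
    using jac_nonzero[OF C(2) x0(2)] jac_nonzero[OF C(1) ltrans_e0(2)[OF s]] jac_nonzero[OF C(2) \<sigma>] by auto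
  have "\<bar>rjac s y\<bar> = \<bar>jac x (\<phi> s)\<bar> * \<bar>rjac s e0\<bar> / \<bar>jac x e0\<bar>"
    using arg_cong[OF A, of abs] nz(1) by (simp add: abs_mult nonzero_eq_divide_eq)
  then show ?thesis
    using nz by (simp add: rho_def rtrans_D(2)[OF y] C(6) B modulus_def abs_mult field_simps)
qed

text \<open>The domain of integration. Only functions supported in the ball of radius \<open>rQ\<close> inside of it are going to be
  translated.\<close>

definition boxc :: "(real^'n::_) \<times> (real^'n::_)" where
  "boxc = (SOME c. cbox (fst c) (snd c) \<subseteq> D \<and> e0 \<in> box (fst c) (snd c))"

abbreviation "Q \<equiv> cbox (fst boxc) (snd boxc)"

lemma Q: "Q \<subseteq> D" "e0 \<in> box (fst boxc) (snd boxc)"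
proof -
  obtain a b where "cbox a b \<subseteq> D" "e0 \<in> box a b" using open_contains_cbox[OF open_D e0_D] by metis
  then have "\<exists>c. cbox (fst c) (snd c) \<subseteq> D \<and> e0 \<in> box (fst c) (snd c)" by (intro exI[of _ "(a, b)"]) simp
  then show "Q \<subseteq> D" "e0 \<in> box (fst boxc) (snd boxc)" unfolding boxc_def by (rule someI2_ex, blast)+
qed

definition rQ :: real where "rQ = (SOME r. r > 0 \<and> ball e0 r \<subseteq> Q)"

lemma rQ: "rQ > 0" "ball e0 rQ \<subseteq> Q" "ball e0 rQ \<subseteq> D"
proof -
  have "\<exists>r. r > 0 \<and> ball e0 r \<subseteq> box (fst boxc) (snd boxc)" using open_box Q(2) openE by metis
  then have "\<exists>r. r > 0 \<and> ball e0 r \<subseteq> Q" using box_subset_cbox by blast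
  then show "rQ > 0" "ball e0 rQ \<subseteq> Q" unfolding rQ_def by (rule someI2_ex, blast)+
  then show "ball e0 rQ \<subseteq> D" using Q(1) by blast
qed

definition integ :: "('a \<Rightarrow> real) \<Rightarrow> real" where
  "integ F = integral Q (\<lambda>y. F (\<psi> y) * rho y)"

lemma integrand_continuous:
  assumes "smooth_fun X F" shows "continuous_on Q (\<lambda>y. F (\<psi> y) * rho y)"
  by (intro continuous_on_mult continuous_on_subset[OF smooth_on_continuous[OF smooth_on_D[OF assms]] Q(1)]
    continuous_on_subset[OF rho_continuous Q(1)])

lemma integrand_integrable:
  "smooth_fun X F \<Longrightarrow> (\<lambda>y. F (\<psi> y) * rho y) integrable_on Q"
  by (intro integrable_continuous integrand_continuous)

lemma integ_cong: "(\<And>x. x \<in> carrier G \<Longrightarrow> F x = F' x) \<Longrightarrow> integ F = integ F'"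
  unfolding integ_def by (rule integral_cong) (use Q(1) psi_carrier in auto)

lemma integ_add:
  "smooth_fun X F \<Longrightarrow> smooth_fun X F' \<Longrightarrow> integ (\<lambda>x. F x + F' x) = integ F + integ F'"
  unfolding integ_def by (simp add: distrib_right integral_add integrand_integrable)

lemma integ_cmult: "integ (\<lambda>x. c * F x) = c * integ F"
  unfolding integ_def by (simp add: mult.assoc)

lemma integ_0: "integ (\<lambda>x. 0) = 0"
  using integ_cmult[of 0] by simp

lemma integ_sum:
  "(\<And>i. i \<in> A \<Longrightarrow> smooth_fun X (F i)) \<Longrightarrow> integ (\<lambda>x. \<Sum>i\<in>A. F i x) = (\<Sum>i\<in>A. integ (F i))"
  by (induction A rule: infinite_finite_induct)
    (auto simp: integ_0 integ_add smooth_fun_sum[OF open_charts_X])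

lemma integ_nonneg: "smooth_fun X F \<Longrightarrow> (\<And>x. x \<in> carrier G \<Longrightarrow> F x \<ge> 0) \<Longrightarrow> integ F \<ge> 0"
  unfolding integ_def
  by (rule integral_nonneg[OF integrand_integrable])
    (use Q(1) psi_carrier rho_pos in \<open>auto intro!: mult_nonneg_nonneg less_imp_le[of _ "rho _"]\<close>)

lemma integ_pos:
  assumes F: "smooth_fun X F" and nn: "\<And>x. x \<in> carrier G \<Longrightarrow> F x \<ge> 0" and 1: "F \<one> > 0"
  shows "integ F > 0"
proof (rule ccontr)
  assume "\<not> integ F > 0"
  then have "integ F = 0" using integ_nonneg[OF F nn] by simp
  then have "((\<lambda>y. F (\<psi> y) * rho y) has_integral 0) Q"
    using integrable_integral[OF integrand_integrable[OF F]] by (simp add: integ_def)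
  then have "F (\<psi> e0) * rho e0 = 0"
  proof (rule has_integral_0_cbox_imp_0[OF integrand_continuous[OF F], rotated])
    show "0 \<le> F (\<psi> y) * rho y" if "y \<in> box (fst boxc) (snd boxc)" for y
      using that box_subset_cbox Q(1) psi_carrier nn rho_pos by (intro mult_nonneg_nonneg less_imp_le[of _ "rho y"]) blast+
  qed (use Q(2) box_subset_cbox in blast)+
  then show False using 1 rho_pos[OF e0_D] by (simp add: psi_e0)
qed

lemma integ_change_of_variables:
  assumes S: "open S" "S \<subseteq> Q" "g ` S \<subseteq> Q" "inj_on g S"
    and g: "\<And>y. y \<in> S \<Longrightarrow> (g has_derivative g' y) (at y)"
    and \<kappa>: "\<And>y. y \<in> S \<Longrightarrow> rho (g y) * \<bar>det (matrix (g' y))\<bar> = \<kappa> * rho y"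
    and F: "smooth_fun X F" "\<And>y. y \<in> S \<Longrightarrow> F' (\<psi> y) = F (\<psi> (g y))"
    and F0: "\<And>y. y \<in> Q \<Longrightarrow> y \<notin> g ` S \<Longrightarrow> F (\<psi> y) = 0" "\<And>y. y \<in> Q \<Longrightarrow> y \<notin> S \<Longrightarrow> F' (\<psi> y) = 0"
  shows "integ F = \<kappa> * integ F'"
proof -
  let ?f = "\<lambda>y. F (\<psi> y) * rho y" and ?f' = "\<lambda>y. F' (\<psi> y) * rho y"
  have e: "(\<lambda>y. if y \<in> Q then ?f y else 0) = (\<lambda>y. if y \<in> g ` S then ?f y else 0)"
    using F0(1) S(3) by (auto simp: fun_eq_iff)
  have e': "(\<lambda>y. if y \<in> Q then ?f' y else 0) = (\<lambda>y. if y \<in> S then ?f' y else 0)"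
    using F0(2) S(2) by (auto simp: fun_eq_iff)
  have "?f absolutely_integrable_on Q"
    by (rule absolutely_integrable_continuous[OF integrand_continuous[OF F(1)]])
  then have ai: "?f absolutely_integrable_on (g ` S)"
    unfolding absolutely_integrable_restrict_UNIV[of Q, symmetric]
      absolutely_integrable_restrict_UNIV[of "g ` S", symmetric] e .
  have "integ F = integral (g ` S) ?f"
    unfolding integ_def Henstock_Kurzweil_Integration.integral_restrict_UNIV[of Q, symmetric]
      Henstock_Kurzweil_Integration.integral_restrict_UNIV[of "g ` S", symmetric] e ..
  also have "\<dots> = integral S (\<lambda>y. \<bar>det (matrix (g' y))\<bar> * ?f (g y))"
    by (rule integral_change_of_variables_real[symmetric, OF _ _ S(4) ai])
      (use S(1) g in \<open>auto intro: has_derivative_at_withinI\<close>)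
  also have "\<dots> = integral S (\<lambda>y. \<kappa> * ?f' y)"
  proof (rule integral_cong)
    fix y assume y: "y \<in> S"
    have "\<bar>det (matrix (g' y))\<bar> * ?f (g y) = F (\<psi> (g y)) * (rho (g y) * \<bar>det (matrix (g' y))\<bar>)" by simp
    then show "\<bar>det (matrix (g' y))\<bar> * ?f (g y) = \<kappa> * ?f' y" by (simp only: \<kappa>[OF y] F(2)[OF y]) simp
  qed
  also have "\<dots> = \<kappa> * integral S ?f'" by simp
  also have "integral S ?f' = integ F'"
    unfolding integ_def Henstock_Kurzweil_Integration.integral_restrict_UNIV[of Q, symmetric]
      Henstock_Kurzweil_Integration.integral_restrict_UNIV[of S, symmetric] e' ..
  finally show ?thesis .
qed

lemma supp_inD: "supp_in r F \<Longrightarrow> x \<in> carrier G \<Longrightarrow> F x \<noteq> 0 \<Longrightarrow> \<exists>y\<in>ball e0 r. x = \<psi> y"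
  unfolding supp_in_def by blast

lemma supp_in_mono: "supp_in r F \<Longrightarrow> r \<le> s \<Longrightarrow> supp_in s F"
  unfolding supp_in_def using subset_ball[of r s e0] by blast

lemma supp_in_psi: "supp_in r F \<Longrightarrow> ball e0 r \<subseteq> D \<Longrightarrow> y \<in> D \<Longrightarrow> F (\<psi> y) \<noteq> 0 \<Longrightarrow> y \<in> ball e0 r"
  using supp_inD[of r F "\<psi> y"] psi_carrier[of y] phi_psi by (metis subsetD)

text \<open>A left translation preserves the density. The two support conditions ensure that no mass leaves the
  domain of integration.\<close>

lemma integ_left:
  assumes F: "smooth_fun X F" "supp_in rQ F" and h: "h \<in> carrier G" and F': "supp_in rQ (\<lambda>x. F (h \<otimes> x))"
  shows "integ (\<lambda>x. F (h \<otimes> x)) = integ F"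
proof -
  let ?S = "ball e0 rQ \<inter> (ltrans_dom h \<inter> ltrans h -` ball e0 rQ)"
  have inS: "y \<in> ?S" if "y \<in> ball e0 rQ" "w \<in> ball e0 rQ" "h \<otimes> \<psi> y = \<psi> w" for y w
  proof -
    have "w \<in> D" "y \<in> D" using that rQ(3) by blast+
    then have "\<psi> w \<in> U" "ltrans h y = w" using that(3) psi_U phi_psi by (auto simp: ltrans_def)
    then show ?thesis using that \<open>y \<in> D\<close> by (simp add: ltrans_dom_def)
  qed
  have "integ F = 1 * integ (\<lambda>x. F (h \<otimes> x))"
  proof (rule integ_change_of_variables[where S = ?S and g = "ltrans h" and g' = "\<lambda>y. frechet_derivative (ltrans h) (at y)"])
    show "open ?S" by (intro open_Int open_ltrans_preimage[OF h] open_ball)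
    show "?S \<subseteq> Q" using rQ(2) by blast
    show "ltrans h ` ?S \<subseteq> Q" using rQ(2) by blast
    show "inj_on (ltrans h) ?S"
    proof (rule inj_onI)
      fix y z assume yz: "y \<in> ?S" "z \<in> ?S" "ltrans h y = ltrans h z"
      have l: "y \<in> ltrans_dom h" "z \<in> ltrans_dom h" using yz by blast+
      then have D: "y \<in> D" "z \<in> D" unfolding ltrans_dom_def by blast+
      have "h \<otimes> \<psi> y = h \<otimes> \<psi> z" using ltrans_D(2)[OF l(1)] ltrans_D(2)[OF l(2)] yz(3) by simp
      then have "\<psi> y = \<psi> z" using h psi_carrier[OF D(1)] psi_carrier[OF D(2)] by simp
      then show "y = z" using phi_psi[OF D(1)] phi_psi[OF D(2)] by metis
    qed
    show "(ltrans h has_derivative frechet_derivative (ltrans h) (at y)) (at y)" if "y \<in> ?S" for y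
      using ltrans_has_derivative[OF h] that by blast
    show "rho (ltrans h y) * \<bar>det (matrix (frechet_derivative (ltrans h) (at y)))\<bar> = 1 * rho y" if "y \<in> ?S" for y
      using rho_left[OF h] that by (simp add: jac_def)
    show "F (h \<otimes> \<psi> y) = F (\<psi> (ltrans h y))" if "y \<in> ?S" for y
      using ltrans_D(2)[of y h] that by simp
    show "F (\<psi> w) = 0" if w: "w \<in> Q" "w \<notin> ltrans h ` ?S" for w
    proof (rule ccontr)
      assume nz: "F (\<psi> w) \<noteq> 0"
      have wD: "w \<in> D" "\<psi> w \<in> carrier G" using w Q(1) psi_carrier by blast+
      then have wb: "w \<in> ball e0 rQ" using supp_in_psi[OF F(2) rQ(3) wD(1) nz] by simp
      have "F (h \<otimes> (inv h \<otimes> \<psi> w)) \<noteq> 0" using nz h wD by (simp add: m_assoc[symmetric])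
      then obtain y where y: "y \<in> ball e0 rQ" "inv h \<otimes> \<psi> w = \<psi> y"
        using supp_inD[OF F', of "inv h \<otimes> \<psi> w"] h wD by blast
      have e: "h \<otimes> \<psi> y = \<psi> w" unfolding y(2)[symmetric] using h wD by (simp add: m_assoc[symmetric])
      from inS[OF y(1) wb e] have "y \<in> ?S" .
      moreover have "ltrans h y = w" using e phi_psi[OF wD(1)] by (simp add: ltrans_def)
      ultimately show False using w(2) by blast
    qed
    show "F (h \<otimes> \<psi> y) = 0" if y: "y \<in> Q" "y \<notin> ?S" for y
    proof (rule ccontr)
      assume nz: "F (h \<otimes> \<psi> y) \<noteq> 0"
      have yD: "y \<in> D" "\<psi> y \<in> carrier G" using y Q(1) psi_carrier by blast+
      have "y \<in> ball e0 rQ" using supp_in_psi[OF F' rQ(3) yD(1)] nz by simp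
      moreover obtain w where "w \<in> ball e0 rQ" "h \<otimes> \<psi> y = \<psi> w"
        using supp_inD[OF F(2) _ nz] h yD by blast
      ultimately show False using inS y(2) by blast
    qed
  qed (rule F(1))
  then show ?thesis by simp
qed

text \<open>Functions supported in the ball of radius \<open>rR\<close> stay inside the domain of integration under right
  translations by elements of the same ball.\<close>

definition rR :: real where
  "rR = (SOME r. 0 < r \<and> r \<le> rQ \<and> (\<forall>a\<in>ball e0 r. \<forall>b\<in>ball e0 r. \<psi> a \<otimes> inv (\<psi> b) \<in> \<psi> ` ball e0 rQ))"

lemma rR: "rR > 0" "rR \<le> rQ" "ball e0 rR \<subseteq> D"
  "a \<in> ball e0 rR \<Longrightarrow> b \<in> ball e0 rR \<Longrightarrow> \<psi> a \<otimes> inv (\<psi> b) \<in> \<psi> ` ball e0 rQ"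
proof -
  let ?P = "\<lambda>r. 0 < r \<and> r \<le> rQ \<and> (\<forall>a\<in>ball e0 r. \<forall>b\<in>ball e0 r. \<psi> a \<otimes> inv (\<psi> b) \<in> \<psi> ` ball e0 rQ)"
  let ?B = "{x \<in> U. \<phi> x \<in> ball e0 rQ}"
  have "openin T ?B" "\<one> \<in> ?B" using chart_preimage_open[OF chart open_ball] one_U rQ(1) by auto
  from div_nbhd[OF this] obtain W where W: "openin T W" "\<one> \<in> W" "\<forall>a\<in>W. \<forall>b\<in>W. a \<otimes> inv b \<in> ?B" by blast
  obtain r where r: "r > 0" "\<forall>y\<in>ball e0 r. \<psi> y \<in> W" using ball_in_open[OF W(1,2)] by blast
  have B: "?B \<subseteq> \<psi> ` ball e0 rQ" by (metis (mono_tags, lifting) image_eqI mem_Collect_eq psi_phi subsetI)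
  have "?P (min r rQ)"
    using r W(3) rQ(1) B by (auto simp: subset_iff)
  then have "?P rR" unfolding rR_def by (rule someI)
  then show "rR > 0" "rR \<le> rQ" "a \<in> ball e0 rR \<Longrightarrow> b \<in> ball e0 rR \<Longrightarrow> \<psi> a \<otimes> inv (\<psi> b) \<in> \<psi> ` ball e0 rQ" by blast+
  then show "ball e0 rR \<subseteq> D" using rQ(3) subset_ball[of rR rQ e0] by blast
qed

lemma integ_right:
  assumes F: "smooth_fun X F" "supp_in rR F" and \<sigma>: "\<sigma> \<in> ball e0 rR"
  shows "integ F = modulus (\<psi> \<sigma>) * integ (\<lambda>x. F (x \<otimes> \<psi> \<sigma>))"
proof -
  define s where "s = \<psi> \<sigma>"
  have s: "s \<in> U" "s \<in> carrier G" using \<sigma> rR(3) psi_U psi_carrier unfolding s_def by blast+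
  let ?S = "ball e0 rQ \<inter> (rtrans_dom s \<inter> rtrans s -` ball e0 rQ)"
  have sub: "ball e0 rR \<subseteq> ball e0 rQ" using rR(2) by (rule subset_ball)
  have key: "\<exists>y\<in>?S. \<psi> w \<otimes> inv s = \<psi> y \<and> rtrans s y = w" if w: "w \<in> ball e0 rR" for w
  proof -
    have wD: "w \<in> D" "\<psi> w \<in> carrier G" "\<psi> w \<in> U" using w rR(3) psi_carrier psi_U by blast+
    obtain y where y: "y \<in> ball e0 rQ" "\<psi> w \<otimes> inv s = \<psi> y" using rR(4)[OF w \<sigma>] unfolding s_def by blast
    have "\<psi> y \<otimes> s = \<psi> w" unfolding y(2)[symmetric] using wD s by (simp add: m_assoc)
    then have "y \<in> rtrans_dom s" "rtrans s y = w" using y rQ(3) wD phi_psi by (auto simp: rtrans_dom_def rtrans_def)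
    then show ?thesis using y w sub by blast
  qed
  have "integ F = modulus s * integ (\<lambda>x. F (x \<otimes> s))"
  proof (rule integ_change_of_variables[where S = ?S and g = "rtrans s" and g' = "\<lambda>y. frechet_derivative (rtrans s) (at y)"])
    have "open (rtrans_dom s \<inter> rtrans s -` ball e0 rQ)"
      using continuous_open_preimage[OF smooth_on_continuous[OF rtrans_smooth(2)[OF s(2)]] rtrans_smooth(1)[OF s(2)]] by blast
    then show "open ?S" by (rule open_Int[OF open_ball])
    show "?S \<subseteq> Q" using rQ(2) by blast
    show "rtrans s ` ?S \<subseteq> Q" using rQ(2) by blast
    show "inj_on (rtrans s) ?S"
    proof (rule inj_onI)
      fix y z assume yz: "y \<in> ?S" "z \<in> ?S" "rtrans s y = rtrans s z"
      have l: "y \<in> rtrans_dom s" "z \<in> rtrans_dom s" using yz by blast+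
      then have D: "y \<in> D" "z \<in> D" unfolding rtrans_dom_def by blast+
      have "\<psi> y \<otimes> s = \<psi> z \<otimes> s" using rtrans_D(2)[OF l(1)] rtrans_D(2)[OF l(2)] yz(3) by simp
      then have "\<psi> y = \<psi> z" using s psi_carrier[OF D(1)] psi_carrier[OF D(2)] by simp
      then show "y = z" using phi_psi[OF D(1)] phi_psi[OF D(2)] by metis
    qed
    show "(rtrans s has_derivative frechet_derivative (rtrans s) (at y)) (at y)" if "y \<in> ?S" for y
      using smooth_on_has_derivative[OF rtrans_smooth[OF s(2)]] that by blast
    show "rho (rtrans s y) * \<bar>det (matrix (frechet_derivative (rtrans s) (at y)))\<bar> = modulus s * rho y" if "y \<in> ?S" for y
      using rho_right[OF s(1)] that by (simp add: rjac_def)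
    show "F (\<psi> y \<otimes> s) = F (\<psi> (rtrans s y))" if "y \<in> ?S" for y
      using rtrans_D(2)[of y s] that by simp
    show "F (\<psi> w) = 0" if w: "w \<in> Q" "w \<notin> rtrans s ` ?S" for w
    proof (rule ccontr)
      assume nz: "F (\<psi> w) \<noteq> 0"
      have "w \<in> D" using w Q(1) by blast
      then have "w \<in> ball e0 rR" using supp_in_psi[OF F(2) rR(3) _ nz] by simp
      then show False using key w(2) by blast
    qed
    show "F (\<psi> y \<otimes> s) = 0" if y: "y \<in> Q" "y \<notin> ?S" for y
    proof (rule ccontr)
      assume nz: "F (\<psi> y \<otimes> s) \<noteq> 0"
      have yD: "y \<in> D" "\<psi> y \<in> carrier G" using y Q(1) psi_carrier by blast+
      obtain w where w: "w \<in> ball e0 rR" "\<psi> y \<otimes> s = \<psi> w"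
        using supp_inD[OF F(2) _ nz] s yD by blast
      obtain y' where y': "y' \<in> ?S" "\<psi> w \<otimes> inv s = \<psi> y'" using key[OF w(1)] by blast
      have "\<psi> y = \<psi> y'" unfolding y'(2)[symmetric] w(2)[symmetric] using yD s by (simp add: m_assoc)
      then have "y = y'" using phi_psi yD(1) y'(1) rQ(3) by (metis IntD1 subsetD)
      then show False using y' y(2) by blast
    qed
  qed (rule F(1))
  then show ?thesis by (simp add: s_def)
qed

text \<open>The integrand \<open>F (\<psi> y \<otimes> \<psi> z)\<close> is smooth for all \<open>y\<close> and \<open>z\<close> in the chart, so one can differentiate in \<open>z\<close>
  under the integral sign.\<close>

lemma integ_right_derivative:
  assumes F: "smooth_fun X F"
  shows "((\<lambda>t. integ (\<lambda>x. F (x \<otimes> \<psi> (e0 + t *\<^sub>R c)))) has_real_derivative integ (lder (dvec c) F)) (at 0)"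
proof -
  let ?FF = "\<lambda>(y, z). F (\<one> \<otimes> \<psi> y \<otimes> \<psi> z)"
  have oDD: "open (D \<times> D)" by (intro open_Times open_D)
  note sm = smooth_on_DD[OF F one_closed]
  obtain \<epsilon> where \<epsilon>: "\<epsilon> > 0" "\<And>t. \<bar>t\<bar> < \<epsilon> \<Longrightarrow> e0 + t *\<^sub>R c \<in> D"
  proof -
    have "open ((\<lambda>t. e0 + t *\<^sub>R c) -` D)"
      by (rule open_vimage[OF open_D]) (auto intro!: continuous_intros)
    moreover have "0 \<in> (\<lambda>t. e0 + t *\<^sub>R c) -` D" using e0_D by simp
    ultimately obtain e where "e > 0" "ball 0 e \<subseteq> (\<lambda>t. e0 + t *\<^sub>R c) -` D"
      using open_contains_ball by blast
    then show ?thesis by (intro that[of e]) (auto simp: subset_iff dist_norm)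
  qed
  let ?I = "{-\<epsilon><..<\<epsilon>}"
  let ?f = "\<lambda>t y. F (\<psi> y \<otimes> \<psi> (e0 + t *\<^sub>R c)) * rho y"
  let ?g = "\<lambda>t y. frechet_derivative ?FF (at (y, e0 + t *\<^sub>R c)) (0, c) * rho y"
  have in_D: "e0 + t *\<^sub>R c \<in> D" if "t \<in> ?I" for t using \<epsilon>(2)[of t] that by auto
  have "((\<lambda>t. integral Q (?f t)) has_field_derivative integral Q (?g 0)) (at 0 within ?I)"
  proof (rule leibniz_rule_field_derivative)
    fix t y assume t: "t \<in> ?I" and y: "y \<in> Q"
    have yD: "y \<in> D" using y Q(1) by blast
    have zD: "e0 + t *\<^sub>R c \<in> D" using in_D[OF t] .
    have "((\<lambda>t. (y, e0 + t *\<^sub>R c)) has_derivative (\<lambda>v. (0, v *\<^sub>R c))) (at t)"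
      by (auto intro!: derivative_eq_intros)
    from has_derivative_compose[OF this smooth_on_has_derivative[OF oDD sm]]
    have "((\<lambda>t. ?FF (y, e0 + t *\<^sub>R c)) has_derivative (\<lambda>v. frechet_derivative ?FF (at (y, e0 + t *\<^sub>R c)) (0, v *\<^sub>R c))) (at t)"
      using yD zD by simp
    moreover have "frechet_derivative ?FF (at (y, e0 + t *\<^sub>R c)) (0, v *\<^sub>R c) =
        frechet_derivative ?FF (at (y, e0 + t *\<^sub>R c)) (0, c) * v" for v
      using linear_cmul[OF linear_frechet_smooth_on[OF oDD sm, of "(y, e0 + t *\<^sub>R c)"], of v "(0, c)"] yD zD
      by (simp add: mult.commute)
    ultimately have "((\<lambda>t. ?FF (y, e0 + t *\<^sub>R c)) has_field_derivative frechet_derivative ?FF (at (y, e0 + t *\<^sub>R c)) (0, c)) (at t)"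
      by (simp add: has_field_derivative_def)
    from DERIV_cmult_right[OF this, of "rho y"]
    have "((\<lambda>t. ?FF (y, e0 + t *\<^sub>R c) * rho y) has_field_derivative ?g t y) (at t)" .
    then show "((\<lambda>t. ?f t y) has_field_derivative ?g t y) (at t within ?I)"
      using psi_carrier[OF yD] by (simp add: has_field_derivative_at_within)
  next
    fix t assume t: "t \<in> ?I"
    show "?f t integrable_on Q"
      using integrand_integrable[OF smooth_fun_right[OF F psi_carrier[OF in_D[OF t]]]] .
  next
    have "continuous_on (?I \<times> Q) (\<lambda>p. frechet_derivative ?FF (at (snd p, e0 + fst p *\<^sub>R c)) (0, c))"
      by (rule continuous_on_compose2[OF smooth_on_continuous[OF smooth_on_frechet_derivative[OF sm]]])
        (use in_D Q(1) in \<open>auto intro!: continuous_intros\<close>)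
    moreover have "continuous_on (?I \<times> Q) (\<lambda>p. rho (snd p))"
      by (rule continuous_on_compose2[OF rho_continuous]) (use Q(1) in \<open>auto intro!: continuous_intros\<close>)
    ultimately show "continuous_on (?I \<times> Q) (\<lambda>(t, y). ?g t y)"
      by (simp add: case_prod_unfold continuous_on_mult)
  qed (use \<epsilon>(1) in auto)
  moreover have "integral Q (?g 0) = integ (lder (dvec c) F)"
    unfolding integ_def
  proof (rule integral_cong)
    fix y assume "y \<in> Q"
    then have y: "y \<in> D" using Q(1) by blast
    show "?g 0 y = lder (dvec c) F (\<psi> y) * rho y"
      using lder_dvec_DD[OF F one_closed y, of c] psi_carrier[OF y] by simp
  qed
  ultimately show ?thesis
    using \<epsilon>(1) by (simp add: integ_def at_within_open[of _ ?I])
qed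

definition fbump :: "real \<Rightarrow> 'a \<Rightarrow> real" where "fbump r = bump_ext r (\<lambda>x. 1)"

lemma fbump:
  assumes "r > 0" "ball e0 r \<subseteq> D"
  shows "smooth_fun X (fbump r)" "supp_in r (fbump r)" "fbump r x \<ge> 0" "fbump r \<one> = 1"
    "y \<in> ball e0 (r/3) \<Longrightarrow> fbump r (\<psi> y) = 1"
proof -
  show "smooth_fun X (fbump r)" unfolding fbump_def by (rule smooth_bump_ext[OF assms smooth_on_const])
  show "supp_in r (fbump r)" unfolding fbump_def by (rule supp_bump_ext[OF assms(2)])
  show "fbump r x \<ge> 0" by (simp add: fbump_def bump_ext_def bump_nonneg)
  show p: "fbump r (\<psi> y) = 1" if "y \<in> ball e0 (r/3)" for y
    unfolding fbump_def using bump_ext_plateau[OF assms that] by simp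
  show "fbump r \<one> = 1" using p[of e0] assms(1) by (simp add: psi_e0)
qed

text \<open>The constant divergence, up to sign, of the left-invariant field \<open>u\<close>. The denominator is positive; that the
  choice of the test function does not matter is the content of \<open>integ_lder\<close>.\<close>

definition divg :: "'a tvec \<Rightarrow> real" where
  "divg u = integ (lder u (fbump rR)) / integ (fbump rR)"

text \<open>By \<open>integ_right\<close>, the right translation by \<open>s\<close> divides the integrals of \<open>F\<close> and of the test function by the same number
  \<open>modulus s\<close>. So the ratio of the two integrals does not depend on \<open>s\<close>, and its derivative at the
  identity vanishes.\<close>

lemma integ_lder:
  assumes F: "smooth_fun X F" "supp_in rR F" and u: "u \<in> \<gg>"
  shows "integ (lder u F) = divg u * integ F"
proof -
  let ?F0 = "fbump rR"
  note F0 = fbump[OF rR(1,3)]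
  have pos: "integ ?F0 > 0" by (rule integ_pos[OF F0(1,3)]) (simp add: F0(4))
  define c where "c = coordv u"
  have c: "dvec c = u" unfolding c_def by (rule dvec_coordv[OF u])
  let ?\<Phi> = "\<lambda>F t. integ (\<lambda>x. F (x \<otimes> \<psi> (e0 + t *\<^sub>R c)))"
  have "((\<lambda>t. ?\<Phi> F t * integ ?F0) has_real_derivative integ (lder u F) * integ ?F0) (at 0)"
    using DERIV_cmult_right[OF integ_right_derivative[OF F(1), of c]] c by simp
  moreover have "((\<lambda>t. ?\<Phi> ?F0 t * integ F) has_real_derivative integ (lder u ?F0) * integ F) (at 0)"
    using DERIV_cmult_right[OF integ_right_derivative[OF F0(1), of c]] c by simp
  then have "((\<lambda>t. ?\<Phi> F t * integ ?F0) has_real_derivative integ (lder u ?F0) * integ F) (at 0)"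
  proof (rule has_field_derivative_transform_within_open)
    show "open ((\<lambda>t. e0 + t *\<^sub>R c) -` ball e0 rR)"
      by (rule open_vimage[OF open_ball]) (auto intro!: continuous_intros)
    show "0 \<in> (\<lambda>t. e0 + t *\<^sub>R c) -` ball e0 rR" using rR(1) by simp
    fix t assume "t \<in> (\<lambda>t. e0 + t *\<^sub>R c) -` ball e0 rR"
    then have t: "e0 + t *\<^sub>R c \<in> ball e0 rR" by simp
    show "?\<Phi> ?F0 t * integ F = ?\<Phi> F t * integ ?F0"
      using integ_right[OF F t] integ_right[OF F0(1,2) t] by (simp add: mult.assoc mult.left_commute)
  qed
  ultimately have "integ (lder u F) * integ ?F0 = integ (lder u ?F0) * integ F"
    by (rule DERIV_unique)
  then show ?thesis using pos by (simp add: divg_def field_simps)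
qed

end

section \<open>The invariant mean on a compact quotient\<close>

locale lie_lattice = lie_quotient G X U \<phi> \<Gamma> + lie_chart_cart G X U \<phi>
  for G :: "('a, 'b) monoid_scheme" (structure) and X :: "('a, real^'n::{finite,wellorder}) mfd"
    and U :: "'a set" and \<phi> :: "'a \<Rightarrow> real^'n::{finite,wellorder}" and \<Gamma> :: "'a set" +
  assumes compact_N: "compact_space (mtop (quotient_mfd G X \<Gamma>))"
begin

lemma pi_image_open:
  assumes g: "g \<in> carrier G" and r: "ball e0 r \<subseteq> D"
  shows "openin (mtop N) ((\<lambda>z. \<pi> (g \<otimes> \<psi> z)) ` ball e0 r)"
proof -
  have C: "g \<otimes> \<psi> z \<in> carrier G" if "z \<in> ball e0 r" for z using that g r psi_carrier by blast
  then have sub: "(\<lambda>z. \<pi> (g \<otimes> \<psi> z)) ` ball e0 r \<subseteq> (\<lambda>g. \<pi> g) ` topspace T" unfolding points_X by blast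
  have "{x \<in> topspace T. \<pi> x \<in> (\<lambda>z. \<pi> (g \<otimes> \<psi> z)) ` ball e0 r} =
      (\<Union>\<gamma>\<in>\<Gamma>. (\<lambda>z. (\<gamma> \<otimes> g) \<otimes> \<psi> z) ` ball e0 r)" (is "?L = ?R")
  proof (rule subset_antisym)
    show "?L \<subseteq> ?R"
    proof
      fix x assume "x \<in> ?L"
      then obtain z where z: "x \<in> carrier G" "z \<in> ball e0 r" "\<pi> x = \<pi> (g \<otimes> \<psi> z)" unfolding points_X by blast
      then obtain \<gamma> where \<gamma>: "\<gamma> \<in> \<Gamma>" "x = \<gamma> \<otimes> (g \<otimes> \<psi> z)" using pi_eq_iff[OF z(1) C[OF z(2)]] by blast
      have "x = (\<gamma> \<otimes> g) \<otimes> \<psi> z" using \<gamma> g z(2) r psi_carrier Gamma_carrier by (simp add: m_assoc subset_iff)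
      then show "x \<in> ?R" using \<gamma>(1) z(2) by blast
    qed
    show "?R \<subseteq> ?L"
    proof
      fix x assume "x \<in> ?R"
      then obtain \<gamma> z where \<gamma>: "\<gamma> \<in> \<Gamma>" "z \<in> ball e0 r" "x = (\<gamma> \<otimes> g) \<otimes> \<psi> z" by blast
      have gc: "\<gamma> \<in> carrier G" "\<psi> z \<in> carrier G" using \<gamma> Gamma_carrier r psi_carrier by blast+
      have e: "x = \<gamma> \<otimes> (g \<otimes> \<psi> z)" "x \<in> carrier G" using \<gamma>(3) gc g by (simp_all add: m_assoc)
      then have "\<pi> x = \<pi> (g \<otimes> \<psi> z)" using pi_eq_iff[OF e(2) C[OF \<gamma>(2)]] \<gamma>(1) by blast
      then show "x \<in> ?L" using e(2) \<gamma>(2) unfolding points_X by blast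
    qed
  qed
  moreover have "openin T ?R"
    by (rule openin_Union) (use translated_ball_open[OF _ r] g Gamma_carrier in auto)
  ultimately have "openin T {x \<in> topspace T. \<pi> x \<in> (\<lambda>z. \<pi> (g \<otimes> \<psi> z)) ` ball e0 r}" by simp
  with sub show ?thesis unfolding mtop_N by (intro iffD2[OF openin_quotient_topology] conjI)
qed

definition rad :: "'a \<Rightarrow> real" where "rad g = (SOME r. adapted g r \<and> r \<le> rR)"

lemma rad:
  assumes "g \<in> carrier G"
  shows "adapted g (rad g)" "rad g \<le> rR" "rad g > 0" "ball e0 (rad g) \<subseteq> D"
proof -
  obtain s where s: "adapted g s" using ex_adapted assms by blast
  have "adapted g (min s rR) \<and> min s rR \<le> rR" using adapted_mono[OF s, of "min s rR"] adaptedD(1)[OF s] rR(1) by simp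
  then have "adapted g (rad g) \<and> rad g \<le> rR" unfolding rad_def by (rule someI)
  then show "adapted g (rad g)" "rad g \<le> rR" "rad g > 0" "ball e0 (rad g) \<subseteq> D" using adaptedD by blast+
qed

text \<open>Centres of finitely many translated charts. The functions \<open>B g\<close> below are bumps of radius \<open>rad g / 3\<close>, so they
  equal \<open>1\<close> on the balls of radius \<open>rad g / 9\<close>, which still have to cover the quotient.\<close>

definition nodes :: "'a set" where
  "nodes = (SOME A. finite A \<and> A \<subseteq> carrier G \<and>
     points N \<subseteq> (\<Union>g\<in>A. (\<lambda>z. \<pi> (g \<otimes> \<psi> z)) ` ball e0 (rad g / 9)))"

lemma nodes: "finite nodes" "nodes \<subseteq> carrier G"
  "points N \<subseteq> (\<Union>g\<in>nodes. (\<lambda>z. \<pi> (g \<otimes> \<psi> z)) ` ball e0 (rad g / 9))"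
proof -
  let ?O = "\<lambda>g. (\<lambda>z. \<pi> (g \<otimes> \<psi> z)) ` ball e0 (rad g / 9)"
  let ?P = "\<lambda>A. finite A \<and> A \<subseteq> carrier G \<and> points N \<subseteq> (\<Union>g\<in>A. ?O g)"
  have op: "W \<in> ?O ` carrier G \<Longrightarrow> openin (mtop N) W" for W
  proof -
    assume "W \<in> ?O ` carrier G"
    then have "\<exists>g\<in>carrier G. W = ?O g" by (simp only: image_iff)
    then obtain g where g: "g \<in> carrier G" "W = ?O g" by (elim bexE)
    have "ball e0 (rad g / 9) \<subseteq> ball e0 (rad g)" by (rule subset_ball) (use rad(3)[OF g(1)] in simp)
    then show ?thesis unfolding g(2) using rad(4)[OF g(1)] by (intro pi_image_open[OF g(1)]) blast
  qed
  have cov: "points N \<subseteq> \<Union> (?O ` carrier G)"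
  proof
    fix p assume "p \<in> points N"
    then obtain g where g: "g \<in> carrier G" "p = \<pi> g" by (rule points_N_E)
    then have "p \<in> ?O g" using rad(3)[OF g(1)] by (intro image_eqI[of _ _ e0]) (auto simp: psi_e0)
    then show "p \<in> \<Union> (?O ` carrier G)" using g(1) by blast
  qed
  have "\<exists>\<F>. finite \<F> \<and> \<F> \<subseteq> ?O ` carrier G \<and> points N \<subseteq> \<Union>\<F>"
    by (rule compactinD[OF compact_N[unfolded compact_space_def] _ cov]) (rule op)
  then obtain \<F> where \<F>: "finite \<F>" "\<F> \<subseteq> ?O ` carrier G" "points N \<subseteq> \<Union>\<F>"
    by (elim exE conjE)
  then obtain A where A: "A \<subseteq> carrier G" "finite A" "\<F> = ?O ` A"
    using finite_subset_image[OF \<F>(1,2)] by (elim exE conjE)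
  have "?P A" using A \<F>(3) by simp
  then have "?P nodes" unfolding nodes_def by (rule someI)
  then show "finite nodes" "nodes \<subseteq> carrier G" "points N \<subseteq> (\<Union>g\<in>nodes. ?O g)" by blast+
qed

text \<open>The function \<open>C g\<close> is \<open>1\<close> on the support of \<open>B g\<close>. Writing \<open>B g = B g * C g\<close> shows by the product rule that
  derivatives of \<open>B g\<close> vanish wherever both functions do.\<close>

abbreviation "B g \<equiv> fbump (rad g / 3)"
abbreviation "C g \<equiv> fbump (rad g)"

lemma node_carrier: "g \<in> nodes \<Longrightarrow> g \<in> carrier G" using nodes(2) by blast

lemma node_bump:
  assumes "g \<in> nodes"
  shows "smooth_fun X (B g)" "supp_in (rad g) (B g)" "B g x \<ge> 0" "B g \<one> = 1"
    "y \<in> ball e0 (rad g / 9) \<Longrightarrow> B g (\<psi> y) = 1" "supp_in (rad g / 3) (B g)"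
proof -
  note r = rad[OF node_carrier[OF assms]]
  have 0: "rad g / 3 > 0" "ball e0 (rad g / 3) \<subseteq> D"
    using r(3) r(4) subset_ball[of "rad g / 3" "rad g" e0] by auto
  note b = fbump[OF 0]
  show "smooth_fun X (B g)" "B g x \<ge> 0" "B g \<one> = 1" "supp_in (rad g / 3) (B g)" using b by auto
  show "supp_in (rad g) (B g)" by (rule supp_in_mono[OF b(2)]) (use r(3) in simp)
  show "y \<in> ball e0 (rad g / 9) \<Longrightarrow> B g (\<psi> y) = 1" using b(5)[of y] by simp
qed

lemma B_C:
  assumes "g \<in> nodes" "x \<in> carrier G" shows "B g x = B g x * C g x"
proof (cases "B g x = 0")
  case False
  then obtain y where "y \<in> ball e0 (rad g / 3)" "x = \<psi> y" using supp_inD[OF node_bump(6)[OF assms(1)] assms(2)] by blast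
  then show ?thesis using fbump(5)[OF rad(3,4)[OF node_carrier[OF assms(1)]]] by simp
qed simp

lemma node_cutoff: "g \<in> nodes \<Longrightarrow> smooth_fun X (C g)" "g \<in> nodes \<Longrightarrow> supp_in (rad g) (C g)"
  using fbump[OF rad(3,4)[OF node_carrier]] by blast+

lemma supp_lder_B:
  assumes g: "g \<in> nodes" and u: "u \<in> \<gg>" shows "supp_in (rad g) (lder u (B g))"
  unfolding supp_in_def
proof (intro ballI impI, rule ccontr)
  fix x assume x: "x \<in> carrier G" and nz: "lder u (B g) x \<noteq> 0" and out: "x \<notin> \<psi> ` ball e0 (rad g)"
  have 0: "B g x = 0" "C g x = 0" using node_bump(2)[OF g] node_cutoff(2)[OF g] x out unfolding supp_in_def by blast+
  have "lder u (B g) x = lder u (\<lambda>x. B g x * C g x) x"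
    by (rule lder_cong[OF u node_bump(1)[OF g] B_C[OF g] x])
  also have "\<dots> = 0" using lder_tangent(2)[OF u node_bump(1)[OF g] node_cutoff(1)[OF g] x] 0 by simp
  finally show False using nz by simp
qed

abbreviation "b g \<equiv> descend g (rad g) (B g)"

lemma smooth_b: "g \<in> nodes \<Longrightarrow> smooth_fun N (b g)"
  by (rule smooth_descend[OF rad(1)[OF node_carrier] node_carrier node_bump(1,2)])

text \<open>Near a point that is covered by the chart at \<open>g\<close> both sides are the same derivative. At other points the bump
  and its derivatives vanish, again by the factorisation of \<open>B g\<close>.\<close>

lemma descend_lder:
  assumes g: "g \<in> nodes" and u: "u \<in> \<gg>" and p: "p \<in> points N"
  shows "fr p u (b g) = descend g (rad g) (lder u (B g)) p"
proof -
  note gC = node_carrier[OF g]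
  note r = rad[OF gC]
  obtain h where h: "h \<in> carrier G" "p = \<pi> h" using points_N_E[OF p] by blast
  show ?thesis
  proof (cases "\<exists>z\<in>ball e0 (rad g). p = \<pi> (g \<otimes> \<psi> z)")
    case True
    then obtain z where z: "z \<in> ball e0 (rad g)" "p = \<pi> (g \<otimes> \<psi> z)" by blast
    have zC: "z \<in> D" "\<psi> z \<in> carrier G" "\<psi> z \<in> U" "g \<otimes> \<psi> z \<in> carrier G" using z(1) r(4) psi_carrier psi_U gC by blast+
    have o: "open (ltrans_dom (\<psi> z) \<inter> ltrans (\<psi> z) -` ball e0 (rad g))" by (rule open_ltrans_preimage[OF zC(2) open_ball])
    have "e0 \<in> ltrans_dom (\<psi> z) \<inter> ltrans (\<psi> z) -` ball e0 (rad g)"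
      using ltrans_e0[OF zC(3)] phi_psi[OF zC(1)] z(1) by simp
    then obtain s where s: "s > 0" "ball e0 s \<subseteq> ltrans_dom (\<psi> z) \<inter> ltrans (\<psi> z) -` ball e0 (rad g)" using o openE by blast
    have "fr p u (b g) = u (\<lambda>x. b g (\<pi> (g \<otimes> \<psi> z \<otimes> x)))"
      unfolding z(2) by (rule frame_apply[OF zC(4) u smooth_b[OF g]])
    also have "\<dots> = u (\<lambda>x. B g (\<psi> z \<otimes> x))"
    proof (rule tangent_local_X[OF u smooth_pullback[OF zC(4) smooth_b[OF g]] smooth_fun_left[OF node_bump(1)[OF g] zC(2)] s(1)])
      fix w assume w: "w \<in> ball e0 s"
      have l: "w \<in> ltrans_dom (\<psi> z)" "ltrans (\<psi> z) w \<in> ball e0 (rad g)" using s(2) w by blast+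
      then have "\<psi> w \<in> carrier G" using psi_carrier by (auto simp: ltrans_dom_def)
      then have "g \<otimes> \<psi> z \<otimes> \<psi> w = g \<otimes> \<psi> (ltrans (\<psi> z) w)" using ltrans_D(2)[OF l(1)] gC zC by (simp add: m_assoc)
      then show "b g (\<pi> (g \<otimes> \<psi> z \<otimes> \<psi> w)) = B g (\<psi> z \<otimes> \<psi> w)"
        using descend_at[OF r(1) gC l(2)] ltrans_D(2)[OF l(1)] by simp
    qed
    also have "\<dots> = descend g (rad g) (lder u (B g)) p"
      unfolding z(2) descend_at[OF r(1) gC z(1)] by (simp add: lder_def)
    finally show ?thesis .
  next
    case False
    let ?c = "descend g (rad g) (C g)"
    have sc: "smooth_fun N ?c" by (rule smooth_descend[OF r(1) gC node_cutoff[OF g]])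
    have bc: "b g q = b g q * ?c q" for q
    proof (cases "\<exists>z\<in>ball e0 (rad g). q = \<pi> (g \<otimes> \<psi> z)")
      case True
      then obtain z where z: "z \<in> ball e0 (rad g)" "q = \<pi> (g \<otimes> \<psi> z)" by blast
      then have "\<psi> z \<in> carrier G" using r(4) psi_carrier by blast
      then show ?thesis unfolding z(2) descend_at[OF r(1) gC z(1)] by (rule B_C[OF g])
    qed (simp add: descend_def)
    have "fr p u (b g) = fr p u (\<lambda>q. b g q * ?c q)" using bc by (metis (no_types, lifting) ext)
    also have "\<dots> = 0"
      using tangent_mult[OF frame_tangent[OF p u] smooth_b[OF g] sc] False by (simp add: descend_def)
    finally show ?thesis using False by (simp add: descend_def)
  qed
qed

lemma descend_swap_zero:
  assumes k: "k \<in> carrier G" and l: "l \<in> carrier G"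
    and A: "supp_in (rad k) A"
    and no: "\<not> (\<exists>\<gamma>\<in>\<Gamma>. \<exists>a\<in>ball e0 (rad k). \<exists>z\<in>ball e0 (rad l). k \<otimes> \<psi> a = \<gamma> \<otimes> (l \<otimes> \<psi> z))"
    and x: "x \<in> carrier G"
  shows "A x * descend l (rad l) A' (\<pi> (k \<otimes> x)) = 0"
proof (rule ccontr)
  assume nz: "A x * descend l (rad l) A' (\<pi> (k \<otimes> x)) \<noteq> 0"
  then obtain a where a: "a \<in> ball e0 (rad k)" "x = \<psi> a" using supp_inD[OF A x] by auto
  obtain z where z: "z \<in> ball e0 (rad l)" "\<pi> (k \<otimes> x) = \<pi> (l \<otimes> \<psi> z)" using nz descend_nonzero by (metis mult_zero_right)
  have "l \<otimes> \<psi> z \<in> carrier G" using z(1) rad(4)[OF l] psi_carrier l by blast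
  then show False using pi_eq_iff[of "k \<otimes> x" "l \<otimes> \<psi> z"] z a k x no by blast
qed

text \<open>Both sides integrate the product of \<open>q\<close> with the functions descending from \<open>A\<close> and \<open>A'\<close>, once in the chart at \<open>k\<close>
  and once in the chart at \<open>l\<close>. As the radii are adapted, the two charts are related by a single left
  translation on the supports, and \<open>integ\<close> is invariant under it. The uniqueness comes from whichever of the
  two radii is larger, since all points lie in the ball with that radius.\<close>

lemma integ_swap:
  assumes k: "k \<in> nodes" and l: "l \<in> nodes"
    and A: "smooth_fun X A" "supp_in (rad k) A" and A': "smooth_fun X A'" "supp_in (rad l) A'"
    and q: "smooth_fun N q"
  shows "integ (\<lambda>x. A x * (descend l (rad l) A' (\<pi> (k \<otimes> x)) * q (\<pi> (k \<otimes> x)))) =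
    integ (\<lambda>x. A' x * (descend k (rad k) A (\<pi> (l \<otimes> x)) * q (\<pi> (l \<otimes> x))))"
proof -
  note kC = node_carrier[OF k] and lC = node_carrier[OF l]
  note rk = rad[OF kC] and rl = rad[OF lC]
  let ?F1 = "\<lambda>x. A x * (descend l (rad l) A' (\<pi> (k \<otimes> x)) * q (\<pi> (k \<otimes> x)))"
  let ?F2 = "\<lambda>x. A' x * (descend k (rad k) A (\<pi> (l \<otimes> x)) * q (\<pi> (l \<otimes> x)))"
  show ?thesis
  proof (cases "\<exists>\<gamma>\<in>\<Gamma>. \<exists>a\<in>ball e0 (rad k). \<exists>z\<in>ball e0 (rad l). k \<otimes> \<psi> a = \<gamma> \<otimes> (l \<otimes> \<psi> z)")
    case False
    have False': "\<not> (\<exists>\<gamma>\<in>\<Gamma>. \<exists>a\<in>ball e0 (rad l). \<exists>z\<in>ball e0 (rad k). l \<otimes> \<psi> a = \<gamma> \<otimes> (k \<otimes> \<psi> z))"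
    proof
      assume "\<exists>\<gamma>\<in>\<Gamma>. \<exists>a\<in>ball e0 (rad l). \<exists>z\<in>ball e0 (rad k). l \<otimes> \<psi> a = \<gamma> \<otimes> (k \<otimes> \<psi> z)"
      then obtain \<gamma> a z where g: "\<gamma> \<in> \<Gamma>" "a \<in> ball e0 (rad l)" "z \<in> ball e0 (rad k)" "l \<otimes> \<psi> a = \<gamma> \<otimes> (k \<otimes> \<psi> z)" by blast
      have "\<psi> z \<in> carrier G" using g(3) rk(4) psi_carrier by blast
      then have "k \<otimes> \<psi> z = inv \<gamma> \<otimes> (l \<otimes> \<psi> a)" unfolding g(4) using kC Gamma_carrier[OF g(1)] by (simp add: inv_cancel_left)
      then show False using False g subgroup.m_inv_closed[OF Gamma g(1)] by blast
    qed
    have "integ ?F1 = integ (\<lambda>x. 0)"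
      using descend_swap_zero[OF kC lC A(2) False, of _ A'] by (intro integ_cong) (simp add: mult.assoc[symmetric])
    moreover have "integ ?F2 = integ (\<lambda>x. 0)"
      using descend_swap_zero[OF lC kC A'(2) False', of _ A] by (intro integ_cong) (simp add: mult.assoc[symmetric])
    ultimately show ?thesis by simp
  next
    case True
    then obtain \<gamma> a z where g: "\<gamma> \<in> \<Gamma>" "a \<in> ball e0 (rad k)" "z \<in> ball e0 (rad l)" "k \<otimes> \<psi> a = \<gamma> \<otimes> (l \<otimes> \<psi> z)" by blast
    have \<gamma>C: "\<gamma> \<in> carrier G" using g(1) Gamma_carrier by blast
    have uniq: "\<gamma>' = \<gamma>"
      if "\<gamma>' \<in> \<Gamma>" "a' \<in> ball e0 (rad k)" "z' \<in> ball e0 (rad l)" "k \<otimes> \<psi> a' = \<gamma>' \<otimes> (l \<otimes> \<psi> z')" for \<gamma>' a' z'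
    proof (cases "rad k \<le> rad l")
      case True
      then have "ball e0 (rad k) \<subseteq> ball e0 (rad l)" by (rule subset_ball)
      then show ?thesis using adapted_single[OF rl(1) lC kC _ _ _ _ that(1) g(1) that(4) g(4)] that(2,3) g(2,3) by blast
    next
      case False
      then have "ball e0 (rad l) \<subseteq> ball e0 (rad k)" by (intro subset_ball) simp
      then show ?thesis using adapted_single'[OF rk(1) lC kC _ _ _ _ that(1) g(1) that(4) g(4)] that(2,3) g(2,3) by blast
    qed
    \<comment> \<open>The left translation by \<open>h\<close> is the change from the chart at \<open>k\<close> to the chart at \<open>l\<close>.\<close>
    define h where "h = inv (\<gamma> \<otimes> l) \<otimes> k"
    have hC: "h \<in> carrier G" unfolding h_def using \<gamma>C lC kC by simp
    have F1: "?F1 x = A x * (A' (h \<otimes> x) * q (\<pi> (k \<otimes> x)))" if x: "x \<in> carrier G" for x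
    proof (cases "A x = 0")
      case False
      then obtain a' where a': "a' \<in> ball e0 (rad k)" "x = \<psi> a'" using supp_inD[OF A(2) x] by blast
      have "descend l (rad l) A' (\<pi> (k \<otimes> \<psi> a')) = A' (inv (\<gamma> \<otimes> l) \<otimes> (k \<otimes> \<psi> a'))"
        by (rule descend_translate[OF rl(1) lC kC A'(2) g(1)]) (use x a' kC uniq in auto)
      then show ?thesis using a' x kC lC \<gamma>C by (simp add: h_def m_assoc)
    qed simp
    have inv_h: "inv h = inv (inv \<gamma> \<otimes> k) \<otimes> l" unfolding h_def using \<gamma>C lC kC by (simp add: inv_mult_group m_assoc)
    have F2: "?F2 x = A' x * (A (inv h \<otimes> x) * q (\<pi> (l \<otimes> x)))" if x: "x \<in> carrier G" for x
    proof (cases "A' x = 0")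
      case False
      then obtain z' where z': "z' \<in> ball e0 (rad l)" "x = \<psi> z'" using supp_inD[OF A'(2) x] by blast
      have "descend k (rad k) A (\<pi> (l \<otimes> \<psi> z')) = A (inv (inv \<gamma> \<otimes> k) \<otimes> (l \<otimes> \<psi> z'))"
      proof (rule descend_translate[OF rk(1) kC lC A(2) subgroup.m_inv_closed[OF Gamma g(1)]])
        show "l \<otimes> \<psi> z' \<in> carrier G" using x z' lC by simp
        fix \<gamma>'' a'' assume s: "\<gamma>'' \<in> \<Gamma>" "a'' \<in> ball e0 (rad k)" "l \<otimes> \<psi> z' = \<gamma>'' \<otimes> (k \<otimes> \<psi> a'')"
        have sC: "\<psi> a'' \<in> carrier G" "\<gamma>'' \<in> carrier G" using s rk(4) psi_carrier Gamma_carrier by blast+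
        have "k \<otimes> \<psi> a'' = inv \<gamma>'' \<otimes> (l \<otimes> \<psi> z')" unfolding s(3) using sC kC by (simp add: inv_cancel_left)
        then have "inv \<gamma>'' = \<gamma>" using uniq[OF subgroup.m_inv_closed[OF Gamma s(1)] s(2) z'(1)] by simp
        then show "\<gamma>'' = inv \<gamma>" using sC by (metis inv_inv)
      qed
      then show ?thesis using z' x kC lC \<gamma>C inv_h by (simp add: m_assoc)
    qed simp
    have eq: "?F2 (h \<otimes> x) = ?F1 x" if x: "x \<in> carrier G" for x
    proof -
      have hx: "h \<otimes> x \<in> carrier G" using hC x by simp
      have "l \<otimes> (h \<otimes> x) = inv \<gamma> \<otimes> (k \<otimes> x)"
        unfolding h_def using \<gamma>C lC kC x by (simp add: inv_mult_group m_assoc inv_cancel_left)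
      then have "\<pi> (l \<otimes> (h \<otimes> x)) = \<pi> (k \<otimes> x)"
        using iffD2[OF pi_eq_iff[OF m_closed[OF lC hx] m_closed[OF kC x]]] subgroup.m_inv_closed[OF Gamma g(1)] by blast
      then show ?thesis
        unfolding F2[OF hx] F1[OF x] using hC x by (simp add: inv_cancel_left)
    qed
    have s2: "smooth_fun X ?F2"
      by (intro smooth_fun_mult open_charts_X A' smooth_pullback[OF lC] smooth_descend[OF rk(1) kC A] q)
    have "supp_in rQ ?F2" by (rule supp_in_mono[OF supp_mult[OF A'(2)]]) (use rl(2) rR(2) in linarith)
    moreover have "supp_in rQ (\<lambda>x. ?F2 (h \<otimes> x))"
    proof -
      have "supp_in rQ ?F1" by (rule supp_in_mono[OF supp_mult[OF A(2)]]) (use rk(2) rR(2) in linarith)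
      then show ?thesis unfolding supp_in_def using eq by auto
    qed
    ultimately have "integ (\<lambda>x. ?F2 (h \<otimes> x)) = integ ?F2" by (intro integ_left[OF s2 _ hC])
    moreover have "integ (\<lambda>x. ?F2 (h \<otimes> x)) = integ ?F1" by (rule integ_cong[OF eq])
    ultimately show ?thesis by simp
  qed
qed

text \<open>The functions \<open>b g p / bsum p\<close> form a partition of unity.\<close>

definition bsum :: "'a set \<Rightarrow> real" where "bsum p = (\<Sum>g\<in>nodes. b g p)"

lemma b_nonneg: "g \<in> nodes \<Longrightarrow> b g p \<ge> 0"
  using node_bump(3) by (simp add: descend_def)

lemma bsum_pos: assumes p: "p \<in> points N" shows "bsum p > 0"
proof -
  obtain g z where g: "g \<in> nodes" "z \<in> ball e0 (rad g / 9)" "p = \<pi> (g \<otimes> \<psi> z)" using nodes(3) p by blast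
  note r = rad[OF node_carrier[OF g(1)]]
  have "z \<in> ball e0 (rad g)" using g(2) r(3) by auto
  then have "b g p = 1" unfolding g(3) using descend_at[OF r(1) node_carrier[OF g(1)]] node_bump(5)[OF g(1,2)] by simp
  then show ?thesis unfolding bsum_def using g(1) nodes(1) b_nonneg by (intro sum_pos2[of _ g]) auto
qed

lemma smooth_bsum: "smooth_fun N bsum"
  unfolding bsum_def by (rule smooth_fun_sum[OF open_charts_N smooth_b])

lemma charts_N_points: "(A, \<kappa>) \<in> charts N \<Longrightarrow> p \<in> A \<Longrightarrow> p \<in> points N"
proof -
  assume "(A, \<kappa>) \<in> charts N" and p: "p \<in> A"
  then obtain V where V: "A = (\<lambda>g. \<pi> g) ` V" "openin T V" unfolding charts_N by blast
  have "V \<subseteq> carrier G" using openin_subset[OF V(2)] points_X by simp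
  then show "p \<in> points N" using p V(1) points_N by blast
qed

lemma smooth_div_bsum: "smooth_fun N f \<Longrightarrow> smooth_fun N (\<lambda>p. f p / bsum p)"
  by (rule smooth_fun_divide[OF open_charts_N _ smooth_bsum]) (use bsum_pos charts_N_points in \<open>auto simp: less_imp_neq[THEN not_sym]\<close>)

text \<open>The integral of \<open>a * bsum\<close> over the quotient, taken chart by chart. Dividing a function by \<open>bsum\<close> first gives its
  integral.\<close>

definition pre_mean :: "('a set \<Rightarrow> real) \<Rightarrow> real" where
  "pre_mean a = (\<Sum>g\<in>nodes. integ (\<lambda>x. B g x * a (\<pi> (g \<otimes> x))))"

lemma smooth_B_mult: "g \<in> nodes \<Longrightarrow> smooth_fun N a \<Longrightarrow> smooth_fun X (\<lambda>x. B g x * a (\<pi> (g \<otimes> x)))"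
  by (intro smooth_fun_mult open_charts_X node_bump smooth_pullback node_carrier)

lemma pre_mean_add: "smooth_fun N a \<Longrightarrow> smooth_fun N a' \<Longrightarrow> pre_mean (\<lambda>p. a p + a' p) = pre_mean a + pre_mean a'"
  unfolding pre_mean_def sum.distrib[symmetric]
  by (rule sum.cong) (auto simp: distrib_left integ_add smooth_B_mult)

lemma pre_mean_cmult: "pre_mean (\<lambda>p. c * a p) = c * pre_mean a"
  unfolding pre_mean_def sum_distrib_left
  by (rule sum.cong) (auto simp: integ_cmult[symmetric] mult.left_commute)

lemma pre_mean_cong: "(\<And>p. p \<in> points N \<Longrightarrow> a p = a' p) \<Longrightarrow> pre_mean a = pre_mean a'"
  unfolding pre_mean_def
  by (rule sum.cong[OF refl], rule integ_cong) (use pi_points node_carrier in simp)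

text \<open>The left-hand side integrates the derivative of \<open>q * bsum\<^sup>2\<close>, expanded by the product rule. In the chart at \<open>k\<close>,
  \<open>integ_lder\<close> applies to the product of \<open>B k\<close> and \<open>a = q * bsum\<close>. The terms in which \<open>B k\<close> is differentiated are
  distributed over the charts at all \<open>l\<close> by means of \<open>integ_swap\<close>, where their sum over \<open>k\<close> is a derivative of \<open>bsum\<close>.\<close>

lemma pre_mean_frame:
  assumes u: "u \<in> \<gg>" and q: "smooth_fun N q"
  shows "pre_mean (\<lambda>p. fr p u (\<lambda>p. q p * bsum p)) + pre_mean (\<lambda>p. q p * fr p u bsum)
    = divg u * pre_mean (\<lambda>p. q p * bsum p)"
proof -
  let ?a = "\<lambda>p. q p * bsum p"
  have a: "smooth_fun N ?a" by (rule smooth_fun_mult[OF open_charts_N q smooth_bsum])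
  have Ea: "smooth_fun N (\<lambda>p. fr p u ?a)" by (rule smooth_frame_fun[OF u a])
  let ?t = "\<lambda>g. integ (\<lambda>x. lder u (B g) x * ?a (\<pi> (g \<otimes> x)))"
  have sl: "smooth_fun X (\<lambda>x. lder u (B g) x * a' (\<pi> (g \<otimes> x)))" if "g \<in> nodes" "smooth_fun N a'" for g a'
    using that by (intro smooth_fun_mult open_charts_X smooth_lder[OF u node_bump(1)] smooth_pullback node_carrier)
  have 1: "divg u * integ (\<lambda>x. B g x * ?a (\<pi> (g \<otimes> x))) = integ (\<lambda>x. B g x * fr (\<pi> (g \<otimes> x)) u ?a) + ?t g"
    if g: "g \<in> nodes" for g
  proof -
    note gC = node_carrier[OF g]
    have s: "smooth_fun X (\<lambda>x. B g x * ?a (\<pi> (g \<otimes> x)))" by (rule smooth_B_mult[OF g a])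
    have "divg u * integ (\<lambda>x. B g x * ?a (\<pi> (g \<otimes> x))) = integ (lder u (\<lambda>x. B g x * ?a (\<pi> (g \<otimes> x))))"
      by (rule integ_lder[OF s supp_in_mono[OF supp_mult[OF node_bump(2)[OF g]] rad(2)[OF gC]] u, symmetric])
    also have "\<dots> = integ (\<lambda>x. B g x * fr (\<pi> (g \<otimes> x)) u ?a + lder u (B g) x * ?a (\<pi> (g \<otimes> x)))"
    proof (rule integ_cong)
      fix x assume x: "x \<in> carrier G"
      have gx: "g \<otimes> x \<in> carrier G" using gC x by simp
      have "lder u (\<lambda>x. ?a (\<pi> (g \<otimes> x))) x = fr (\<pi> (g \<otimes> x)) u ?a"
        unfolding frame_apply[OF gx u a] lder_def
        by (rule tangent_cong_X[OF u smooth_fun_left[OF smooth_pullback[OF gC a] x]]) (use gC x in \<open>simp add: m_assoc\<close>)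
      then show "lder u (\<lambda>x. B g x * ?a (\<pi> (g \<otimes> x))) x = B g x * fr (\<pi> (g \<otimes> x)) u ?a + lder u (B g) x * ?a (\<pi> (g \<otimes> x))"
        using lder_tangent(2)[OF u node_bump(1)[OF g] smooth_pullback[OF gC a] x] by simp
    qed
    also have "\<dots> = integ (\<lambda>x. B g x * fr (\<pi> (g \<otimes> x)) u ?a) + ?t g"
      by (rule integ_add[OF smooth_B_mult[OF g Ea] sl[OF g a]])
    finally show ?thesis .
  qed
  have 2: "?t k = (\<Sum>l\<in>nodes. integ (\<lambda>x. B l x * (descend k (rad k) (lder u (B k)) (\<pi> (l \<otimes> x)) * q (\<pi> (l \<otimes> x)))))"
    if k: "k \<in> nodes" for k
  proof -
    have s: "smooth_fun X (\<lambda>x. lder u (B k) x * (b l (\<pi> (k \<otimes> x)) * q (\<pi> (k \<otimes> x))))" if "l \<in> nodes" for l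
      by (rule sl[OF k smooth_fun_mult[OF open_charts_N smooth_b[OF that] q]])
    have "?t k = integ (\<lambda>x. \<Sum>l\<in>nodes. lder u (B k) x * (b l (\<pi> (k \<otimes> x)) * q (\<pi> (k \<otimes> x))))"
      by (rule integ_cong) (simp add: bsum_def sum_distrib_left sum_distrib_right mult.commute)
    also have "\<dots> = (\<Sum>l\<in>nodes. integ (\<lambda>x. lder u (B k) x * (b l (\<pi> (k \<otimes> x)) * q (\<pi> (k \<otimes> x)))))"
      by (rule integ_sum[OF s])
    also have "\<dots> = (\<Sum>l\<in>nodes. integ (\<lambda>x. B l x * (descend k (rad k) (lder u (B k)) (\<pi> (l \<otimes> x)) * q (\<pi> (l \<otimes> x)))))"
      by (rule sum.cong[OF refl], rule integ_swap[OF k _ smooth_lder[OF u node_bump(1)[OF k]] supp_lder_B[OF k u] node_bump(1,2) q])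
    finally show ?thesis .
  qed
  have sp: "smooth_fun X (\<lambda>x. B l x * (descend k (rad k) (lder u (B k)) (\<pi> (l \<otimes> x)) * q (\<pi> (l \<otimes> x))))"
    if "k \<in> nodes" "l \<in> nodes" for k l
    using that by (intro smooth_fun_mult open_charts_X node_bump smooth_pullback node_carrier q
      smooth_descend[OF rad(1)[OF node_carrier] node_carrier smooth_lder[OF u node_bump(1)] supp_lder_B[OF _ u]])
  have "(\<Sum>k\<in>nodes. ?t k) = (\<Sum>k\<in>nodes. \<Sum>l\<in>nodes. integ (\<lambda>x. B l x * (descend k (rad k) (lder u (B k)) (\<pi> (l \<otimes> x)) * q (\<pi> (l \<otimes> x)))))"
    by (rule sum.cong[OF refl 2])
  also have "\<dots> = (\<Sum>l\<in>nodes. \<Sum>k\<in>nodes. integ (\<lambda>x. B l x * (descend k (rad k) (lder u (B k)) (\<pi> (l \<otimes> x)) * q (\<pi> (l \<otimes> x)))))"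
    by (rule sum.swap)
  also have "\<dots> = pre_mean (\<lambda>p. q p * fr p u bsum)"
    unfolding pre_mean_def
  proof (rule sum.cong[OF refl])
    fix l assume l: "l \<in> nodes"
    have "(\<Sum>k\<in>nodes. integ (\<lambda>x. B l x * (descend k (rad k) (lder u (B k)) (\<pi> (l \<otimes> x)) * q (\<pi> (l \<otimes> x))))) =
        integ (\<lambda>x. \<Sum>k\<in>nodes. B l x * (descend k (rad k) (lder u (B k)) (\<pi> (l \<otimes> x)) * q (\<pi> (l \<otimes> x))))"
      by (rule integ_sum[symmetric]) (rule sp[OF _ l])
    also have "\<dots> = integ (\<lambda>x. B l x * (q (\<pi> (l \<otimes> x)) * fr (\<pi> (l \<otimes> x)) u bsum))"
    proof (rule integ_cong)
      fix x assume x: "x \<in> carrier G"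
      have p: "\<pi> (l \<otimes> x) \<in> points N" using x node_carrier[OF l] pi_points by simp
      have "fr (\<pi> (l \<otimes> x)) u bsum = (\<Sum>k\<in>nodes. fr (\<pi> (l \<otimes> x)) u (b k))"
        unfolding bsum_def[abs_def] by (rule tangent_sum[OF frame_tangent[OF p u] open_charts_N smooth_b])
      also have "\<dots> = (\<Sum>k\<in>nodes. descend k (rad k) (lder u (B k)) (\<pi> (l \<otimes> x)))"
        by (rule sum.cong[OF refl descend_lder[OF _ u p]])
      finally show "(\<Sum>k\<in>nodes. B l x * (descend k (rad k) (lder u (B k)) (\<pi> (l \<otimes> x)) * q (\<pi> (l \<otimes> x)))) =
          B l x * (q (\<pi> (l \<otimes> x)) * fr (\<pi> (l \<otimes> x)) u bsum)"
        by (simp add: sum_distrib_left sum_distrib_right mult.commute mult.left_commute)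
    qed
    finally show "(\<Sum>k\<in>nodes. integ (\<lambda>x. B l x * (descend k (rad k) (lder u (B k)) (\<pi> (l \<otimes> x)) * q (\<pi> (l \<otimes> x))))) =
        integ (\<lambda>x. B l x * (q (\<pi> (l \<otimes> x)) * fr (\<pi> (l \<otimes> x)) u bsum))" .
  qed
  finally have "(\<Sum>k\<in>nodes. ?t k) = pre_mean (\<lambda>p. q p * fr p u bsum)" .
  moreover have "divg u * pre_mean ?a = pre_mean (\<lambda>p. fr p u ?a) + (\<Sum>k\<in>nodes. ?t k)"
    unfolding pre_mean_def sum_distrib_left sum.distrib[symmetric] by (rule sum.cong[OF refl 1])
  ultimately show ?thesis by simp
qed

text \<open>The previous lemma for \<open>q = f / bsum\<^sup>2\<close>.\<close>

lemma pre_mean_divergence: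
  assumes u: "u \<in> \<gg>" and f: "smooth_fun N f"
  shows "pre_mean (\<lambda>p. fr p u f / bsum p) = divg u * pre_mean (\<lambda>p. f p / bsum p)"
proof -
  let ?a = "\<lambda>p. f p / bsum p" and ?q = "\<lambda>p. f p / bsum p / bsum p"
  have a: "smooth_fun N ?a" by (rule smooth_div_bsum[OF f])
  have q: "smooth_fun N ?q" by (rule smooth_div_bsum[OF a])
  have nz: "bsum p \<noteq> 0" if "p \<in> points N" for p using bsum_pos[OF that] by simp
  have qb: "?q p * bsum p = ?a p" if "p \<in> points N" for p using nz[OF that] by simp
  have qb_s: "smooth_fun N (\<lambda>p. ?q p * bsum p)" by (rule smooth_fun_mult[OF open_charts_N q smooth_bsum])
  have E: "fr p u f / bsum p = fr p u (\<lambda>p. ?q p * bsum p) + ?q p * fr p u bsum" if p: "p \<in> points N" for p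
  proof -
    note w = frame_tangent[OF p u]
    have "fr p u f = fr p u (\<lambda>p. ?a p * bsum p)"
      by (rule tangent_cong_N[OF p w f]) (use nz in simp)
    also have "\<dots> = ?a p * fr p u bsum + bsum p * fr p u ?a" by (rule tangent_mult[OF w a smooth_bsum])
    also have "fr p u ?a = fr p u (\<lambda>p. ?q p * bsum p)"
      by (rule tangent_cong_N[OF p w a]) (use qb in simp)
    finally show ?thesis using nz[OF p] by (simp add: field_simps)
  qed
  have "pre_mean (\<lambda>p. fr p u f / bsum p) = pre_mean (\<lambda>p. fr p u (\<lambda>p. ?q p * bsum p) + ?q p * fr p u bsum)"
    by (rule pre_mean_cong[OF E])
  also have "\<dots> = pre_mean (\<lambda>p. fr p u (\<lambda>p. ?q p * bsum p)) + pre_mean (\<lambda>p. ?q p * fr p u bsum)"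
    by (rule pre_mean_add[OF smooth_frame_fun[OF u qb_s] smooth_fun_mult[OF open_charts_N q smooth_frame_fun[OF u smooth_bsum]]])
  also have "\<dots> = divg u * pre_mean (\<lambda>p. ?q p * bsum p)" by (rule pre_mean_frame[OF u q])
  also have "pre_mean (\<lambda>p. ?q p * bsum p) = pre_mean ?a" by (rule pre_mean_cong[OF qb])
  finally show ?thesis .
qed

lemma pre_mean_pos: "pre_mean (\<lambda>p. 1 / bsum p) > 0"
proof -
  have s: "smooth_fun N (\<lambda>p. 1 / bsum p)" by (rule smooth_div_bsum[OF smooth_fun_const])
  have ne: "nodes \<noteq> {}" using nodes(3) pi_points[OF one_closed] by blast
  have "integ (\<lambda>x. B g x * (1 / bsum (\<pi> (g \<otimes> x)))) > 0" if g: "g \<in> nodes" for g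
  proof (rule integ_pos[OF smooth_B_mult[OF g s]])
    show "B g x * (1 / bsum (\<pi> (g \<otimes> x))) \<ge> 0" if "x \<in> carrier G" for x
      using node_bump(3)[OF g] bsum_pos[OF pi_points, of "g \<otimes> x"] node_carrier[OF g] that by (simp add: less_imp_le)
    show "B g \<one> * (1 / bsum (\<pi> (g \<otimes> \<one>))) > 0"
      using node_bump(4)[OF g] bsum_pos[OF pi_points, of g] node_carrier[OF g] by simp
  qed
  then show ?thesis unfolding pre_mean_def by (rule sum_pos[OF nodes(1) ne])
qed

definition mean :: "('a set \<Rightarrow> real) \<Rightarrow> real" where
  "mean f = pre_mean (\<lambda>p. f p / bsum p) / pre_mean (\<lambda>p. 1 / bsum p)"

lemma mean_const: "mean (\<lambda>p. c) = c"
  using pre_mean_cmult[of c "\<lambda>p. 1 / bsum p"] pre_mean_pos by (simp add: mean_def)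

lemma mean_add: "smooth_fun N f \<Longrightarrow> smooth_fun N f' \<Longrightarrow> mean (\<lambda>p. f p + f' p) = mean f + mean f'"
  using pre_mean_add[OF smooth_div_bsum smooth_div_bsum, of f f'] by (simp add: mean_def add_divide_distrib)

lemma mean_cmult: "mean (\<lambda>p. c * f p) = c * mean f"
  using pre_mean_cmult[of c "\<lambda>p. f p / bsum p"] by (simp add: mean_def)

lemma mean_cong: "(\<And>p. p \<in> points N \<Longrightarrow> f p = f' p) \<Longrightarrow> mean f = mean f'"
  using pre_mean_cong[of "\<lambda>p. f p / bsum p" "\<lambda>p. f' p / bsum p"] by (simp add: mean_def)

text \<open>The constant function \<open>1\<close> has derivative zero and positive mean.\<close>

lemma divg_0: assumes u: "u \<in> \<gg>" shows "divg u = 0"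
proof -
  have "pre_mean (\<lambda>p. fr p u (\<lambda>p. 1) / bsum p) = 0"
  proof -
    have "pre_mean (\<lambda>p. fr p u (\<lambda>p. 1) / bsum p) = pre_mean (\<lambda>p. 0 * 0)"
      by (rule pre_mean_cong) (simp add: tangent_const[OF frame_tangent[OF _ u]])
    then show ?thesis using pre_mean_cmult[of 0 "\<lambda>p. 0"] by simp
  qed
  then show ?thesis using pre_mean_divergence[OF u smooth_fun_const[of _ 1]] pre_mean_pos by simp
qed

lemma mean_frame: "u \<in> \<gg> \<Longrightarrow> smooth_fun N f \<Longrightarrow> mean (\<lambda>p. fr p u f) = 0"
  using pre_mean_divergence divg_0 by (simp add: mean_def)

end

section \<open>Averaging forms over the quotient\<close>

lemma two_formsD:
  assumes "\<alpha> \<in> two_forms M"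
  shows "p \<in> points M \<Longrightarrow> \<alpha> p \<in> alt_forms2 (tangent_space M p)" "p \<notin> points M \<Longrightarrow> \<alpha> p = 0"
    "smooth_vf M Y \<Longrightarrow> smooth_vf M Z \<Longrightarrow> smooth_fun M (\<lambda>p. \<alpha> p (Y p) (Z p))"
  using assms by (auto simp: two_forms_def)

lemma one_formsD:
  assumes "\<theta> \<in> one_forms M"
  shows "p \<in> points M \<Longrightarrow> \<theta> p \<in> linear_forms (tangent_space M p)" "p \<notin> points M \<Longrightarrow> \<theta> p = 0"
    "smooth_vf M Y \<Longrightarrow> smooth_fun M (\<lambda>p. \<theta> p (Y p))"
  using assms by (auto simp: one_forms_def)

lemma subspace_linear_forms: "subspace (linear_forms V)"
  by (auto simp: subspace_def linear_forms_def scaleR_fun_def algebra_simps)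

lemma scaleR_fun_apply: "(c *\<^sub>R f) x = c *\<^sub>R f x"
  by (simp add: scaleR_fun_def)

lemma subspace_alt_forms2: "subspace (alt_forms2 V)"
proof (rule subspaceI)
  note L = subspace_linear_forms[of V]
  show "0 \<in> alt_forms2 V"
    using subspace_0[OF L] by (simp add: alt_forms2_def)
  show "\<alpha> + \<beta> \<in> alt_forms2 V" if a: "\<alpha> \<in> alt_forms2 V" and b: "\<beta> \<in> alt_forms2 V" for \<alpha> \<beta>
    unfolding alt_forms2_def
  proof (safe)
    show "(\<alpha> + \<beta>) u v = 0" if "u \<notin> V" for u v using that a b by (simp add: alt_forms2_def)
    show "(\<alpha> + \<beta>) u v = 0" if "v \<notin> V" for u v using that a b by (simp add: alt_forms2_def)
    show "(\<alpha> + \<beta>) u \<in> linear_forms V" if "u \<in> V" for u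
      using subspace_add[OF L alt_forms2D(1)[OF a that] alt_forms2D(1)[OF b that]] by simp
    show "(\<alpha> + \<beta>) u v = - (\<alpha> + \<beta>) v u" if "u \<in> V" "v \<in> V" for u v
      using alt_forms2D(2)[OF a that] alt_forms2D(2)[OF b that] by simp
  qed
  show "c *\<^sub>R \<alpha> \<in> alt_forms2 V" if a: "\<alpha> \<in> alt_forms2 V" for c \<alpha>
    unfolding alt_forms2_def
  proof (safe)
    show "(c *\<^sub>R \<alpha>) u v = 0" if "u \<notin> V" for u v using that a by (simp add: alt_forms2_def scaleR_fun_apply)
    show "(c *\<^sub>R \<alpha>) u v = 0" if "v \<notin> V" for u v using that a by (simp add: alt_forms2_def scaleR_fun_apply)
    show "(c *\<^sub>R \<alpha>) u \<in> linear_forms V" if "u \<in> V" for u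
      using subspace_scale[OF L alt_forms2D(1)[OF a that]] by (simp add: scaleR_fun_apply)
    show "(c *\<^sub>R \<alpha>) u v = - (c *\<^sub>R \<alpha>) v u" if "u \<in> V" "v \<in> V" for u v
      using alt_forms2D(2)[OF a that] by (simp add: scaleR_fun_apply)
  qed
qed

context lie_lattice
begin

lemma mean_uminus: "mean (\<lambda>p. - f p) = - mean f"
  using mean_cmult[of "-1" f] by simp

lemma mean_diff:
  assumes "smooth_fun N f" "smooth_fun N f'" shows "mean (\<lambda>p. f p - f' p) = mean f - mean f'"
  using mean_add[OF assms(1) smooth_fun_uminus[OF open_charts_N assms(2)]] by (simp add: mean_uminus)

definition avg1 :: "('a set \<Rightarrow> 'a set tvec \<Rightarrow> real) \<Rightarrow> 'a tvec \<Rightarrow> real" where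
  "avg1 \<theta> u = (if u \<in> \<gg> then mean (\<lambda>p. \<theta> p (fr p u)) else 0)"

definition avg2 :: "('a set \<Rightarrow> 'a set tvec \<Rightarrow> 'a set tvec \<Rightarrow> real) \<Rightarrow> 'a tvec \<Rightarrow> 'a tvec \<Rightarrow> real" where
  "avg2 \<alpha> u v = (if u \<in> \<gg> \<and> v \<in> \<gg> then mean (\<lambda>p. \<alpha> p (fr p u) (fr p v)) else 0)"

lemma avg1_linear_form:
  assumes \<theta>: "\<theta> \<in> one_forms N" shows "avg1 \<theta> \<in> linear_forms \<gg>"
  unfolding linear_forms_def
proof safe
  fix u v assume uv: "u \<in> \<gg>" "v \<in> \<gg>"
  have "mean (\<lambda>p. \<theta> p (fr p (u + v))) = mean (\<lambda>p. \<theta> p (fr p u) + \<theta> p (fr p v))"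
    by (rule mean_cong) (simp add: frame_add linear_formsD(1)[OF one_formsD(1)[OF \<theta>]] frame_tangent uv)
  then show "avg1 \<theta> (u + v) = avg1 \<theta> u + avg1 \<theta> v"
    using uv by (simp add: avg1_def tangent_space_add mean_add one_formsD(3)[OF \<theta>] smooth_vf_frame)
next
  fix c u assume u: "u \<in> \<gg>"
  have "mean (\<lambda>p. \<theta> p (fr p (c *\<^sub>R u))) = mean (\<lambda>p. c * \<theta> p (fr p u))"
    by (rule mean_cong) (simp add: frame_scaleR linear_formsD(2)[OF one_formsD(1)[OF \<theta>]] frame_tangent u)
  then show "avg1 \<theta> (c *\<^sub>R u) = c * avg1 \<theta> u"
    using u by (simp add: avg1_def tangent_space_scaleR mean_cmult)
qed (simp add: avg1_def)

lemma smooth_form_frame: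
  "\<alpha> \<in> two_forms N \<Longrightarrow> u \<in> \<gg> \<Longrightarrow> v \<in> \<gg> \<Longrightarrow> smooth_fun N (\<lambda>p. \<alpha> p (fr p u) (fr p v))"
  using two_formsD(3) smooth_vf_frame by blast

lemma avg2_alt_form:
  assumes \<alpha>: "\<alpha> \<in> two_forms N" shows "avg2 \<alpha> \<in> alt_forms2 \<gg>"
  unfolding alt_forms2_def
proof safe
  fix u assume u: "u \<in> \<gg>"
  have lin: "\<alpha> p (fr p u) \<in> linear_forms (tangent_space N p)" if "p \<in> points N" for p
    using alt_forms2D(1)[OF two_formsD(1)[OF \<alpha> that] frame_tangent[OF that u]] .
  show "avg2 \<alpha> u \<in> linear_forms \<gg>"
    unfolding linear_forms_def
  proof safe
    fix v w assume vw: "v \<in> \<gg>" "w \<in> \<gg>"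
    have "mean (\<lambda>p. \<alpha> p (fr p u) (fr p (v + w))) = mean (\<lambda>p. \<alpha> p (fr p u) (fr p v) + \<alpha> p (fr p u) (fr p w))"
      by (rule mean_cong) (simp add: frame_add linear_formsD(1)[OF lin] frame_tangent vw)
    then show "avg2 \<alpha> u (v + w) = avg2 \<alpha> u v + avg2 \<alpha> u w"
      using u vw by (simp add: avg2_def tangent_space_add mean_add smooth_form_frame[OF \<alpha>])
  next
    fix c v assume v: "v \<in> \<gg>"
    have "mean (\<lambda>p. \<alpha> p (fr p u) (fr p (c *\<^sub>R v))) = mean (\<lambda>p. c * \<alpha> p (fr p u) (fr p v))"
      by (rule mean_cong) (simp add: frame_scaleR linear_formsD(2)[OF lin] frame_tangent v)
    then show "avg2 \<alpha> u (c *\<^sub>R v) = c * avg2 \<alpha> u v"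
      using u v by (simp add: avg2_def tangent_space_scaleR mean_cmult)
  qed (simp add: avg2_def)
next
  fix u v assume uv: "u \<in> \<gg>" "v \<in> \<gg>"
  have "mean (\<lambda>p. \<alpha> p (fr p u) (fr p v)) = mean (\<lambda>p. - \<alpha> p (fr p v) (fr p u))"
    by (rule mean_cong) (rule alt_forms2D(2)[OF two_formsD(1)[OF \<alpha>]], simp_all add: frame_tangent uv)
  then show "avg2 \<alpha> u v = - avg2 \<alpha> v u" using uv by (simp add: avg2_def mean_uminus)
qed (simp_all add: avg2_def)

text \<open>The mean annihilates the terms of \<open>ext_d2\<close> in which the form is differentiated along a frame field. What is
  left are the terms with brackets, and these make up \<open>ce_d2\<close>.\<close>

lemma avg2_closed:
  assumes \<alpha>: "\<alpha> \<in> closed_forms N" shows "avg2 \<alpha> \<in> ce_closed \<gg> br"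
proof -
  have a2: "\<alpha> \<in> two_forms N" using \<alpha> by (simp add: closed_forms_def)
  have "ce_d2 br (avg2 \<alpha>) u v w = 0" if uvw: "u \<in> \<gg>" "v \<in> \<gg>" "w \<in> \<gg>" for u v w
  proof -
    let ?f = "\<lambda>u v p. \<alpha> p (fr p u) (fr p v)"
    note s = smooth_form_frame[OF a2]
    note sb = s[OF lie_bracket_in]
    note E = smooth_frame_fun[OF _ s]
    have "fr p u (?f v w) - fr p v (?f u w) + fr p w (?f u v) =
        ?f (br u v) w p - ?f (br u w) v p + ?f (br v w) u p" if p: "p \<in> points N" for p
    proof -
      have "ext_d2 \<alpha> (\<lambda>p. fr p u) (\<lambda>p. fr p v) (\<lambda>p. fr p w) p = 0"
        using \<alpha> smooth_vf_frame uvw p unfolding closed_forms_def by blast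
      then show ?thesis using frame_bracket[OF _ _ p] uvw by (simp add: ext_d2_def)
    qed
    then have "mean (\<lambda>p. fr p u (?f v w) - fr p v (?f u w) + fr p w (?f u v)) =
        mean (\<lambda>p. ?f (br u v) w p - ?f (br u w) v p + ?f (br v w) u p)"
      by (rule mean_cong)
    also have "mean (\<lambda>p. fr p u (?f v w) - fr p v (?f u w) + fr p w (?f u v)) = 0"
      using uvw by (simp add: mean_add mean_diff E s mean_frame smooth_fun_diff[OF open_charts_N])
    also have "mean (\<lambda>p. ?f (br u v) w p - ?f (br u w) v p + ?f (br v w) u p) =
       avg2 \<alpha> (br u v) w - avg2 \<alpha> (br u w) v + avg2 \<alpha> (br v w) u"
      using uvw by (simp add: mean_add mean_diff sb smooth_fun_diff[OF open_charts_N] avg2_def lie_bracket_in)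
    finally show ?thesis by (simp add: ce_d2_def)
  qed
  then show ?thesis using avg2_alt_form[OF a2] by (simp add: ce_closed_def)
qed

lemma avg2_exact:
  assumes \<alpha>: "\<alpha> \<in> exact_forms N" shows "avg2 \<alpha> \<in> ce_exact \<gg> br"
proof -
  obtain \<theta> where \<theta>: "\<theta> \<in> one_forms N"
    and d: "\<And>Y Z p. smooth_vf N Y \<Longrightarrow> smooth_vf N Z \<Longrightarrow> p \<in> points N \<Longrightarrow> \<alpha> p (Y p) (Z p) = ext_d1 \<theta> Y Z p"
    using \<alpha> unfolding exact_forms_def by blast
  have "avg2 \<alpha> u v = ce_d1 \<gg> br (avg1 \<theta>) u v" for u v
  proof (cases "u \<in> \<gg> \<and> v \<in> \<gg>")
    case True
    then have uv: "u \<in> \<gg>" "v \<in> \<gg>" by auto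
    let ?f = "\<lambda>u p. \<theta> p (fr p u)"
    have s: "smooth_fun N (?f u)" if "u \<in> \<gg>" for u using one_formsD(3)[OF \<theta> smooth_vf_frame[OF that]] .
    note E = smooth_frame_fun[OF _ s]
    have "mean (\<lambda>p. \<alpha> p (fr p u) (fr p v)) = mean (\<lambda>p. fr p u (?f v) - fr p v (?f u) - ?f (br u v) p)"
      by (rule mean_cong) (use d[OF smooth_vf_frame smooth_vf_frame] uv frame_bracket in \<open>simp add: ext_d1_def\<close>)
    also have "\<dots> = - mean (?f (br u v))"
      using uv by (simp add: mean_diff E s lie_bracket_in mean_frame smooth_fun_diff[OF open_charts_N])
    finally show ?thesis using uv by (simp add: avg2_def ce_d1_def avg1_def lie_bracket_in)
  qed (auto simp: avg2_def ce_d1_def)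
  then have "avg2 \<alpha> = ce_d1 \<gg> br (avg1 \<theta>)" by (intro ext)
  then show ?thesis unfolding ce_exact_def using avg1_linear_form[OF \<theta>] by blast
qed

lemma avg2_left_inv:
  assumes \<beta>: "\<beta> \<in> alt_forms2 \<gg>" shows "avg2 (lif \<beta>) = \<beta>"
proof (intro ext)
  fix u v
  show "avg2 (lif \<beta>) u v = \<beta> u v"
  proof (cases "u \<in> \<gg> \<and> v \<in> \<gg>")
    case True
    then have "mean (\<lambda>p. lif \<beta> p (fr p u) (fr p v)) = mean (\<lambda>p. \<beta> u v)"
      by (intro mean_cong) (simp add: lif_apply frame_tangent coframe_frame)
    then show ?thesis using True by (simp add: avg2_def mean_const)
  next
    case False
    then have "\<beta> u v = 0" using \<beta> unfolding alt_forms2_def by blast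
    then show ?thesis using False by (auto simp: avg2_def)
  qed
qed

lemma avg2_diff:
  assumes "\<alpha> \<in> two_forms N" "\<beta> \<in> two_forms N" shows "avg2 (\<alpha> - \<beta>) = avg2 \<alpha> - avg2 \<beta>"
  by (intro ext) (simp add: avg2_def mean_diff smooth_form_frame assms)

abbreviation "JN J \<equiv> induced_J G X \<Gamma> J"

lemma induced_J_frame: "p \<in> points N \<Longrightarrow> u \<in> \<gg> \<Longrightarrow> JN J p (fr p u) = fr p (J u)"
  by (simp add: induced_J_def coframe_frame)

lemma avg2_J:
  assumes J: "almost_complex_structure_on \<gg> J"
    and \<alpha>: "\<forall>p\<in>points N. \<forall>u\<in>tangent_space N p. \<forall>v\<in>tangent_space N p. \<alpha> p (JN J p u) (JN J p v) = s * \<alpha> p u v"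
    and uv: "u \<in> \<gg>" "v \<in> \<gg>"
  shows "avg2 \<alpha> (J u) (J v) = s * avg2 \<alpha> u v"
proof -
  have J': "J u \<in> \<gg>" "J v \<in> \<gg>" using J uv by (auto simp: almost_complex_structure_on_def)
  have "mean (\<lambda>p. \<alpha> p (fr p (J u)) (fr p (J v))) = mean (\<lambda>p. s * \<alpha> p (fr p u) (fr p v))"
    by (rule mean_cong) (use \<alpha> frame_tangent uv in \<open>simp add: induced_J_frame[symmetric]\<close>)
  then show ?thesis using uv J' by (simp add: avg2_def mean_cmult)
qed

lemma left_inv_J:
  assumes J: "almost_complex_structure_on \<gg> J"
    and \<beta>: "\<forall>u\<in>\<gg>. \<forall>v\<in>\<gg>. \<beta> (J u) (J v) = s * \<beta> u v"
    and p: "p \<in> points N" and uv: "u \<in> tangent_space N p" "v \<in> tangent_space N p"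
  shows "lif \<beta> p (JN J p u) (JN J p v) = s * lif \<beta> p u v"
proof -
  have c: "cofr p u \<in> \<gg>" "cofr p v \<in> \<gg>" using coframe_in[OF p] uv by auto
  then have J': "J (cofr p u) \<in> \<gg>" "J (cofr p v) \<in> \<gg>" using J by (auto simp: almost_complex_structure_on_def)
  then show ?thesis
    using \<beta> c p uv by (simp add: induced_J_def lif_apply frame_tangent coframe_frame)
qed

lemma linear_lif: "linear lif"
  by (rule linearI) (auto simp: left_inv_form_def Let_def fun_eq_iff scaleR_fun_def)

text \<open>An alternating form on \<open>\<gg>\<close> is a combination of products of two coordinates.\<close>

lemma finite_dim_alt_forms2: "\<exists>S. finite S \<and> alt_forms2 \<gg> \<subseteq> span S"
proof (intro exI conjI subsetI)
  define \<eta> where "\<eta> = (\<lambda>(b, b') u v. if u \<in> \<gg> \<and> v \<in> \<gg> then (coordv u \<bullet> b) * (coordv v \<bullet> b') else (0::real))"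
  let ?S = "\<eta> ` (Basis \<times> Basis)"
  show "finite ?S" by simp
  fix \<alpha> assume \<alpha>: "\<alpha> \<in> alt_forms2 \<gg>"
  have "\<alpha> = (\<Sum>p\<in>Basis \<times> Basis. \<alpha> (dvec (fst p)) (dvec (snd p)) *\<^sub>R \<eta> p)"
  proof (intro ext)
    fix u v
    show "\<alpha> u v = (\<Sum>p\<in>Basis \<times> Basis. \<alpha> (dvec (fst p)) (dvec (snd p)) *\<^sub>R \<eta> p) u v"
    proof (cases "u \<in> \<gg> \<and> v \<in> \<gg>")
      case False
      then have "\<alpha> u v = 0" using \<alpha> unfolding alt_forms2_def by blast
      moreover have "\<eta> p u v = 0" for p using False by (auto simp: \<eta>_def split: prod.split)
      ultimately show ?thesis by (simp add: sum_fun_apply scaleR_fun_apply)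
    next
      case True
      have "\<alpha> u v = \<alpha> (dvec (coordv u)) (dvec (coordv v))" using True by (simp add: dvec_coordv)
      also have "\<dots> = (\<Sum>b\<in>Basis. (coordv u \<bullet> b) * \<alpha> (dvec b) (dvec (coordv v)))"
        by (rule linear_forms_dvec[OF alt_forms2_left[OF \<alpha> subspace_g dvec_in]])
      also have "\<dots> = (\<Sum>b\<in>Basis. \<Sum>b'\<in>Basis. (coordv u \<bullet> b) * ((coordv v \<bullet> b') * \<alpha> (dvec b) (dvec b')))"
        unfolding sum_distrib_left[symmetric]
        by (rule sum.cong[OF refl], subst linear_forms_dvec[OF alt_forms2D(1)[OF \<alpha> dvec_in]], rule refl)
      also have "\<dots> = (\<Sum>p\<in>Basis \<times> Basis. \<alpha> (dvec (fst p)) (dvec (snd p)) *\<^sub>R \<eta> p) u v"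
        using True by (simp add: sum_fun_apply scaleR_fun_apply sum.cartesian_product \<eta>_def case_prod_unfold mult.commute mult.left_commute)
      finally show ?thesis .
    qed
  qed
  also have "\<dots> \<in> span ?S" by (intro span_sum span_scale span_base) auto
  finally show "\<alpha> \<in> span ?S" .
qed

lemma linear_ce_d1: "linear (ce_d1 V bk)"
  by (rule linearI) (auto simp: ce_d1_def fun_eq_iff scaleR_fun_def)

lemma subspace_ce_exact: "subspace (ce_exact \<gg> br)"
  unfolding ce_exact_def by (rule linear_subspace_image[OF linear_ce_d1 subspace_linear_forms])

lemma subspace_ce_closed: "subspace (ce_closed \<gg> br)"
proof (rule subspaceI)
  note A = subspace_alt_forms2[of \<gg>]
  show "0 \<in> ce_closed \<gg> br" using subspace_0[OF A] by (simp add: ce_closed_def ce_d2_def)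
  have add: "ce_d2 br (\<alpha> + \<beta>) u v w = ce_d2 br \<alpha> u v w + ce_d2 br \<beta> u v w" for \<alpha> \<beta> u v w
    by (simp add: ce_d2_def)
  show "\<alpha> + \<beta> \<in> ce_closed \<gg> br" if "\<alpha> \<in> ce_closed \<gg> br" "\<beta> \<in> ce_closed \<gg> br" for \<alpha> \<beta>
    using that subspace_add[OF A, of \<alpha> \<beta>] by (simp add: ce_closed_def add)
  have scale: "ce_d2 br (c *\<^sub>R \<alpha>) u v w = c * ce_d2 br \<alpha> u v w" for c \<alpha> u v w
    by (simp add: ce_d2_def scaleR_fun_apply algebra_simps)
  show "c *\<^sub>R \<alpha> \<in> ce_closed \<gg> br" if "\<alpha> \<in> ce_closed \<gg> br" for c \<alpha>
    using that subspace_scale[OF A, of \<alpha> c] by (simp add: ce_closed_def scale)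
qed

lemma subspace_two_forms: "subspace (two_forms N)"
proof (rule subspaceI)
  show "0 \<in> two_forms N"
    by (simp add: two_forms_def smooth_fun_const subspace_0[OF subspace_alt_forms2])
  show "\<alpha> + \<beta> \<in> two_forms N" if a: "\<alpha> \<in> two_forms N" and b: "\<beta> \<in> two_forms N" for \<alpha> \<beta>
    by (simp add: two_forms_def subspace_add[OF subspace_alt_forms2] two_formsD[OF a] two_formsD[OF b]
      smooth_fun_add[OF open_charts_N])
  show "c *\<^sub>R \<alpha> \<in> two_forms N" if a: "\<alpha> \<in> two_forms N" for c \<alpha>
    by (simp add: two_forms_def subspace_scale[OF subspace_alt_forms2] two_formsD[OF a]
      smooth_fun_cmult[OF open_charts_N] scaleR_fun_apply)
qed

lemma subspace_one_forms: "subspace (one_forms N)"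
proof (rule subspaceI)
  show "0 \<in> one_forms N"
    by (simp add: one_forms_def smooth_fun_const subspace_0[OF subspace_linear_forms])
  show "\<alpha> + \<beta> \<in> one_forms N" if a: "\<alpha> \<in> one_forms N" and b: "\<beta> \<in> one_forms N" for \<alpha> \<beta>
    by (simp add: one_forms_def subspace_add[OF subspace_linear_forms] one_formsD[OF a] one_formsD[OF b]
      smooth_fun_add[OF open_charts_N])
  show "c *\<^sub>R \<alpha> \<in> one_forms N" if a: "\<alpha> \<in> one_forms N" for c \<alpha>
    by (simp add: one_forms_def subspace_scale[OF subspace_linear_forms] one_formsD[OF a]
      smooth_fun_cmult[OF open_charts_N] scaleR_fun_apply)
qed

lemma ext_d1_linear:
  assumes Y: "smooth_vf N Y" and Z: "smooth_vf N Z" and p: "p \<in> points N" and \<theta>: "\<theta> \<in> one_forms N"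
  shows "\<theta>' \<in> one_forms N \<Longrightarrow> ext_d1 (\<theta> + \<theta>') Y Z p = ext_d1 \<theta> Y Z p + ext_d1 \<theta>' Y Z p"
    "ext_d1 (c *\<^sub>R \<theta>) Y Z p = c * ext_d1 \<theta> Y Z p"
proof -
  note t = vf_tangent[OF Y p] vf_tangent[OF Z p]
  note s = one_formsD(3)[OF \<theta>]
  show "ext_d1 (c *\<^sub>R \<theta>) Y Z p = c * ext_d1 \<theta> Y Z p"
    by (simp add: ext_d1_def scaleR_fun_apply tangent_cmult[OF t(1) s[OF Z]] tangent_cmult[OF t(2) s[OF Y]] algebra_simps)
  assume "\<theta>' \<in> one_forms N"
  note s' = one_formsD(3)[OF this]
  show "ext_d1 (\<theta> + \<theta>') Y Z p = ext_d1 \<theta> Y Z p + ext_d1 \<theta>' Y Z p"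
    by (simp add: ext_d1_def tangent_add[OF t(1) s[OF Z] s'[OF Z]] tangent_add[OF t(2) s[OF Y] s'[OF Y]])
qed

lemma exact_formsI:
  assumes "\<alpha> \<in> two_forms N" "\<theta> \<in> one_forms N"
    "\<And>Y Z p. smooth_vf N Y \<Longrightarrow> smooth_vf N Z \<Longrightarrow> p \<in> points N \<Longrightarrow> \<alpha> p (Y p) (Z p) = ext_d1 \<theta> Y Z p"
  shows "\<alpha> \<in> exact_forms N"
  using assms unfolding exact_forms_def by blast

lemma subspace_exact_forms: "subspace (exact_forms N)"
  unfolding subspace_def
proof (intro conjI ballI allI)
  show "0 \<in> exact_forms N"
  proof (rule exact_formsI[OF subspace_0[OF subspace_two_forms] subspace_0[OF subspace_one_forms]])
    fix Y Z p assume "smooth_vf N Y" "smooth_vf N Z" "p \<in> points N"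
    then show "0 p (Y p) (Z p) = ext_d1 0 Y Z p"
      by (simp add: ext_d1_def tangent_const[OF vf_tangent])
  qed
  show "\<alpha> + \<beta> \<in> exact_forms N" if \<alpha>: "\<alpha> \<in> exact_forms N" and \<beta>: "\<beta> \<in> exact_forms N" for \<alpha> \<beta>
  proof -
    obtain \<theta> where 1: "\<alpha> \<in> two_forms N" "\<theta> \<in> one_forms N"
      "\<And>Y Z p. smooth_vf N Y \<Longrightarrow> smooth_vf N Z \<Longrightarrow> p \<in> points N \<Longrightarrow> \<alpha> p (Y p) (Z p) = ext_d1 \<theta> Y Z p"
      using \<alpha> unfolding exact_forms_def by blast
    obtain \<eta> where 2: "\<beta> \<in> two_forms N" "\<eta> \<in> one_forms N"
      "\<And>Y Z p. smooth_vf N Y \<Longrightarrow> smooth_vf N Z \<Longrightarrow> p \<in> points N \<Longrightarrow> \<beta> p (Y p) (Z p) = ext_d1 \<eta> Y Z p"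
      using \<beta> unfolding exact_forms_def by blast
    show ?thesis
      by (rule exact_formsI[OF subspace_add[OF subspace_two_forms 1(1) 2(1)] subspace_add[OF subspace_one_forms 1(2) 2(2)]])
        (simp add: 1(3) 2(3) ext_d1_linear(1)[OF _ _ _ 1(2) 2(2)])
  qed
  show "c *\<^sub>R \<alpha> \<in> exact_forms N" if \<alpha>: "\<alpha> \<in> exact_forms N" for c \<alpha>
  proof -
    obtain \<theta> where 1: "\<alpha> \<in> two_forms N" "\<theta> \<in> one_forms N"
      "\<And>Y Z p. smooth_vf N Y \<Longrightarrow> smooth_vf N Z \<Longrightarrow> p \<in> points N \<Longrightarrow> \<alpha> p (Y p) (Z p) = ext_d1 \<theta> Y Z p"
      using \<alpha> unfolding exact_forms_def by blast
    show ?thesis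
      by (rule exact_formsI[OF subspace_scale[OF subspace_two_forms 1(1)] subspace_scale[OF subspace_one_forms 1(2), of c]])
        (simp add: 1(3) scaleR_fun_apply ext_d1_linear(2)[where c = c, OF _ _ _ 1(2)])
  qed
qed

end

section \<open>Linear algebra of quotients\<close>

lemma cls_eq_iff: "subspace B \<Longrightarrow> cls B x = cls B y \<longleftrightarrow> x - y \<in> B"
proof
  assume B: "subspace B"
  assume "cls B x = cls B y"
  moreover have "x \<in> cls B x" using subspace_0[OF B] by (force simp: cls_def)
  ultimately show "x - y \<in> B" by (auto simp: cls_def)
next
  assume B: "subspace B" and d: "x - y \<in> B"
  have sub: "cls B u \<subseteq> cls B v" if "u - v \<in> B" for u v
  proof
    fix z assume "z \<in> cls B u"
    then obtain b where "b \<in> B" "z = u + b" by (auto simp: cls_def)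
    then have "z = v + ((u - v) + b)" "(u - v) + b \<in> B" using that subspace_add[OF B] by auto
    then show "z \<in> cls B v" unfolding cls_def by blast
  qed
  have "y - x \<in> B" using subspace_neg[OF B d] by simp
  then show "cls B x = cls B y" using sub d by blast
qed

lemma cls_add_cls:
  assumes B: "subspace B" shows "cls_add (cls B x) (cls B y) = cls B (x + y)"
proof
  show "cls_add (cls B x) (cls B y) \<subseteq> cls B (x + y)"
  proof
    fix z assume "z \<in> cls_add (cls B x) (cls B y)"
    then obtain a b where "a \<in> B" "b \<in> B" "z = (x + a) + (y + b)" by (auto simp: cls_def cls_add_def)
    then have "z = (x + y) + (a + b)" "a + b \<in> B" using subspace_add[OF B] by auto
    then show "z \<in> cls B (x + y)" unfolding cls_def by blast
  qed
  show "cls B (x + y) \<subseteq> cls_add (cls B x) (cls B y)"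
  proof
    fix z assume "z \<in> cls B (x + y)"
    then obtain b where "b \<in> B" "z = (x + 0) + (y + b)" by (auto simp: cls_def)
    then show "z \<in> cls_add (cls B x) (cls B y)" unfolding cls_def cls_add_def using subspace_0[OF B] by blast
  qed
qed

lemma cls_scale_cls:
  assumes B: "subspace B" shows "cls_scale B c (cls B x) = cls B (c *\<^sub>R x)"
proof
  show "cls_scale B c (cls B x) \<subseteq> cls B (c *\<^sub>R x)"
  proof
    fix z assume "z \<in> cls_scale B c (cls B x)"
    then obtain a b where "a \<in> B" "b \<in> B" "z = c *\<^sub>R (x + a) + b" by (auto simp: cls_def cls_scale_def)
    then have "z = c *\<^sub>R x + (c *\<^sub>R a + b)" "c *\<^sub>R a + b \<in> B"
      using subspace_add[OF B] subspace_scale[OF B] by (auto simp: scaleR_right_distrib)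
    then show "z \<in> cls B (c *\<^sub>R x)" unfolding cls_def by blast
  qed
  show "cls B (c *\<^sub>R x) \<subseteq> cls_scale B c (cls B x)"
  proof
    fix z assume "z \<in> cls B (c *\<^sub>R x)"
    then obtain b where "b \<in> B" "z = c *\<^sub>R (x + 0) + b" by (auto simp: cls_def)
    then show "z \<in> cls_scale B c (cls B x)" unfolding cls_def cls_scale_def using subspace_0[OF B] by blast
  qed
qed

text \<open>The composition of \<open>i\<close> with the inverse of \<open>F\<close> is an injective endomorphism of the space of classes of \<open>Z\<close>
  modulo \<open>B\<close>, hence surjective. In the proof, this endomorphism is lifted to a linear map \<open>T\<close> of \<open>Z\<close> that fixes \<open>Z \<inter> B\<close>, so that
  the dimension count takes place in \<open>Z\<close>.\<close>

lemma injective_imp_surjective_quotient: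
  fixes i :: "'v::real_vector \<Rightarrow> 'w::real_vector"
  assumes B: "subspace B" and B': "subspace B'" and Z: "subspace Z" and fd: "finite S" "Z \<subseteq> span S"
    and i: "linear i" "i ` Z \<subseteq> Z'" and inj: "\<And>z. z \<in> Z \<Longrightarrow> i z \<in> B' \<Longrightarrow> z \<in> B"
    and F: "quot_iso B B' (cls B ` Z) (cls B' ` Z') F"
    and z': "z' \<in> Z'"
  shows "\<exists>z\<in>Z. z' - i z \<in> B'"
proof -
  have FZ: "F ` cls B ` Z = cls B' ` Z'" using F by (simp add: quot_iso_def bij_betw_def)
  have F_add: "F (cls B (x + y)) = cls B' (x' + y')"
    if "x \<in> Z" "y \<in> Z" "F (cls B x) = cls B' x'" "F (cls B y) = cls B' y'" for x y x' y'
    using F that unfolding quot_iso_def cls_add_cls[OF B, symmetric] cls_add_cls[OF B', symmetric] by auto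
  have F_scale: "F (cls B (c *\<^sub>R x)) = cls B' (c *\<^sub>R x')" if "x \<in> Z" "F (cls B x) = cls B' x'" for c x x'
    using F that unfolding quot_iso_def cls_scale_cls[OF B, symmetric] cls_scale_cls[OF B', symmetric] by auto
  have "\<forall>z\<in>Z. \<exists>y\<in>Z. F (cls B y) = cls B' (i z)"
  proof
    fix z assume "z \<in> Z"
    then have "cls B' (i z) \<in> F ` cls B ` Z" unfolding FZ using i(2) by blast
    then show "\<exists>y\<in>Z. F (cls B y) = cls B' (i z)" by auto
  qed
  then obtain t where t: "\<And>z. z \<in> Z \<Longrightarrow> t z \<in> Z \<and> F (cls B (t z)) = cls B' (i z)" by metis
  have sK: "subspace (Z \<inter> B)" using subspace_Int[of "{Z, B}"] Z B by (simp add: subspace_inter)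
  obtain b where b: "b \<subseteq> Z \<inter> B" "independent b" "Z \<inter> B \<subseteq> span b" using maximal_independent_subset by blast
  have span_b: "span b = Z \<inter> B" using b(3) span_minimal[OF b(1) sK] by blast
  obtain E where E: "b \<subseteq> E" "E \<subseteq> Z" "independent E" "Z \<subseteq> span E"
    using maximal_independent_subset_extend[of b Z] b by blast
  have span_E: "span E = Z" using E(4) span_minimal[OF E(2) Z] by blast
  have finE: "finite E" using independent_span_bound[OF fd(1) E(3)] E(2) fd(2) by blast
  \<comment> \<open>The vectors in \<open>c\<close> represent a basis of the quotient of \<open>Z\<close> by \<open>Z \<inter> B\<close>.\<close>
  define c where "c = E - b"
  have cE: "c \<subseteq> Z" "E = b \<union> c" using E by (auto simp: c_def)
  obtain T where T: "linear T" "\<forall>x\<in>E. T x = (if x \<in> b then x else t x)"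
    using linear_independent_extend[OF E(3), of "\<lambda>x. if x \<in> b then x else t x"] by (elim exE conjE)
  \<comment> \<open>The projection onto the span of \<open>c\<close> along that of \<open>b\<close>, used to see that these spans meet in zero.\<close>
  obtain P where P: "linear P" "\<forall>x\<in>E. P x = (if x \<in> b then 0 else x)"
    using linear_independent_extend[OF E(3), of "\<lambda>x. if x \<in> b then 0 else x"] by (elim exE conjE)
  have span_c: "span c \<subseteq> Z" by (rule span_minimal[OF cE(1) Z])
  have Tb: "T x = x" if "x \<in> span b" for x
  proof -
    have "T y = id y" if "y \<in> b" for y using T(2) E(1) that by auto
    from linear_eq_on_span[OF T(1) linear_id this that] show ?thesis by simp
  qed
  have F0: "F (cls B 0) = cls B' 0"
  proof -
    have "0 \<in> Z" by (rule subspace_0[OF Z])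
    then show ?thesis using F_scale[of "t 0" "i 0" 0] t[of 0] by simp
  qed
  have Tc: "T x \<in> Z \<and> F (cls B (T x)) = cls B' (i x)" if "x \<in> span c" for x
  proof (rule span_induct_alt[OF that])
    show "T 0 \<in> Z \<and> F (cls B (T 0)) = cls B' (i 0)"
      using linear_0[OF T(1)] linear_0[OF i(1)] F0 subspace_0[OF Z] by simp
    fix a x y assume x: "x \<in> c" and y: "T y \<in> Z \<and> F (cls B (T y)) = cls B' (i y)"
    have "x \<in> E" "x \<notin> b" using x by (auto simp: c_def)
    then have xx: "T x = t x" "x \<in> Z" using T(2) E(2) by auto
    have tx: "t x \<in> Z" "F (cls B (t x)) = cls B' (i x)" using t[OF xx(2)] by auto
    have ax: "a *\<^sub>R t x \<in> Z" using subspace_scale[OF Z tx(1)] .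
    have "F (cls B (a *\<^sub>R t x + T y)) = cls B' (a *\<^sub>R i x + i y)"
      using F_add[OF ax _ F_scale[OF tx]] y by blast
    moreover have "a *\<^sub>R t x + T y \<in> Z" using subspace_add[OF Z ax] y by blast
    ultimately show "T (a *\<^sub>R x + y) \<in> Z \<and> F (cls B (T (a *\<^sub>R x + y))) = cls B' (i (a *\<^sub>R x + y))"
      by (simp only: linear_add[OF T(1)] linear_cmul[OF T(1)] linear_add[OF i(1)] linear_cmul[OF i(1)] xx(1))
  qed
  have decomp: "\<exists>x\<in>span b. \<exists>y\<in>span c. z = x + y" if "z \<in> Z" for z
  proof -
    have "z \<in> span (b \<union> c)" using that span_E cE(2) by simp
    then show ?thesis unfolding span_Un by blast
  qed
  have T0: "z = 0" if z: "z \<in> Z" "T z = 0" for z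
  proof -
    obtain x y where xy: "x \<in> span b" "y \<in> span c" "z = x + y" using decomp[OF z(1)] by blast
    have Ty: "T y = - x" using z(2) Tb[OF xy(1)] by (simp add: xy(3) linear_add[OF T(1)] eq_neg_iff_add_eq_0 add.commute)
    have "T y - 0 \<in> B" unfolding Ty using xy(1) span_b subspace_neg[OF B] by auto
    then have "cls B (T y) = cls B 0" using cls_eq_iff[OF B] by blast
    then have "cls B' (i y) = cls B' 0" using Tc[OF xy(2)] F0 by simp
    then have "i y \<in> B'" using cls_eq_iff[OF B', of "i y" 0] by simp
    then have "y \<in> span b" using inj span_c xy(2) span_b by blast
    moreover have "P x = 0" if "x \<in> b" for x using P(2) E(1) that by auto
    ultimately have "P y = 0" using linear_eq_0_on_span[OF P(1), of b y] by blast
    moreover have "P y = y"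
    proof -
      have "P x = id x" if "x \<in> c" for x using P(2) that by (auto simp: c_def)
      from linear_eq_on_span[OF P(1) linear_id this xy(2)] show ?thesis by simp
    qed
    ultimately have "y = 0" by simp
    then have "x = 0" using Ty linear_0[OF T(1)] by simp
    then show ?thesis using xy(3) \<open>y = 0\<close> by simp
  qed
  have injT: "inj_on T (span E)"
  proof (rule inj_onI)
    fix x y assume "x \<in> span E" "y \<in> span E" "T x = T y"
    then have "x - y \<in> Z" "T (x - y) = 0" unfolding span_E by (auto intro: subspace_diff[OF Z] simp: linear_diff[OF T(1)])
    then show "x = y" using T0 by fastforce
  qed
  have TE: "independent (T ` E)" by (rule linear_independent_injective_image[OF T(1) E(3) injT])
  have TEZ: "T ` E \<subseteq> Z" using T(2) E(1,2) t by auto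
  have cardTE: "card (T ` E) = card E"
    by (rule card_image) (rule inj_on_subset[OF injT span_superset])
  have surj: "z \<in> span (T ` E)" if "z \<in> Z" for z
  proof (rule ccontr)
    assume n: "z \<notin> span (T ` E)"
    then have "independent (insert z (T ` E))" using TE by (simp add: independent_insert)
    moreover have "insert z (T ` E) \<subseteq> span E" using TEZ that span_E by simp
    ultimately have "card (insert z (T ` E)) \<le> card E" using independent_span_bound[OF finE] by blast
    moreover have "z \<notin> T ` E" using n span_base[of z "T ` E"] by (rule contrapos_nn)
    ultimately show False using finE cardTE by simp
  qed
  have "cls B' z' \<in> F ` cls B ` Z" unfolding FZ using z' by (rule imageI)
  then obtain z where z: "z \<in> Z" "F (cls B z) = cls B' z'" by auto
  have "z \<in> T ` span E" using surj[OF z(1)] linear_span_image[OF T(1)] by simp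
  then obtain y where y: "y \<in> Z" "z = T y" using span_E by blast
  obtain u v where uv: "u \<in> span b" "v \<in> span c" "y = u + v" using decomp[OF y(1)] by blast
  have "z - T v = u" using y(2) Tb[OF uv(1)] by (simp add: uv(3) linear_add[OF T(1)])
  then have "cls B z = cls B (T v)" using cls_eq_iff[OF B] uv(1) span_b by auto
  then have "cls B' z' = cls B' (i v)" using z(2) Tc[OF uv(2)] by simp
  then have "z' - i v \<in> B'" using cls_eq_iff[OF B'] by blast
  then show ?thesis using uv(2) span_c by blast
qed

text \<open>The retraction \<open>r\<close> gives injectivity, and \<open>r x\<close> represents a preimage of the class of \<open>x\<close>.\<close>

lemma quot_iso_of_retraction:
  fixes i :: "'v::real_vector \<Rightarrow> 'w::real_vector"
  assumes B: "subspace B" and B': "subspace B'"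
    and i: "linear i" "i ` B \<subseteq> B'" "i ` P \<subseteq> P'"
    and r: "\<And>z. z \<in> P \<Longrightarrow> r (i z) = z" "r ` P' \<subseteq> P"
      "\<And>x y. x \<in> P' \<Longrightarrow> y \<in> P' \<Longrightarrow> x - y \<in> B' \<Longrightarrow> r x - r y \<in> B"
    and surj: "\<And>x. x \<in> P' \<Longrightarrow> x - i (r x) \<in> B'"
  shows "quot_iso B B' (cls B ` P) (cls B' ` P') (\<lambda>S. \<Union>z\<in>S. cls B' (i z))"
proof -
  let ?h = "\<lambda>S. \<Union>z\<in>S. cls B' (i z)"
  have h: "?h (cls B z) = cls B' (i z)" for z
  proof -
    have "cls B' (i x) = cls B' (i z)" if x: "x \<in> cls B z" for x
    proof -
      obtain b where "b \<in> B" "x = z + b" using x by (auto simp: cls_def)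
      then show ?thesis using i(2) cls_eq_iff[OF B'] by (auto simp: linear_add[OF i(1)])
    qed
    moreover have "z \<in> cls B z" using subspace_0[OF B] by (force simp: cls_def)
    ultimately show ?thesis by blast
  qed
  have "inj_on ?h (cls B ` P)"
  proof (rule inj_onI)
    fix S S' assume "S \<in> cls B ` P" "S' \<in> cls B ` P" and eq: "?h S = ?h S'"
    then obtain x y where xy: "x \<in> P" "S = cls B x" "y \<in> P" "S' = cls B y" by blast
    then have "i x - i y \<in> B'" using eq cls_eq_iff[OF B'] by (simp only: h)
    then have "r (i x) - r (i y) \<in> B" using r(3) i(3) xy by blast
    then have "x - y \<in> B" using r(1) xy by simp
    then show "S = S'" using cls_eq_iff[OF B] xy by blast
  qed
  moreover have "?h ` cls B ` P = cls B' ` P'"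
  proof
    show "?h ` cls B ` P \<subseteq> cls B' ` P'" unfolding image_image h using i(3) by blast
    show "cls B' ` P' \<subseteq> ?h ` cls B ` P"
    proof
      fix S assume "S \<in> cls B' ` P'"
      then obtain x where x: "x \<in> P'" "S = cls B' x" by blast
      have "S = cls B' (i (r x))" using x cls_eq_iff[OF B'] surj by blast
      then show "S \<in> ?h ` cls B ` P" unfolding image_image h using r(2) x(1) by blast
    qed
  qed
  ultimately show ?thesis
    unfolding quot_iso_def bij_betw_def
    by (auto simp: cls_add_cls[OF B] cls_add_cls[OF B'] cls_scale_cls[OF B] cls_scale_cls[OF B'] h
        linear_add[OF i(1)] linear_cmul[OF i(1)] simp del: UN_simps)
qed

section \<open>Comparison of the cohomology groups\<close>

context lie_lattice
begin

text \<open>Every closed form \<open>x\<close> is cohomologous to the left-invariant form of its average; as averaging preserves the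
  type with respect to \<open>J\<close>, it is a retraction on the forms of this type as well.\<close>

lemma natural_hom_quot_iso:
  assumes J: "almost_complex_structure_on \<gg> J"
    and F: "quot_iso (ce_exact \<gg> br) (exact_forms N) (ce_H2 \<gg> br) (deRham_H2 N) F"
  shows "quot_iso (ce_exact \<gg> br) (exact_forms N) (ce_HJ s \<gg> br J) (deRham_HJ s N (JN J)) (natural_hom G X \<Gamma>)"
proof -
  let ?B = "ce_exact \<gg> br" and ?B' = "exact_forms N" and ?Z = "ce_closed \<gg> br" and ?Z' = "closed_forms N"
  have ZA: "?Z \<subseteq> alt_forms2 \<gg>" by (auto simp: ce_closed_def)
  have Z2: "?Z' \<subseteq> two_forms N" by (auto simp: closed_forms_def)
  have avg_lif: "avg2 (lif z) = z" if "z \<in> ?Z" for z using avg2_left_inv that ZA by blast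
  have lifB: "lif ` ?B \<subseteq> ?B'" and lifZ: "lif ` ?Z \<subseteq> ?Z'" using lif_exact lif_closed by blast+
  have avgB: "avg2 x - avg2 y \<in> ?B" if "x \<in> ?Z'" "y \<in> ?Z'" "x - y \<in> ?B'" for x y
    using avg2_exact[OF that(3)] unfolding avg2_diff[OF subsetD[OF Z2 that(1)] subsetD[OF Z2 that(2)]] .
  obtain S where S: "finite S" "?Z \<subseteq> span S" using finite_dim_alt_forms2 ZA by blast
  have surj: "x - lif (avg2 x) \<in> ?B'" if x: "x \<in> ?Z'" for x
  proof -
    have "\<exists>z\<in>?Z. x - lif z \<in> ?B'"
    proof (rule injective_imp_surjective_quotient[OF subspace_ce_exact subspace_exact_forms subspace_ce_closed S linear_lif lifZ
          _ F[unfolded ce_H2_def deRham_H2_def] x])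
      show "z \<in> ?B" if "z \<in> ?Z" "lif z \<in> ?B'" for z
        using avg2_exact[OF that(2)] avg_lif[OF that(1)] by simp
    qed
    then obtain z where z: "z \<in> ?Z" "x - lif z \<in> ?B'" by blast
    have "avg2 x - z \<in> ?B" using avgB[OF x _ z(2)] lifZ z(1) avg_lif by auto
    then have "lif (avg2 x) - lif z \<in> ?B'" using lifB by (auto simp: linear_diff[OF linear_lif, symmetric])
    then have "(x - lif z) - (lif (avg2 x) - lif z) \<in> ?B'" using subspace_diff[OF subspace_exact_forms z(2)] by blast
    then show ?thesis by simp
  qed
  let ?P = "{\<alpha> \<in> ?Z. \<forall>u\<in>\<gg>. \<forall>v\<in>\<gg>. \<alpha> (J u) (J v) = s * \<alpha> u v}"
  let ?P' = "{\<alpha> \<in> ?Z'. \<forall>p\<in>points N. \<forall>u\<in>tangent_space N p. \<forall>v\<in>tangent_space N p.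
       \<alpha> p (JN J p u) (JN J p v) = s * \<alpha> p u v}"
  have "quot_iso ?B ?B' (cls ?B ` ?P) (cls ?B' ` ?P') (\<lambda>S. \<Union>z\<in>S. cls ?B' (lif z))"
  proof (rule quot_iso_of_retraction[OF subspace_ce_exact subspace_exact_forms linear_lif lifB, where r = avg2])
    show "lif ` ?P \<subseteq> ?P'"
    proof
      fix x assume "x \<in> lif ` ?P"
      then obtain \<beta> where \<beta>: "\<beta> \<in> ?Z" "\<forall>u\<in>\<gg>. \<forall>v\<in>\<gg>. \<beta> (J u) (J v) = s * \<beta> u v" "x = lif \<beta>" by blast
      then show "x \<in> ?P'" using lif_closed[OF \<beta>(1)] left_inv_J[OF J \<beta>(2)] by simp
    qed
    show "avg2 (lif z) = z" if "z \<in> ?P" for z using avg_lif that by blast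
    show "avg2 ` ?P' \<subseteq> ?P"
    proof
      fix x assume "x \<in> avg2 ` ?P'"
      then obtain \<alpha> where \<alpha>: "\<alpha> \<in> ?Z'" "\<forall>p\<in>points N. \<forall>u\<in>tangent_space N p. \<forall>v\<in>tangent_space N p.
          \<alpha> p (JN J p u) (JN J p v) = s * \<alpha> p u v" "x = avg2 \<alpha>" by blast
      then show "x \<in> ?P" using avg2_closed[OF \<alpha>(1)] avg2_J[OF J \<alpha>(2)] by simp
    qed
    show "avg2 x - avg2 y \<in> ?B" if "x \<in> ?P'" "y \<in> ?P'" "x - y \<in> ?B'" for x y using avgB that by blast
    show "x - lif (avg2 x) \<in> ?B'" if "x \<in> ?P'" for x using surj that by blast
  qed
  then show ?thesis unfolding ce_HJ_def deRham_HJ_def natural_hom_def[abs_def] .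
qed

end

theorem theorem4p1:
  fixes G :: "('a, 'b) monoid_scheme"
    and X :: "('a, real ^ 4) mfd"
    and \<Gamma> :: "'a set"
    and J :: "'a tvec \<Rightarrow> 'a tvec"
  defines "\<gg> \<equiv> lie_algebra G X"
    and "br \<equiv> lie_bracket G X"
    and "M \<equiv> quotient_mfd G X \<Gamma>"
  assumes "lie_group G X"
    and "simply_connected_space (mtop X)"
    and "discrete_subgroup G X \<Gamma>"
    and "compact_space (mtop M)"
    and "almost_complex_structure_on \<gg> J"
    and "\<exists>F. quot_iso (ce_exact \<gg> br) (exact_forms M) (ce_H2 \<gg> br) (deRham_H2 M) F"
  shows "quot_iso (ce_exact \<gg> br) (exact_forms M)
           (ce_HJ 1 \<gg> br J) (deRham_HJ 1 M (induced_J G X \<Gamma> J)) (natural_hom G X \<Gamma>)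
       \<and> quot_iso (ce_exact \<gg> br) (exact_forms M)
           (ce_HJ (- 1) \<gg> br J) (deRham_HJ (- 1) M (induced_J G X \<Gamma> J)) (natural_hom G X \<Gamma>)"
proof -
  have G: "group G" and pts: "points X = carrier G" and mf: "smooth_manifold X"
    using assms(4) by (auto simp: lie_group_def)
  have "\<one>\<^bsub>G\<^esub> \<in> (\<Union>(U, \<phi>)\<in>charts X. U)"
    using mf pts group.is_monoid[OF G] monoid.one_closed by (auto simp: smooth_manifold_def)
  then obtain U \<phi> where "(U, \<phi>) \<in> charts X" "\<one>\<^bsub>G\<^esub> \<in> U" by auto
  then interpret lie_lattice G X U \<phi> \<Gamma>
    using assms(4,6,7) by unfold_locales (auto simp: M_def)
  obtain F where "quot_iso (ce_exact \<gg> br) (exact_forms M) (ce_H2 \<gg> br) (deRham_H2 M) F"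
    using assms(9) by blast
  from natural_hom_quot_iso[OF assms(8)[unfolded \<gg>_def] this[unfolded \<gg>_def br_def M_def]]
  show ?thesis unfolding \<gg>_def br_def M_def by blast
qed

end
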